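(* Let $k\ge3$ be an integer. The set $\mathrm{Reg}_D\cap\mathrm{CI}_D$ contains a dense $G_\delta$ subset of $\mathcal{D}$.
   Context: $\mathbb{N}$ includes $0$. An overline denotes infinite repetition. $\Delta=\{\boldsymbol\alpha\in\mathbb{R}^k_{\ge0} : \sum_{i=0}^{k-1}\alpha_i=1\}$ with the Euclidean metric; $\mathcal{C}(\Delta)$ is the space of non-empty compact subsets of $\Delta$ with the Hausdorff metric. $\Delta'=\{\boldsymbol\alpha\in\Delta:\alpha_{k-1}\ne0\}$. Itinerary map. For $n\in\mathbb{N}$, $\Delta_n=\{\boldsymbol\alpha\in\Delta':\lfloor\alpha_0/\alpha_{k-1}\rfloor=n\}$; these sets partition $\Delta'$. Let $J(\boldsymbol\alpha)=\lfloor\alpha_0/\alpha_{k-1}\rfloor$ and define $K\colon\Delta'\to\Delta'$ by $$K(\boldsymbol\alpha)=\left(\tfrac{\alpha_1}{1-\alpha_0},\ldots,\tfrac{\alpha_{k-2}}{1-\alpha_0},\tfrac{\alpha_0-n\alpha_{k-1}}{1-\alpha_0},\tfrac{(n+1)\alpha_{k-1}-\alpha_0}{1-\alpha_0}\right),\quad n=J(\boldsymbol\alpha).$$ The itinerary map $\Phi\colon\Delta'\to\mathbb{N}^{\mathbb{N}}$ is $\Phi(\boldsymbol\alpha)_r=J(K^r(\boldsymbol\alpha))$; it is surjective. Digit frequency sets. $\Sigma=\{0,\ldots,k-1\}^{\mathbb{N}}$ is ordered lexicographically, with shift map $\sigma$. For $n\in\mathbb{N}$, $\Lambda_n$ is the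 substitution with $i\mapsto(i+1)$ for $0\le i\le k-3$, $(k-2)\mapsto(k-1)0^{n+1}$, $(k-1)\mapsto(k-1)0^n$. For $\mathbf{n}\in\mathbb{N}^{\mathbb{N}}$ set $S(\mathbf{n})=\lim_{r\to\infty}\Lambda_{n_0}\circ\cdots\circ\Lambda_{n_r}(\overline{k-1})\in\Sigma$, $X(S(\mathbf{n}))=\{v\in\Sigma:\sigma^r(v)\le S(\mathbf{n})\text{ for all }r\in\mathbb{N}\}$, and let $\mathrm{DF}(\mathbf{n})\in\mathcal{C}(\Delta)$ be the set of $\boldsymbol\alpha\in\Delta$ for which some $v\in X(S(\mathbf{n}))$ has digit frequency $\boldsymbol\alpha$, i.e. for each $i$ the proportion of digits $i$ among the first $r$ entries of $v$ tends to $\alpha_i$ as $r\to\infty$. $\mathcal{D}=\{\mathrm{DF}(\mathbf{n}):\mathbf{n}\in\mathbb{N}^{\mathbb{N}}\setminus\{\overline{0}\}\}$, with the topology induced from $\mathcal{C}(\Delta)$. (This is the same as the set of all digit frequency sets of greedy $\beta$-expansions for $\beta\in(k-1,k)$.) An element $\boldsymbol\alpha\in\Delta'$ is completely irrational if there is no relation $\sum_{i=0}^{k-1}m_i\alpha_i=0$ with integers $m_i$ not all zero; it is regular if $\Phi^{-1}(\Phi(\boldsymbol\alpha))=\{\boldsymbol\alpha\}$. Let $\mathrm{Reg}_D$ be the set of all $\mathrm{DF}(\Phi(\boldsymbol\alpha))$ with $\boldsymbol\alpha\in\Delta'$ regular, and $\mathrm{CI}_D$ the set of all $\mathrm{DF}(\Phi(\boldsymbol\alpha))$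 with $\boldsymbol\alpha\in\Delta'$ completely irrational. *)

theory Defs
  imports "HOL-Analysis.Analysis" "HOL-Library.Fun_Lexorder"
begin

section \<open>The Hausdorff metric on non-empty compact subsets of a metric space\<close>

definition compact_sets :: "'a set \<Rightarrow> ('a \<Rightarrow> 'a \<Rightarrow> real) \<Rightarrow> 'a set set" where
  "compact_sets M d = {A. A \<noteq> {} \<and> compactin (Metric_space.mtopology M d) A}"

text \<open>Suprema of unbounded sets of reals are unspecified, while the locale \<^locale>\<open>Metric_space\<close>
  constrains the metric on the whole type; hence the default value 0 outside the carrier.\<close>

definition hausdorff_dist ::
    "'a set \<Rightarrow> ('a \<Rightarrow> 'a \<Rightarrow> real) \<Rightarrow> 'a set \<Rightarrow> 'a set \<Rightarrow> real" where
  "hausdorff_dist M d A B =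
     (if A \<in> compact_sets M d \<and> B \<in> compact_sets M d
      then max (SUP a\<in>A. INF b\<in>B. d a b) (SUP b\<in>B. INF a\<in>A. d a b)
      else 0)"

context Metric_space
begin

lemma compact_sets_bounded:
  assumes "A \<in> compact_sets M d" "B \<in> compact_sets M d"
  obtains C where "\<And>a b. a \<in> A \<Longrightarrow> b \<in> B \<Longrightarrow> d a b \<le> C"
proof -
  have "mbounded (A \<union> B)"
    using assms compactin_imp_mbounded mbounded_Un by (auto simp: compact_sets_def)
  then obtain C where "\<forall>x\<in>A \<union> B. \<forall>y\<in>A \<union> B. d x y \<le> C"
    unfolding mbounded_alt by auto
  then show ?thesis using that by blast
qed

lemma compact_sets_subset: "A \<in> compact_sets M d \<Longrightarrow> A \<subseteq> M"
  using compactin_subset_topspace[of mtopology A] by (auto simp: compact_sets_def)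

lemma inf_dist_nonneg: "B \<noteq> {} \<Longrightarrow> 0 \<le> (INF b\<in>B. d a b)"
  by (intro cINF_greatest) auto

lemma inf_dist_le: "b \<in> B \<Longrightarrow> (INF b\<in>B. d a b) \<le> d a b"
  by (intro cINF_lower bdd_belowI2[where m = 0]) auto

lemma inf_dist_le_excess:
  assumes A: "A \<in> compact_sets M d" and B: "B \<in> compact_sets M d" and a: "a \<in> A"
  shows "(INF b\<in>B. d a b) \<le> (SUP a\<in>A. INF b\<in>B. d a b)"
proof -
  obtain C where C: "\<And>a b. a \<in> A \<Longrightarrow> b \<in> B \<Longrightarrow> d a b \<le> C"
    using compact_sets_bounded[OF A B] by blast
  obtain b where b: "b \<in> B" using B by (auto simp: compact_sets_def)
  have "bdd_above ((\<lambda>a. INF b\<in>B. d a b) ` A)"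
    by (rule bdd_aboveI2[where M = C]) (meson C b inf_dist_le order_trans)
  then show ?thesis using a by (intro cSUP_upper)
qed

lemma excess_nonneg:
  assumes A: "A \<in> compact_sets M d" and B: "B \<in> compact_sets M d"
  shows "0 \<le> (SUP a\<in>A. INF b\<in>B. d a b)"
proof -
  obtain a where "a \<in> A" using A by (auto simp: compact_sets_def)
  then show ?thesis
    using inf_dist_le_excess[OF A B] inf_dist_nonneg[of B a] B
    by (force simp: compact_sets_def)
qed

lemma excess_eq_0_imp_subset:
  assumes A: "A \<in> compact_sets M d" and B: "B \<in> compact_sets M d"
    and le: "(SUP a\<in>A. INF b\<in>B. d a b) \<le> 0"
  shows "A \<subseteq> B"
proof
  fix a assume a: "a \<in> A"
  have "(INF b\<in>B. d a b) \<le> 0"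
    using inf_dist_le_excess[OF A B a] le by simp
  moreover have "B \<noteq> {}" and cl: "closedin mtopology B"
    using B by (auto simp: compact_sets_def compactin_imp_closedin Hausdorff_space_mtopology)
  moreover have "bdd_below (d a ` B)"
    by (intro bdd_belowI2[where m = 0]) auto
  ultimately have near: "\<exists>b\<in>B. d a b < r" if "r > 0" for r
    using that cINF_less_iff[of B "d a" r] by auto
  have "a \<in> M" using a A compact_sets_subset by blast
  then have "a \<in> mtopology closure_of B"
    unfolding metric_closure_of using near compact_sets_subset[OF B] by fastforce
  then show "a \<in> B" using cl by (simp add: closure_of_closedin)
qed

lemma excess_self:
  assumes A: "A \<in> compact_sets M d"
  shows "(SUP a\<in>A. INF b\<in>A. d a b) = 0"
proof -
  have "(INF b\<in>A. d a b) = 0" if "a \<in> A" for a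
    using inf_dist_le[OF that, of a] inf_dist_nonneg[of A a] that compact_sets_subset[OF A]
    by force
  then show ?thesis using A by (auto simp: compact_sets_def)
qed

lemma excess_triangle:
  assumes A: "A \<in> compact_sets M d" and B: "B \<in> compact_sets M d" and C: "C \<in> compact_sets M d"
  shows "(SUP a\<in>A. INF c\<in>C. d a c)
           \<le> (SUP a\<in>A. INF b\<in>B. d a b) + (SUP b\<in>B. INF c\<in>C. d b c)"
proof (rule cSUP_least)
  show "A \<noteq> {}" using A by (simp add: compact_sets_def)
  fix a assume a: "a \<in> A"
  let ?BC = "SUP b\<in>B. INF c\<in>C. d b c"
  have ne: "B \<noteq> {}" "C \<noteq> {}" using B C by (auto simp: compact_sets_def)
  have 1: "(INF c\<in>C. d a c) - ?BC \<le> d a b" if b: "b \<in> B" for b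
  proof -
    have "(INF c\<in>C. d a c) - d a b \<le> d b c" if c: "c \<in> C" for c
    proof -
      have "d a c \<le> d a b + d b c"
        using a b c compact_sets_subset[OF A] compact_sets_subset[OF B] compact_sets_subset[OF C]
        by (intro triangle) auto
      then show ?thesis using inf_dist_le[OF c, of a] by linarith
    qed
    then have "(INF c\<in>C. d a c) - d a b \<le> (INF c\<in>C. d b c)"
      using ne by (intro cINF_greatest) auto
    then show ?thesis using inf_dist_le_excess[OF B C b] by linarith
  qed
  have "(INF c\<in>C. d a c) - ?BC \<le> (INF b\<in>B. d a b)"
    using ne 1 by (intro cINF_greatest) auto
  then show "(INF c\<in>C. d a c) \<le> (SUP a\<in>A. INF b\<in>B. d a b) + ?BC"
    using inf_dist_le_excess[OF A B a] by linarith
qed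

lemma hausdorff_dist_alt:
  assumes "A \<in> compact_sets M d" "B \<in> compact_sets M d"
  shows "hausdorff_dist M d A B = max (SUP a\<in>A. INF b\<in>B. d a b) (SUP b\<in>B. INF a\<in>A. d b a)"
  using assms by (simp add: hausdorff_dist_def commute)

theorem Metric_space_hausdorff_dist: "Metric_space (compact_sets M d) (hausdorff_dist M d)"
proof
  fix A B C
  show "0 \<le> hausdorff_dist M d A B"
    using excess_nonneg[of A B] by (auto simp: hausdorff_dist_def max_def)
  show "hausdorff_dist M d A B = hausdorff_dist M d B A"
    by (simp add: hausdorff_dist_def commute max.commute)
  assume A: "A \<in> compact_sets M d" and B: "B \<in> compact_sets M d"
  show "hausdorff_dist M d A B = 0 \<longleftrightarrow> A = B"
    using excess_eq_0_imp_subset[OF A B] excess_eq_0_imp_subset[OF B A] excess_self[OF A] A B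
    by (auto simp: hausdorff_dist_alt max_def split: if_splits)
  assume C: "C \<in> compact_sets M d"
  show "hausdorff_dist M d A C \<le> hausdorff_dist M d A B + hausdorff_dist M d B C"
    using excess_triangle[OF A B C] excess_triangle[OF C B A] A B C
    by (auto simp: hausdorff_dist_alt)
qed

end


section \<open>The simplex\<close>

text \<open>Vectors in \<open>\<real>\<^sup>k\<close> are functions \<open>nat \<Rightarrow> real\<close> vanishing at all indices \<open>i \<ge> k\<close>, as in
  \<^const>\<open>Euclidean_space\<close>.\<close>

definition unit_simplex :: "nat \<Rightarrow> (nat \<Rightarrow> real) set" where
  "unit_simplex k = {\<alpha>. (\<forall>i<k. 0 \<le> \<alpha> i) \<and> (\<forall>i\<ge>k. \<alpha> i = 0) \<and> (\<Sum>i<k. \<alpha> i) = 1}"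

definition unit_simplex' :: "nat \<Rightarrow> (nat \<Rightarrow> real) set" where
  "unit_simplex' k = {\<alpha> \<in> unit_simplex k. \<alpha> (k - 1) \<noteq> 0}"

definition edist :: "nat \<Rightarrow> (nat \<Rightarrow> real) \<Rightarrow> (nat \<Rightarrow> real) \<Rightarrow> real" where
  "edist k \<alpha> \<beta> = L2_set (\<lambda>i. \<alpha> i - \<beta> i) {..<k}"

lemma Metric_space_simplex: "Metric_space (unit_simplex k) (edist k)"
proof
  fix \<alpha> \<beta> \<gamma> :: "nat \<Rightarrow> real"
  show "0 \<le> edist k \<alpha> \<beta>" by (simp add: edist_def)
  show "edist k \<alpha> \<beta> = edist k \<beta> \<alpha>" by (simp add: edist_def L2_set_def power2_commute)
  show "edist k \<alpha> \<gamma> \<le> edist k \<alpha> \<beta> + edist k \<beta> \<gamma>"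
    using L2_set_triangle_ineq[of "\<lambda>i. \<alpha> i - \<beta> i" "\<lambda>i. \<beta> i - \<gamma> i" "{..<k}"]
    by (simp add: edist_def)
  assume "\<alpha> \<in> unit_simplex k" "\<beta> \<in> unit_simplex k"
  then have "\<alpha> = \<beta> \<longleftrightarrow> (\<forall>i<k. \<alpha> i = \<beta> i)"
    by (auto simp: unit_simplex_def fun_eq_iff) (metis not_le)
  then show "edist k \<alpha> \<beta> = 0 \<longleftrightarrow> \<alpha> = \<beta>"
    by (auto simp: edist_def L2_set_eq_0_iff)
qed

definition compact_simplex_top :: "nat \<Rightarrow> (nat \<Rightarrow> real) set topology" where
  "compact_simplex_top k =
     Metric_space.mtopology (compact_sets (unit_simplex k) (edist k))
       (hausdorff_dist (unit_simplex k) (edist k))"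


section \<open>The itinerary map\<close>

definition J_map :: "nat \<Rightarrow> (nat \<Rightarrow> real) \<Rightarrow> nat" where
  "J_map k \<alpha> = nat \<lfloor>\<alpha> 0 / \<alpha> (k - 1)\<rfloor>"

definition K_map :: "nat \<Rightarrow> (nat \<Rightarrow> real) \<Rightarrow> (nat \<Rightarrow> real)" where
  "K_map k \<alpha> = (\<lambda>i.
     if i < k - 2 then \<alpha> (i + 1) / (1 - \<alpha> 0)
     else if i = k - 2 then (\<alpha> 0 - real (J_map k \<alpha>) * \<alpha> (k - 1)) / (1 - \<alpha> 0)
     else if i = k - 1 then ((real (J_map k \<alpha>) + 1) * \<alpha> (k - 1) - \<alpha> 0) / (1 - \<alpha> 0)
     else 0)"

definition itinerary :: "nat \<Rightarrow> (nat \<Rightarrow> real) \<Rightarrow> (nat \<Rightarrow> nat)" where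
  "itinerary k \<alpha> = (\<lambda>r. J_map k ((K_map k ^^ r) \<alpha>))"


section \<open>Digit frequency sets\<close>

definition digit_seqs :: "nat \<Rightarrow> (nat \<Rightarrow> nat) set" where
  "digit_seqs k = {v. \<forall>i. v i < k}"

definition shift :: "(nat \<Rightarrow> 'a) \<Rightarrow> (nat \<Rightarrow> 'a)" where
  "shift v = (\<lambda>i. v (Suc i))"

definition lex_le :: "(nat \<Rightarrow> nat) \<Rightarrow> (nat \<Rightarrow> nat) \<Rightarrow> bool" where
  "lex_le v w \<longleftrightarrow> v = w \<or> less_fun v w"

definition subst_letter :: "nat \<Rightarrow> nat \<Rightarrow> nat \<Rightarrow> nat list" where
  "subst_letter k n i =
     (if i < k - 2 then [i + 1]
      else if i = k - 2 then (k - 1) # replicate (n + 1) 0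
      else (k - 1) # replicate n 0)"

text \<open>Every letter is mapped to a non-empty word, so the image of the first \<open>j + 1\<close> letters of
  \<open>v\<close> is a prefix of the image of \<open>v\<close> of length at least \<open>j + 1\<close>, and determines its \<open>j\<close>-th
  letter.\<close>

definition subst_seq :: "nat \<Rightarrow> nat \<Rightarrow> (nat \<Rightarrow> nat) \<Rightarrow> (nat \<Rightarrow> nat)" where
  "subst_seq k n v = (\<lambda>j. concat (map (\<lambda>i. subst_letter k n (v i)) [0..<Suc j]) ! j)"

text \<open>Convergence in \<open>\<Sigma>\<close> is pointwise: the product topology with discrete factors.
  The \<open>r\<close>-th term is \<open>\<Lambda>(n 0) \<circ> \<dots> \<circ> \<Lambda>(n r)\<close> applied to the constant sequence \<open>k - 1\<close>.\<close>

definition S_seq :: "nat \<Rightarrow> (nat \<Rightarrow> nat) \<Rightarrow> (nat \<Rightarrow> nat)" where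
  "S_seq k ns =
     (\<lambda>i. lim (\<lambda>r. foldr (subst_seq k) (map ns [0..<Suc r]) (\<lambda>_. k - 1) i))"

definition X_set :: "nat \<Rightarrow> (nat \<Rightarrow> nat) \<Rightarrow> (nat \<Rightarrow> nat) set" where
  "X_set k w = {v \<in> digit_seqs k. \<forall>r. lex_le ((shift ^^ r) v) w}"

definition has_digit_frequency :: "nat \<Rightarrow> (nat \<Rightarrow> nat) \<Rightarrow> (nat \<Rightarrow> real) \<Rightarrow> bool" where
  "has_digit_frequency k v \<alpha> \<longleftrightarrow>
     (\<forall>i<k. (\<lambda>r. real (card {j. j < r \<and> v j = i}) / real r) \<longlonglongrightarrow> \<alpha> i)"

definition DF :: "nat \<Rightarrow> (nat \<Rightarrow> nat) \<Rightarrow> (nat \<Rightarrow> real) set" where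
  "DF k ns = {\<alpha> \<in> unit_simplex k. \<exists>v \<in> X_set k (S_seq k ns). has_digit_frequency k v \<alpha>}"

definition DF_sets :: "nat \<Rightarrow> (nat \<Rightarrow> real) set set" where
  "DF_sets k = {DF k ns | ns. ns \<noteq> (\<lambda>_. 0)}"

definition DF_top :: "nat \<Rightarrow> (nat \<Rightarrow> real) set topology" where
  "DF_top k = subtopology (compact_simplex_top k) (DF_sets k)"


section \<open>Completely irrational and regular elements\<close>

definition completely_irrational :: "nat \<Rightarrow> (nat \<Rightarrow> real) \<Rightarrow> bool" where
  "completely_irrational k \<alpha> \<longleftrightarrow>
     \<not> (\<exists>m :: nat \<Rightarrow> int. (\<exists>i<k. m i \<noteq> 0) \<and> (\<Sum>i<k. of_int (m i) * \<alpha> i) = 0)"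

definition regular :: "nat \<Rightarrow> (nat \<Rightarrow> real) \<Rightarrow> bool" where
  "regular k \<alpha> \<longleftrightarrow> {\<beta> \<in> unit_simplex' k. itinerary k \<beta> = itinerary k \<alpha>} = {\<alpha>}"

definition Reg_D :: "nat \<Rightarrow> (nat \<Rightarrow> real) set set" where
  "Reg_D k = {DF k (itinerary k \<alpha>) | \<alpha>. \<alpha> \<in> unit_simplex' k \<and> regular k \<alpha>}"

definition CI_D :: "nat \<Rightarrow> (nat \<Rightarrow> real) set set" where
  "CI_D k = {DF k (itinerary k \<alpha>) | \<alpha>. \<alpha> \<in> unit_simplex' k \<and> completely_irrational k \<alpha>}"

end

theory Submission
  imports Defs
begin

text \<open>
  Call a finite word \<^emph>\<open>free\<close> for a sequence \<open>s\<close> if each of its non-empty suffixes becomes strictly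
  smaller than \<open>s\<close> within the word. Free words can be concatenated arbitrarily, and any word
  occurring in \<open>X_set k s\<close> becomes free after changing a single letter. Hence
  \<open>DF k n\<close> is the closure of the set of frequencies of free words of \<open>S_seq k n\<close>; it is therefore
  compact, it depends continuously on \<open>n\<close>, and it decreases when \<open>n\<close> increases lexicographically.

  The decrease is strict. A rearrangement of zeros desubstitutes free words, so
  membership in \<open>DF k n\<close> passes from \<open>\<alpha>\<close> to \<open>K_map k \<alpha>\<close> as long as the itinerary agrees with \<open>n\<close>, and
  \<open>\<alpha> \<in> DF k n\<close> forces \<open>itinerary k \<alpha> \<ge> n\<close>; conversely some \<open>\<alpha>\<close> with itinerary \<open>n\<close> lies in \<open>DF k n\<close>.
  So the image of every open lexicographic interval is relatively open in the Hausdorff metric.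

  The points whose itinerary begins with a given word form a simplex, the image of the whole simplex
  under a product of substitution matrices. A long block of zeros contracts this simplex
  to one of its vertices, and the preceding digits can be chosen so that this vertex avoids a given
  rational hyperplane. Requiring, for each \<open>j\<close>, that some initial simplex has diameter below
  \<open>1 / (j + 1)\<close> and misses the \<open>j\<close>-th rational hyperplane defines a countable intersection of
  dense open sets consisting of itineraries of regular, completely irrational points.
\<close>

section \<open>Words and substitutions\<close>

text \<open>Freeness of a word of length \<open>L\<close> depends only on the first \<open>L\<close>
  letters of the bounding sequence, so it transfers between sequences with a common prefix, and it
  survives concatenation. The non-strict inequality that defines \<open>X_set\<close> has no such
  finite version.

  The form of the G-delta set is dictated by the sequences ending in zeros. Such a sequence cannot
  be approached from below in the lexicographic order: lowering it changes an entry before the zero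
  tail. So, unless it is constantly zero, every open lexicographic interval around it contains
  sequences with a different prefix. The sets \<open>DF k n\<close> are compared by inclusion only,
  hence an interval can isolate a long prefix only around a sequence with infinitely many non-zero
  entries. The open sets are therefore unions of intervals all of whose members satisfy the required
  condition, and density is shown with generic sequences that have infinitely many non-zero
  entries.\<close>

definition concat_seq :: "(nat \<Rightarrow> 'a list) \<Rightarrow> nat \<Rightarrow> 'a" where
  "concat_seq f j = concat (map f [0..<Suc j]) ! j"

lemma length_concat_ge:
  assumes "\<And>i. f i \<noteq> []"
  shows "L \<le> length (concat (map f [0..<L]))"
proof (induction L)
  case (Suc L)
  have "0 < length (f L)" using assms by blast
  then have "Suc 0 \<le> length (f L)" by linarith
  then show ?case using Suc by (simp del: length_greater_0_conv)
qed simp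

lemma nth_concat_upt:
  assumes "L \<le> L'" "j < length (concat (map f [0..<L]))"
  shows "concat (map f [0..<L']) ! j = concat (map f [0..<L]) ! j"
proof -
  have "[0..<L'] = [0..<L] @ [L..<L']"
    using assms(1) by (metis le_add_diff_inverse upt_add_eq_append zero_le)
  then show ?thesis using assms(2) by (simp add: nth_append)
qed

lemma concat_seq_nth:
  assumes "\<And>i. f i \<noteq> []" "j < length (concat (map f [0..<L]))"
  shows "concat_seq f j = concat (map f [0..<L]) ! j"
proof (cases "L \<le> Suc j")
  case True
  then show ?thesis using assms(2) by (simp only: concat_seq_def nth_concat_upt)
next
  case False
  have "Suc j \<le> length (concat (map f [0..<Suc j]))"
    using length_concat_ge[of f "Suc j"] assms(1) by blast
  then show ?thesis
    using nth_concat_upt[of "Suc j" L j f] False unfolding concat_seq_def by simp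
qed

lemma map_concat_seq:
  assumes "\<And>i. f i \<noteq> []"
  shows "map (concat_seq f) [0..<length (concat (map f [0..<L]))] = concat (map f [0..<L])"
  using concat_seq_nth[of f, OF assms] by (intro nth_equalityI) auto

definition subst_word :: "nat \<Rightarrow> nat \<Rightarrow> nat list \<Rightarrow> nat list" where
  "subst_word k n u = concat (map (subst_letter k n) u)"

lemma subst_word_simps [simp]:
  "subst_word k n [] = []"
  "subst_word k n (a # u) = subst_letter k n a @ subst_word k n u"
  "subst_word k n (u @ w) = subst_word k n u @ subst_word k n w"
  by (simp_all add: subst_word_def)

lemma subst_letter_nonempty [simp]: "subst_letter k n i \<noteq> []"
  by (simp add: subst_letter_def)

lemma length_subst_word: "length u \<le> length (subst_word k n u)"
proof (induction u)
  case (Cons a u)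
  have "Suc 0 \<le> length (subst_letter k n a)" by (simp add: Suc_le_eq)
  then show ?case using Cons by simp
qed simp

lemma subst_seq_eq_concat_seq: "subst_seq k n v = concat_seq (\<lambda>i. subst_letter k n (v i))"
  by (simp add: subst_seq_def concat_seq_def fun_eq_iff)

lemma subst_seq_nth:
  assumes "j < length (subst_word k n (map v [0..<L]))"
  shows "subst_seq k n v j = subst_word k n (map v [0..<L]) ! j"
  using concat_seq_nth[of "\<lambda>i. subst_letter k n (v i)" j L] assms
  by (simp add: subst_seq_eq_concat_seq subst_word_def comp_def)

lemma map_subst_seq:
  "map (subst_seq k n v) [0..<length (subst_word k n (map v [0..<L]))] = subst_word k n (map v [0..<L])"
  by (intro nth_equalityI) (auto simp: subst_seq_nth)

lemma subst_seq_next: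
  assumes "j < length (subst_letter k n (v L))"
  shows "subst_seq k n v (length (subst_word k n (map v [0..<L])) + j) = subst_letter k n (v L) ! j"
  using subst_seq_nth[of "length (subst_word k n (map v [0..<L])) + j" k n v "Suc L"] assms
  by (simp add: nth_append)

text \<open>Needed when the image of one letter is a proper prefix of the image of another: the
  comparison is then decided by the first letter of the following image.\<close>

lemma subst_seq_next2:
  assumes "j < length (subst_letter k n (v (Suc L)))"
  shows "subst_seq k n v (length (subst_word k n (map v [0..<L])) + length (subst_letter k n (v L)) + j)
           = subst_letter k n (v (Suc L)) ! j"
  using subst_seq_next[of j k n v "Suc L"] assms by (simp add: add.assoc)

section \<open>Words strictly below a sequence, and free words\<close>

definition word_below :: "nat list \<Rightarrow> (nat \<Rightarrow> nat) \<Rightarrow> bool" where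
  "word_below u s \<longleftrightarrow> (\<exists>j<length u. (\<forall>i<j. u ! i = s i) \<and> u ! j < s j)"

definition free_word :: "nat \<Rightarrow> (nat \<Rightarrow> nat) \<Rightarrow> nat list \<Rightarrow> bool" where
  "free_word k s u \<longleftrightarrow> set u \<subseteq> {..<k} \<and> (\<forall>i<length u. word_below (drop i u) s)"

lemma word_belowI:
  assumes "\<And>i. i < length p \<Longrightarrow> s i = p ! i" "x < s (length p)"
  shows "word_below (p @ x # q) s"
  unfolding word_below_def using assms
  by (intro exI[of _ "length p"]) (auto simp: nth_append)

lemma word_belowE:
  assumes "word_below u s"
  obtains p x q where "u = p @ x # q" "p = map s [0..<length p]" "x < s (length p)"
proof -
  obtain j where j: "j < length u" "\<forall>i<j. u ! i = s i" "u ! j < s j"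
    using assms by (auto simp: word_below_def)
  show thesis
  proof
    show "u = take j u @ u ! j # drop (Suc j) u" using j(1) by (rule id_take_nth_drop)
    show "take j u = map s [0..<length (take j u)]"
      using j by (intro nth_equalityI) auto
    show "u ! j < s (length (take j u))" using j by simp
  qed
qed

lemma word_below_append:
  assumes "word_below u s"
  shows "word_below (u @ w) s"
proof -
  obtain j where "j < length u" "\<forall>i<j. u ! i = s i" "u ! j < s j"
    using assms by (auto simp: word_below_def)
  then show ?thesis unfolding word_below_def
    by (intro exI[of _ j]) (auto simp: nth_append)
qed

lemma word_below_Cons: "a < s 0 \<Longrightarrow> word_below (a # u) s"
  using word_belowI[of "[]"] by simp

lemma word_below_trichotomy:
  obtains "word_below u s" | "u = map s [0..<length u]"
    | p a q where "u = p @ a # q" "p = map s [0..<length p]" "s (length p) < a"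
proof (cases "u = map s [0..<length u]")
  case False
  then have ex: "\<exists>i. i < length u \<and> u ! i \<noteq> s i"
    by (metis length_map length_upt minus_nat.diff_0 nth_equalityI nth_map_upt add_0)
  define j where "j = (LEAST i. i < length u \<and> u ! i \<noteq> s i)"
  have j: "j < length u" "u ! j \<noteq> s j"
    using LeastI_ex[OF ex] by (simp_all add: j_def)
  have below: "u ! i = s i" if "i < j" for i
    using not_less_Least[OF that[unfolded j_def]] that j by auto
  show thesis
  proof (cases "u ! j < s j")
    case True
    then show ?thesis using that(1) j below by (auto simp: word_below_def)
  next
    case False
    show ?thesis
    proof (rule that(3))
      show "u = take j u @ u ! j # drop (Suc j) u" using j(1) by (rule id_take_nth_drop)
      show "take j u = map s [0..<length (take j u)]"
        using j below by (intro nth_equalityI) auto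
      show "s (length (take j u)) < u ! j" using j False by simp
    qed
  qed
qed (use that in blast)

lemma word_below_not_prefix:
  assumes "word_below u s"
  shows "u \<noteq> map s [0..<length u]"
proof
  assume u: "u = map s [0..<length u]"
  obtain j where "j < length u" "u ! j < s j" using assms by (auto simp: word_below_def)
  moreover have "map s [0..<length u] ! j = s j" using \<open>j < length u\<close> by simp
  ultimately show False using u by simp
qed

lemma word_below_not_above:
  assumes "word_below (p @ q) s" "\<And>i. i < length p \<Longrightarrow> s i = p ! i" "q \<noteq> []"
  shows "q ! 0 \<le> s (length p)"
proof -
  obtain j where j: "j < length (p @ q)" "\<forall>i<j. (p @ q) ! i = s i" "(p @ q) ! j < s j"
    using assms(1) by (auto simp: word_below_def)
  have "\<not> j < length p" using j(3) assms(2)[of j] by (auto simp: nth_append)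
  then consider "j = length p" | "length p < j" by linarith
  then show ?thesis
  proof cases
    case 1
    then show ?thesis using j(3) by (simp add: nth_append)
  next
    case 2
    then have "(p @ q) ! length p = s (length p)" using j(2) by simp
    then show ?thesis by (simp add: nth_append)
  qed
qed

lemma word_below_less_fun:
  assumes "word_below u s" "less_fun s s'"
  shows "word_below u s'"
proof -
  obtain j where j: "j < length u" "\<forall>i<j. u ! i = s i" "u ! j < s j"
    using assms by (auto simp: word_below_def)
  obtain l where l: "s l < s' l" "\<And>i. i < l \<Longrightarrow> s i = s' i"
    using assms(2) by (auto elim: less_funE)
  \<comment> \<open>\<open>u\<close> leaves \<open>s\<close> at \<open>j\<close>, and
    \<open>s\<close> leaves \<open>s'\<close> at \<open>l\<close>; the earlier of the two positions
    decides.\<close>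
  show ?thesis
  proof (cases "j < l")
    case True
    then show ?thesis unfolding word_below_def
      using j l by (intro exI[of _ j]) auto
  next
    case False
    then show ?thesis unfolding word_below_def
      using j l by (intro exI[of _ l]) (cases "l = j"; auto)
  qed
qed

lemma less_fun_iff_word_below:
  "less_fun v s \<longleftrightarrow> (\<exists>L. word_below (map v [0..<L]) s)"
proof
  assume "less_fun v s"
  then obtain l where "v l < s l" "\<And>i. i < l \<Longrightarrow> v i = s i" by (auto elim: less_funE)
  then have "word_below (map v [0..<Suc l]) s"
    unfolding word_below_def by (intro exI[of _ l]) (auto simp del: upt_Suc)
  then show "\<exists>L. word_below (map v [0..<L]) s" ..
next
  assume "\<exists>L. word_below (map v [0..<L]) s"
  then obtain L j where "j < L" "\<forall>i<j. map v [0..<L] ! i = s i" "map v [0..<L] ! j < s j"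
    by (auto simp: word_below_def)
  then show "less_fun v s" by (intro less_funI exI[of _ j]) auto
qed

lemma word_below_cong:
  assumes "\<And>i. i < length u \<Longrightarrow> s i = s' i"
  shows "word_below u s \<longleftrightarrow> word_below u s'"
proof -
  have "(\<forall>i<j. u ! i = s i) \<and> u ! j < s j \<longleftrightarrow> (\<forall>i<j. u ! i = s' i) \<and> u ! j < s' j"
    if "j < length u" for j
    using assms that by auto
  then show ?thesis unfolding word_below_def by blast
qed

text \<open>The source of the continuity of \<open>DF\<close>: sequences that share a long prefix
  have the same short free words.\<close>

lemma free_word_cong:
  assumes "\<And>i. i < length u \<Longrightarrow> s i = s' i"
  shows "free_word k s u \<longleftrightarrow> free_word k s' u"
proof -
  have "word_below (drop i u) s \<longleftrightarrow> word_below (drop i u) s'" for i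
    using assms by (intro word_below_cong) auto
  then show ?thesis by (simp add: free_word_def)
qed

lemma free_word_less_fun: "free_word k s u \<Longrightarrow> less_fun s s' \<Longrightarrow> free_word k s' u"
  by (auto simp: free_word_def intro: word_below_less_fun)

lemma free_word_Nil [simp]: "free_word k s []"
  by (simp add: free_word_def)

lemma free_word_Cons:
  "free_word k s (a # u) \<longleftrightarrow> a < k \<and> word_below (a # u) s \<and> free_word k s u"
  by (auto simp: free_word_def less_Suc_eq_0_disj)

text \<open>A suffix that starts inside \<open>u\<close> is already decided inside \<open>u\<close>,
  so whatever follows cannot change the outcome.\<close>

lemma free_word_append: "free_word k s u \<Longrightarrow> free_word k s w \<Longrightarrow> free_word k s (u @ w)"
proof (induction u)
  case (Cons a u)
  then show ?case using word_below_append[of "a # u" s w] by (simp add: free_word_Cons)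
qed simp

lemma free_word_concat: "(\<And>u. u \<in> set us \<Longrightarrow> free_word k s u) \<Longrightarrow> free_word k s (concat us)"
  by (induction us) (auto intro: free_word_append)

lemma free_word_zeros: "0 < k \<Longrightarrow> 0 < s 0 \<Longrightarrow> free_word k s (replicate r 0)"
  by (induction r) (auto simp: free_word_Cons intro: word_below_Cons)

section \<open>Substitutions and the lexicographic order\<close>

locale alphabet =
  fixes k :: nat
  assumes k3: "3 \<le> k"
begin

lemma subst_letter_last: "subst_letter k n (k - 1) = (k - 1) # replicate n 0"
proof -
  have "\<not> k - 1 < k - 2" "k - 1 \<noteq> k - 2" using k3 by arith+
  then show ?thesis by (simp add: subst_letter_def)
qed

lemma subst_letter_penult: "subst_letter k n (k - 2) = (k - 1) # replicate (Suc n) 0"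
  by (simp add: subst_letter_def)

lemma subst_letter_small: "a < k - 2 \<Longrightarrow> subst_letter k n a = [a + 1]"
  by (simp add: subst_letter_def)

lemma subst_letter_hd: "i < k \<Longrightarrow> subst_letter k n i ! 0 = min (i + 1) (k - 1)"
  using k3 by (auto simp: subst_letter_def)

lemma set_subst_letter: "i < k \<Longrightarrow> set (subst_letter k n i) \<subseteq> {..<k}"
  using k3 by (auto simp: subst_letter_def)

lemma set_subst_word: "set u \<subseteq> {..<k} \<Longrightarrow> set (subst_word k n u) \<subseteq> {..<k}"
  by (induction u) (use set_subst_letter in auto)

lemma map_digit_seq: "v \<in> digit_seqs k \<Longrightarrow> set (map v [0..<L]) \<subseteq> {..<k}"
  by (auto simp: digit_seqs_def)

lemma subst_seq_digit: 
  assumes "v \<in> digit_seqs k"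
  shows "subst_seq k n v \<in> digit_seqs k"
proof -
  have "subst_seq k n v j < k" for j
  proof -
    have j: "j < length (subst_word k n (map v [0..<Suc j]))"
      using length_subst_word[of "map v [0..<Suc j]" k n] by simp
    then have "subst_word k n (map v [0..<Suc j]) ! j \<in> set (subst_word k n (map v [0..<Suc j]))"
      by (rule nth_mem)
    then show ?thesis
      using set_subst_word[OF map_digit_seq[OF assms, of "Suc j"], of n] subst_seq_nth[OF j] by auto
  qed
  then show ?thesis by (simp add: digit_seqs_def)
qed

lemma subst_seq_0: "v \<in> digit_seqs k \<Longrightarrow> subst_seq k n v 0 = min (v 0 + 1) (k - 1)"
  using subst_seq_next[of 0 k n v 0] subst_letter_hd[of "v 0" n] by (simp add: digit_seqs_def)

text \<open>The image of every letter starts with a non-zero letter; this decides the comparison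
  with anything that continues with a \<open>0\<close>.\<close>

lemma subst_word_hd:
  assumes "set u \<subseteq> {..<k}" "u \<noteq> []"
  shows "0 < subst_word k n u ! 0"
proof (cases u)
  case (Cons a u')
  then show ?thesis using assms subst_letter_hd[of a n] k3 by (simp add: nth_append)
qed (use assms in simp)

text \<open>First letters of images increase strictly with the letter, except that
  \<open>k - 2\<close> and \<open>k - 1\<close> both give \<open>k - 1\<close>. There the image of
  the smaller letter is that of the larger one with one more \<open>0\<close>, and this
  \<open>0\<close> meets the non-zero first letter of the next image.\<close>

lemma word_below_subst:
  assumes "word_below u s" "set u \<subseteq> {..<k}" "s \<in> digit_seqs k"
  shows "word_below (subst_word k n u) (subst_seq k n s)"
proof -
  obtain p a q where u: "u = p @ a # q" and p: "p = map s [0..<length p]" and a: "a < s (length p)"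
    using assms(1) by (rule word_belowE)
  let ?P = "subst_word k n p" and ?b = "s (length p)" and ?S = "subst_seq k n s"
  have b: "?b < k" "s (Suc (length p)) < k" using assms(3) by (auto simp: digit_seqs_def)
  have next1: "?S (length ?P + j) = subst_letter k n ?b ! j" if "j < length (subst_letter k n ?b)" for j
    using subst_seq_next[of j k n s "length p"] that p by simp
  have pre: "?S i = ?P ! i" if "i < length ?P" for i
    using subst_seq_nth[of i k n s "length p"] p that by simp
  show ?thesis
  proof (cases "a < k - 2")
    case True
    then have l: "subst_letter k n a = [a + 1]" by (simp add: subst_letter_def)
    have "a + 1 < ?S (length ?P)"
      using next1[of 0] subst_letter_hd[OF b(1), of n] a True by simp
    then show ?thesis using word_belowI[OF pre, of "a + 1" "subst_word k n q"] u l by simp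
  next
    case False
    then have a': "a = k - 2" "?b = k - 1" using a b by auto
    let ?w = "(k - 1) # replicate n 0"
    have la: "subst_letter k n a = ?w @ [0]"
      using a' by (simp add: subst_letter_def replicate_append_same)
    have lb: "subst_letter k n ?b = ?w" using a' subst_letter_last by simp
    have 1: "?S i = (?P @ ?w) ! i" if i: "i < length (?P @ ?w)" for i
    proof (cases "i < length ?P")
      case True
      then show ?thesis using pre by (simp add: nth_append)
    next
      case False
      then show ?thesis using next1[of "i - length ?P"] lb i by (simp add: nth_append)
    qed
    have "?S (length ?P + length (subst_letter k n ?b) + 0)
            = subst_letter k n (s (Suc (length p))) ! 0"
      using subst_seq_next2[of 0 k n s "length p"] p by simp
    then have 2: "0 < ?S (length (?P @ ?w))"
      using lb subst_letter_hd[OF b(2), of n] k3 by simp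
    show ?thesis using word_belowI[OF 1 2, of "subst_word k n q"] u la by simp
  qed
qed

text \<open>The other two cases of the trichotomy are excluded: a prefix of \<open>s\<close> is sent
  to a prefix of the image, and a word above \<open>s\<close> is sent above the image or, for the
  two top letters, possibly to a prefix of it.\<close>

lemma word_below_substD:
  assumes "word_below (subst_word k n u) (subst_seq k n s)" "set u \<subseteq> {..<k}" "s \<in> digit_seqs k"
  shows "word_below u s"
proof (cases rule: word_below_trichotomy[of u s])
  case 2
  then have "subst_word k n u = map (subst_seq k n s) [0..<length (subst_word k n u)]"
    using map_subst_seq[of k n s "length u"] by simp
  then show ?thesis using word_below_not_prefix[OF assms(1)] by simp
next
  case (3 p a q)
  let ?P = "subst_word k n p" and ?b = "s (length p)" and ?S = "subst_seq k n s"
  let ?u = "subst_word k n u"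
  have a: "a < k" "set q \<subseteq> {..<k}" using assms(2) 3 by auto
  have b: "?b < k" using assms(3) by (auto simp: digit_seqs_def)
  have next1: "?S (length ?P + j) = subst_letter k n ?b ! j" if "j < length (subst_letter k n ?b)" for j
    using subst_seq_next[of j k n s "length p"] that 3 by simp
  have pre: "?S i = ?P ! i" if "i < length ?P" for i
    using subst_seq_nth[of i k n s "length p"] 3 that by simp
  have False
  proof (cases "?b < k - 2")
    case True
    have "(subst_letter k n a @ subst_word k n q) ! 0 \<le> ?S (length ?P)"
      using word_below_not_above[of ?P "subst_letter k n a @ subst_word k n q" ?S] assms(1) 3(1) pre
      by simp
    moreover have "?S (length ?P) = ?b + 1" using next1[of 0] True by (simp add: subst_letter_def)
    moreover have "(subst_letter k n a @ subst_word k n q) ! 0 = subst_letter k n a ! 0"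
      by (simp add: nth_append)
    ultimately show False using subst_letter_hd[OF a(1), of n] 3(3) True by simp
  next
    case False
    then have b': "a = k - 1" "?b = k - 2" using 3(3) a b by auto
    let ?w = "(k - 1) # replicate n 0"
    have lb: "subst_letter k n ?b = ?w @ [0]"
      using b' by (simp add: subst_letter_def replicate_append_same)
    have la: "subst_letter k n a = ?w" using b' subst_letter_last by simp
    have u: "?u = (?P @ ?w) @ subst_word k n q" using 3(1) la by simp
    have 1: "?S i = (?P @ ?w) ! i" if i: "i < length (?P @ ?w)" for i
    proof (cases "i < length ?P")
      case True
      then show ?thesis using pre by (simp add: nth_append)
    next
      case False
      then show ?thesis using next1[of "i - length ?P"] lb i
        by (auto simp: nth_append nth_Cons' )
    qed
    have 2: "?S (length (?P @ ?w)) = 0"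
      using next1[of "length ?w"] lb by (simp add: nth_append)
    show False
    proof (cases "q = []")
      case True
      then have "?u = ?P @ ?w" using u by simp
      then have "?u = map ?S [0..<length ?u]"
        using 1 by (intro nth_equalityI) (simp_all del: upt_Suc)
      then show False using word_below_not_prefix[OF assms(1)] by simp
    next
      case False
      then have "subst_word k n q \<noteq> []" using length_subst_word[of q k n] by auto
      then have "subst_word k n q ! 0 \<le> ?S (length (?P @ ?w))"
        using word_below_not_above[OF assms(1)[unfolded u] 1] by blast
      then show False using 2 subst_word_hd[OF a(2) False, of n] by simp
    qed
  qed
  then show ?thesis ..
qed

lemma less_fun_subst:
  assumes "less_fun v w" "v \<in> digit_seqs k" "w \<in> digit_seqs k"
  shows "less_fun (subst_seq k n v) (subst_seq k n w)"
proof -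
  obtain L where "word_below (map v [0..<L]) w"
    using assms(1) by (auto simp: less_fun_iff_word_below)
  then have "word_below (subst_word k n (map v [0..<L])) (subst_seq k n w)"
    using word_below_subst map_digit_seq assms by blast
  then have "word_below (map (subst_seq k n v) [0..<length (subst_word k n (map v [0..<L]))])
      (subst_seq k n w)"
    by (simp only: map_subst_seq)
  then show ?thesis
    unfolding less_fun_iff_word_below by blast
qed

text \<open>The run of zeros behind the leading \<open>k - 1\<close> has length exactly
  \<open>m\<close>, so the first exponent can be read off from the image.\<close>

lemma subst_seq_start:
  assumes "s \<in> digit_seqs k" "s 0 = k - 1"
  shows "subst_seq k m s 0 = k - 1" "\<And>i. 0 < i \<Longrightarrow> i \<le> m \<Longrightarrow> subst_seq k m s i = 0"
    "0 < subst_seq k m s (Suc m)"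
proof -
  have l: "subst_letter k m (s 0) = (k - 1) # replicate m 0"
    using assms(2) subst_letter_last by simp
  show "subst_seq k m s 0 = k - 1" using subst_seq_next[of 0 k m s 0] l by simp
  show "subst_seq k m s i = 0" if "0 < i" "i \<le> m" for i
    using subst_seq_next[of i k m s 0] l that by simp
  have "s 1 < k" using assms(1) by (simp add: digit_seqs_def)
  then show "0 < subst_seq k m s (Suc m)"
    using subst_seq_next2[of 0 k m s 0] l subst_letter_hd[of "s 1" m] k3 by simp
qed

text \<open>A suffix of the image starts either with the full image of a letter, where
  \<open>word_below_subst\<close> applies, or inside a run of zeros, which is below because the
  bound starts with \<open>k - 1\<close>.\<close>

lemma free_word_subst:
  assumes "free_word k s u" "s \<in> digit_seqs k" "s 0 = k - 1"
  shows "free_word k (subst_seq k m s) (subst_word k m u)"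
  using assms(1)
proof (induction u)
  case (Cons a u)
  let ?S = "subst_seq k m s"
  have S0: "?S 0 = k - 1" by (rule subst_seq_start(1)[OF assms(2,3)])
  have a: "a < k" "word_below (a # u) s" "set (a # u) \<subseteq> {..<k}" and u: "free_word k ?S (subst_word k m u)"
    using Cons by (auto simp: free_word_Cons) (auto simp: free_word_def)
  have below: "word_below (subst_word k m (a # u)) ?S"
    by (rule word_below_subst[OF a(2,3) assms(2)])
  obtain b r where l: "subst_letter k m a = b # replicate r 0" "b < k"
  proof -
    consider "a < k - 2" | "a = k - 2" | "a = k - 1" using a(1) by linarith
    then show thesis
    proof cases
      case 1
      then show ?thesis using that[of "a + 1" 0] subst_letter_small by simp
    next
      case 2
      then show ?thesis using that[of "k - 1" "Suc m"] subst_letter_penult k3 by simp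
    next
      case 3
      then show ?thesis using that[of "k - 1" m] subst_letter_last k3 by simp
    qed
  qed
  have "free_word k ?S (replicate r 0 @ subst_word k m u)"
    using free_word_append[OF free_word_zeros u] S0 k3 by simp
  then show ?case using below l by (simp add: free_word_Cons)
qed simp

end

section \<open>The sequences \<open>S(n)\<close>\<close>

primrec subst_iter :: "nat \<Rightarrow> (nat \<Rightarrow> nat) \<Rightarrow> nat \<Rightarrow> (nat \<Rightarrow> nat) \<Rightarrow> (nat \<Rightarrow> nat)" where
  "subst_iter k n 0 v = v"
| "subst_iter k n (Suc N) v = subst_seq k (n 0) (subst_iter k (shift n) N v)"

lemma subst_iter_eq_foldr: "foldr (subst_seq k) (map n [0..<N]) v = subst_iter k n N v"
proof (induction N arbitrary: n)
  case (Suc N)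
  have "map n [0..<Suc N] = n 0 # map (shift n) [0..<N]"
    by (simp only: map_upt_Suc shift_def)
  then show ?case using Suc by (simp del: upt_Suc)
qed simp

lemma shift_funpow: "(shift ^^ r) n = (\<lambda>i. n (i + r))"
  by (induction r) (auto simp: shift_def fun_eq_iff)

lemma subst_iter_add: "subst_iter k n (M + N) v = subst_iter k n M (subst_iter k ((shift ^^ M) n) N v)"
proof (induction M arbitrary: n)
  case (Suc M)
  have "(shift ^^ Suc M) n = (shift ^^ M) (shift n)" by (simp only: funpow_Suc_right comp_def)
  then show ?case using Suc by simp
qed simp

lemma subst_iter_cong:
  "(\<And>i. i < N \<Longrightarrow> n i = n' i) \<Longrightarrow> subst_iter k n N v = subst_iter k n' N v"
proof (induction N arbitrary: n n')
  case (Suc N)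
  have "subst_iter k (shift n) N v = subst_iter k (shift n') N v"
    using Suc.prems by (intro Suc.IH) (auto simp: shift_def)
  then show ?case using Suc.prems[of 0] by simp
qed simp

lemma subst_seq_cong:
  assumes "\<And>i. i < L \<Longrightarrow> v i = w i" "j < length (subst_word k n (map v [0..<L]))"
  shows "subst_seq k n v j = subst_seq k n w j"
proof -
  have "map v [0..<L] = map w [0..<L]" using assms(1) by simp
  then show ?thesis
    using assms(2) subst_seq_nth[of j k n v L] subst_seq_nth[of j k n w L] by (simp only:)
qed

context alphabet
begin

lemma subst_iter_digit: "v \<in> digit_seqs k \<Longrightarrow> subst_iter k n N v \<in> digit_seqs k"
  by (induction N arbitrary: n) (auto intro: subst_seq_digit)

text \<open>After the common prefix both sequences continue with letters \<open>\<ge> t\<close>, hence with the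
  common letter \<open>k - 1\<close> when \<open>t = k - 1\<close>: each block of \<open>k - 1\<close> substitutions lengthens the
  common prefix, whatever the exponents.\<close>

lemma subst_iter_agree_aux:
  assumes "v \<in> digit_seqs k" "w \<in> digit_seqs k" "\<And>i. i < L \<Longrightarrow> v i = w i" "t \<le> k - 1"
  shows "\<exists>L'\<ge>L. (\<forall>i<L'. subst_iter k n t v i = subst_iter k n t w i) \<and>
           t \<le> subst_iter k n t v L' \<and> t \<le> subst_iter k n t w L'"
  using assms(4)
proof (induction t arbitrary: n)
  case 0
  then show ?case using assms(3) by auto
next
  case (Suc t)
  let ?v = "subst_iter k (shift n) t v" and ?w = "subst_iter k (shift n) t w"
  obtain L' where L': "L \<le> L'" "\<forall>i<L'. ?v i = ?w i" "t \<le> ?v L'" "t \<le> ?w L'"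
    using Suc.IH[of "shift n"] Suc.prems by auto
  have d: "?v L' < k" "?w L' < k"
    using subst_iter_digit assms(1,2) by (auto simp: digit_seqs_def)
  let ?L = "length (subst_word k (n 0) (map ?v [0..<L']))"
  have eq: "map ?v [0..<L'] = map ?w [0..<L']" using L' by simp
  have "L' \<le> ?L" using length_subst_word[of "map ?v [0..<L']" k "n 0"] by simp
  moreover have "subst_seq k (n 0) ?v i = subst_seq k (n 0) ?w i" if "i < ?L" for i
    using subst_seq_cong[of L' ?v ?w i k "n 0"] L' that by simp
  moreover have "Suc t \<le> subst_seq k (n 0) ?v ?L"
    using subst_seq_next[of 0 k "n 0" ?v L'] subst_letter_hd[OF d(1)] L' Suc.prems by simp
  moreover have "Suc t \<le> subst_seq k (n 0) ?w ?L"
    using subst_seq_next[of 0 k "n 0" ?w L'] subst_letter_hd[OF d(2)] L' Suc.prems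
    unfolding eq by simp
  ultimately show ?case
    using L'(1) by (intro exI[of _ ?L]) simp
qed

lemma subst_iter_agree:
  assumes "v \<in> digit_seqs k" "w \<in> digit_seqs k" "i < q" "q * (k - 1) \<le> N"
  shows "subst_iter k n N v i = subst_iter k n N w i"
proof -
  have 1: "\<forall>i<q. subst_iter k n (q * (k - 1)) v i = subst_iter k n (q * (k - 1)) w i"
    if "v \<in> digit_seqs k" "w \<in> digit_seqs k" for v w
  proof (induction q arbitrary: n)
    case (Suc q)
    let ?n = "(shift ^^ (k - 1)) n"
    let ?v = "subst_iter k ?n (q * (k - 1)) v" and ?w = "subst_iter k ?n (q * (k - 1)) w"
    have dig: "?v \<in> digit_seqs k" "?w \<in> digit_seqs k" using that subst_iter_digit by auto
    obtain L where L: "q \<le> L" "\<forall>i<L. subst_iter k n (k - 1) ?v i = subst_iter k n (k - 1) ?w i"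
      "k - 1 \<le> subst_iter k n (k - 1) ?v L" "k - 1 \<le> subst_iter k n (k - 1) ?w L"
      using subst_iter_agree_aux[OF dig, of q "k - 1" n] Suc by auto
    have "subst_iter k n (k - 1) ?v L < k" "subst_iter k n (k - 1) ?w L < k"
      using subst_iter_digit dig by (auto simp: digit_seqs_def)
    then have "subst_iter k n (k - 1) ?v L = subst_iter k n (k - 1) ?w L" using L by linarith
    then have "\<forall>i<Suc q. subst_iter k n (k - 1) ?v i = subst_iter k n (k - 1) ?w i"
      using L by (auto simp: less_Suc_eq) (metis le_neq_implies_less)
    then show ?case
      using subst_iter_add[of k n "k - 1" "q * (k - 1)"] by (simp del: subst_iter.simps)
  qed simp
  obtain M where M: "N = q * (k - 1) + M" using assms(4) le_Suc_ex by blast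
  show ?thesis
    unfolding M subst_iter_add using 1 subst_iter_digit assms(1-3) by blast
qed

lemma top_digit_seq: "(\<lambda>_. k - 1) \<in> digit_seqs k"
  using k3 by (simp add: digit_seqs_def)

text \<open>From stage \<open>N\<close> on, every term of the limit is the first \<open>N\<close>
  substitutions applied to some digit sequence, so letter \<open>i\<close> no longer changes. For
  the same reason every seed \<open>v\<close> produces it.\<close>

lemma S_seq_eq_subst_iter:
  assumes "v \<in> digit_seqs k" "Suc i * (k - 1) \<le> N"
  shows "S_seq k n i = subst_iter k n N v i"
proof -
  have ev: "foldr (subst_seq k) (map n [0..<Suc r]) (\<lambda>_. k - 1) i = subst_iter k n N v i"
    if "N \<le> r" for r
  proof -
    define M where "M = Suc r - N"
    have M: "Suc r = N + M" using that by (simp add: M_def)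
    show ?thesis
      unfolding subst_iter_eq_foldr M subst_iter_add
      using assms subst_iter_agree subst_iter_digit top_digit_seq by blast
  qed
  have "(\<lambda>r. foldr (subst_seq k) (map n [0..<Suc r]) (\<lambda>_. k - 1) i) \<longlonglongrightarrow> subst_iter k n N v i"
    by (intro tendsto_eventually eventually_mono[OF eventually_ge_at_top[of N] ev])
  then show ?thesis unfolding S_seq_def by (rule limI)
qed

lemma S_seq_digit: "S_seq k n \<in> digit_seqs k"
proof -
  have "S_seq k n i < k" for i
    using S_seq_eq_subst_iter[OF top_digit_seq order.refl, of n i]
      subst_iter_digit[OF top_digit_seq, of n "Suc i * (k - 1)"] by (simp add: digit_seqs_def)
  then show ?thesis by (simp add: digit_seqs_def)
qed

text \<open>A substitution commutes with the limit, since letter \<open>i\<close> of an image needs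
  only the letters up to \<open>i\<close> of the argument.\<close>

lemma S_seq_unfold: "S_seq k n = subst_seq k (n 0) (S_seq k (shift n))"
proof
  fix i
  let ?N = "Suc i * (k - 1)" and ?v = "\<lambda>_. k - 1"
  have "S_seq k n i = subst_iter k n (Suc ?N) ?v i"
    by (rule S_seq_eq_subst_iter[OF top_digit_seq]) simp
  also have "\<dots> = subst_seq k (n 0) (subst_iter k (shift n) ?N ?v) i" by simp
  also have "\<dots> = subst_seq k (n 0) (S_seq k (shift n)) i"
  proof (rule subst_seq_cong)
    show "subst_iter k (shift n) ?N ?v j = S_seq k (shift n) j" if "j < Suc i" for j
      by (rule S_seq_eq_subst_iter[symmetric, OF top_digit_seq])
        (use that in \<open>auto intro!: mult_le_mono1\<close>)
    show "i < length (subst_word k (n 0) (map (subst_iter k (shift n) ?N ?v) [0..<Suc i]))"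
      using length_subst_word[of "map (subst_iter k (shift n) ?N ?v) [0..<Suc i]" k "n 0"] by simp
  qed
  finally show "S_seq k n i = subst_seq k (n 0) (S_seq k (shift n)) i" .
qed

text \<open>Each unfolding raises a lower bound for the first letter by one, until
  \<open>k - 1\<close> is reached.\<close>

lemma S_seq_0: "S_seq k n 0 = k - 1"
proof -
  have "min t (k - 1) \<le> S_seq k n 0" for t
  proof (induction t arbitrary: n)
    case (Suc t)
    have "S_seq k n 0 = min (S_seq k (shift n) 0 + 1) (k - 1)"
      using S_seq_unfold[of n] subst_seq_0[OF S_seq_digit, of "n 0" "shift n"] by simp
    then show ?case using Suc[of "shift n"] by linarith
  qed simp
  from this[of "k - 1"] have "k - 1 \<le> S_seq k n 0" by simp
  moreover have "S_seq k n 0 < k" using S_seq_digit by (simp add: digit_seqs_def)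
  ultimately show ?thesis by simp
qed

lemma S_seq_agree:
  assumes "\<And>i. i < q * (k - 1) \<Longrightarrow> n i = n' i" "j < q"
  shows "S_seq k n j = S_seq k n' j"
proof -
  have le: "Suc j * (k - 1) \<le> q * (k - 1)" using assms(2) by (intro mult_le_mono1) simp
  show ?thesis
    using S_seq_eq_subst_iter[OF top_digit_seq le] subst_iter_cong[of "q * (k - 1)" n n' k] assms(1)
    by simp
qed

lemma S_seq_zero: "S_seq k (\<lambda>_. 0) = (\<lambda>_. k - 1)"
proof
  fix i
  have word: "subst_word k 0 u = u" if "set u \<subseteq> {k - 1}" for u
    using that
  proof (induction u)
    case (Cons a u)
    then have "subst_letter k 0 a = [a]" using subst_letter_last[of 0] by simp
    then show ?case using Cons by simp
  qed simp
  have fix1: "subst_seq k 0 (\<lambda>_. k - 1) = (\<lambda>_. k - 1)"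
  proof
    fix j
    let ?u = "map (\<lambda>_. k - 1) [0..<Suc j]"
    have "subst_word k 0 ?u = ?u" by (rule word) auto
    moreover have "j < length ?u" "?u ! j = k - 1" by (simp_all del: upt_Suc)
    ultimately show "subst_seq k 0 (\<lambda>_. k - 1) j = k - 1"
      using subst_seq_nth[of j k 0 "\<lambda>_. k - 1" "Suc j"] by metis
  qed
  have "subst_iter k (\<lambda>_. 0) N (\<lambda>_. k - 1) = (\<lambda>_. k - 1)" for N
    by (induction N) (simp_all only: subst_iter.simps shift_def fix1)
  then show "S_seq k (\<lambda>_. 0) i = k - 1"
    by (simp only: S_seq_eq_subst_iter[OF top_digit_seq order.refl, of "\<lambda>_. 0" i])
qed

text \<open>A larger first exponent puts more zeros behind the leading \<open>k - 1\<close> and so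
  lowers the sequence. Equal entries before the first difference are strictly increasing
  substitutions, which keep the inequality.\<close>

lemma S_seq_antimono:
  assumes "less_fun n n'"
  shows "less_fun (S_seq k n') (S_seq k n)"
proof -
  obtain r where "n r < n' r" "\<And>i. i < r \<Longrightarrow> n i = n' i" using assms by (auto elim: less_funE)
  then show ?thesis
  proof (induction r arbitrary: n n')
    case 0
    have "S_seq k n' i = S_seq k n i" if "i < Suc (n 0)" for i
    proof (cases "i = 0")
      case False
      then show ?thesis
        using that 0 subst_seq_start(2)[OF S_seq_digit S_seq_0, of i "n 0" "shift n"]
          subst_seq_start(2)[OF S_seq_digit S_seq_0, of i "n' 0" "shift n'"]
        by (simp add: S_seq_unfold[of n] S_seq_unfold[of n'])
    qed (simp add: S_seq_0)
    \<comment> \<open>The first position behind the zeros of \<open>n\<close>; the longer run of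
      zeros of \<open>n'\<close> still covers it.\<close>
    moreover have "S_seq k n' (Suc (n 0)) < S_seq k n (Suc (n 0))"
      using 0 subst_seq_start(3)[OF S_seq_digit S_seq_0, of "n 0" "shift n"]
        subst_seq_start(2)[OF S_seq_digit S_seq_0, of "Suc (n 0)" "n' 0" "shift n'"]
      by (simp add: S_seq_unfold[of n] S_seq_unfold[of n'])
    ultimately show ?case by (intro less_funI exI[of _ "Suc (n 0)"]) simp
  next
    case (Suc r)
    have "less_fun (S_seq k (shift n')) (S_seq k (shift n))"
      using Suc.prems by (intro Suc.IH) (auto simp: shift_def)
    moreover have "n 0 = n' 0" using Suc.prems by simp
    ultimately show ?case
      using less_fun_subst[OF _ S_seq_digit S_seq_digit]
      by (simp add: S_seq_unfold[of n] S_seq_unfold[of n'])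
  qed
qed

end

section \<open>Frequencies of free words\<close>

definition word_freq :: "nat list \<Rightarrow> nat \<Rightarrow> real" where
  "word_freq u i = real (count_list u i) / real (length u)"

lemma card_eq_count_list: "card {j. j < r \<and> v j = i} = count_list (map v [0..<r]) i"
proof (induction r)
  case (Suc r)
  have "{j. j < Suc r \<and> v j = i} = (if v r = i then insert r {j. j < r \<and> v j = i} else {j. j < r \<and> v j = i})"
    by (auto simp: less_Suc_eq)
  then show ?case using Suc by simp
qed simp

lemma count_list_replicate: "count_list (replicate r a) i = (if i = a then r else 0)"
  by (induction r) auto

lemma coordinates_eventually_near:
  fixes f :: "nat \<Rightarrow> nat \<Rightarrow> real"
  assumes "\<And>i. i < k \<Longrightarrow> (\<lambda>t. f t i) \<longlonglongrightarrow> l i" "0 < \<epsilon>"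
  obtains N where "\<And>t i. N \<le> t \<Longrightarrow> i < k \<Longrightarrow> \<bar>f t i - l i\<bar> < \<epsilon>"
proof -
  have "\<forall>i\<in>{..<k}. \<forall>\<^sub>F t in sequentially. dist (f t i) (l i) < \<epsilon>"
    using assms(2) by (intro ballI tendstoD[OF assms(1)]) auto
  then have "\<forall>\<^sub>F t in sequentially. \<forall>i\<in>{..<k}. dist (f t i) (l i) < \<epsilon>"
    by (intro eventually_ball_finite) auto
  then show thesis using that by (auto simp: eventually_sequentially dist_real_def)
qed

lemma has_digit_frequency_iff:
  "has_digit_frequency k v \<alpha> \<longleftrightarrow> (\<forall>i<k. (\<lambda>r. word_freq (map v [0..<r]) i) \<longlonglongrightarrow> \<alpha> i)"
  by (simp add: has_digit_frequency_def word_freq_def card_eq_count_list)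

lemma last_nonzero_cases:
  fixes y :: "nat list"
  obtains "y = replicate (length y) 0" | y' d r where "y = y' @ d # replicate r 0" "0 < d"
proof -
  have "y = replicate (length y) 0 \<or> (\<exists>y' d r. y = y' @ d # replicate r 0 \<and> 0 < d)"
  proof (induction y rule: rev_induct)
    case (snoc a y)
    show ?case
    proof (cases "a = 0")
      case False
      then show ?thesis by (intro disjI2 exI[of _ y] exI[of _ a] exI[of _ 0]) simp
    next
      case True
      from snoc show ?thesis
      proof (elim disjE exE conjE)
        assume "y = replicate (length y) 0"
        then show ?thesis
          using True replicate_append_same[of "length y" "0::nat"]
          by (intro disjI1) (metis length_append_singleton replicate_Suc)
      next
        fix y' d r assume "y = y' @ d # replicate r 0" "0 < d"
        then show ?thesis
          using True by (intro disjI2 exI[of _ y'] exI[of _ d] exI[of _ "Suc r"])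
            (simp add: replicate_append_same)
      qed
    qed
  qed simp
  then show thesis using that by blast
qed

lemma X_set_shift: "v \<in> X_set k s \<Longrightarrow> (shift ^^ r) v \<in> X_set k s"
  unfolding X_set_def mem_Collect_eq funpow_add[THEN fun_cong, unfolded comp_def, symmetric]
  by (auto simp: digit_seqs_def shift_funpow)

text \<open>Replacing the last non-zero letter of a word of \<open>X_set k s\<close> by \<open>0\<close> makes every suffix
  strictly smaller than \<open>s\<close>.\<close>

lemma free_word_modify:
  assumes v: "v \<in> X_set k s" and s0: "0 < s 0"
  shows "\<exists>u. length u = L \<and> free_word k s u \<and>
    (\<forall>i. \<bar>real (count_list u i) - real (count_list (map v [0..<L]) i)\<bar> \<le> 1)"
proof (cases rule: last_nonzero_cases[of "map v [0..<L]"])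
  case 1
  have "v 0 < k" using v by (simp add: X_set_def digit_seqs_def)
  then show ?thesis
    using 1 free_word_zeros[of k s L] s0 by (intro exI[of _ "map v [0..<L]"]) simp
next
  case (2 y d r)
  let ?z = "replicate (Suc r) (0::nat)"
  have len: "length y + Suc r = L" using arg_cong[OF 2(1), of length] by simp
  have y: "y ! i = v i" if "i < length y" for i
  proof -
    have "map v [0..<L] ! i = v i" using that len by simp
    then show ?thesis using that 2(1) by (simp add: nth_append)
  qed
  have d: "v (length y) = d"
  proof -
    have "map v [0..<L] ! length y = v (length y)" using len by simp
    then show ?thesis using 2(1) by (simp add: nth_append)
  qed
  have vk: "v i < k" for i using v by (simp add: X_set_def digit_seqs_def)
  have z: "free_word k s ?z" using free_word_zeros vk[of 0] s0 by (simp del: replicate_Suc)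
  have "word_below (drop i (y @ ?z)) s" if i: "i < length (y @ ?z)" for i
  proof (cases "i < length y")
    case False
    then have "drop i (y @ ?z) = drop (i - length y) ?z" "i - length y < length ?z"
      using i by (simp_all del: replicate_Suc)
    then show ?thesis using z unfolding free_word_def by simp
  next
    case True
    \<comment> \<open>\<open>?J\<close> is the position, within the suffix, of the letter
      \<open>d\<close> that was replaced by \<open>0\<close>. If the suffix sequence departs from
      \<open>s\<close> before \<open>?J\<close>, that departure decides; otherwise the replacement
      makes \<open>?J\<close> the first place where the word is smaller.\<close>
    let ?J = "length y - i" and ?v = "(shift ^^ i) v"
    have eq: "drop i (y @ ?z) ! t = ?v t" if "t < ?J" for t
      using that True y[of "i + t"] by (simp add: shift_funpow nth_append add.commute)
    have zJ: "drop i (y @ ?z) ! ?J = 0" and lJ: "?J < length (drop i (y @ ?z))"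
      using True by (simp_all add: nth_append)
    have vJ: "?v ?J = d" using d True by (simp add: shift_funpow)
    have "lex_le ?v s" using v by (simp add: X_set_def)
    then consider "?v = s" | l where "?v l < s l" "\<And>t. t < l \<Longrightarrow> ?v t = s t"
      by (auto simp: lex_le_def elim: less_funE)
    then show ?thesis
    proof cases
      case 1
      then show ?thesis unfolding word_below_def
        using eq zJ lJ vJ 2(2) by (intro exI[of _ ?J]) metis
    next
      case (2 l)
      show ?thesis
      proof (cases "l < ?J")
        case True
        then show ?thesis unfolding word_below_def
          using eq 2 lJ by (intro exI[of _ l]) (metis less_trans)
      next
        case False
        have "?v ?J \<le> s ?J" using 2 False by (cases "l = ?J") auto
        then have "0 < s ?J" using vJ \<open>0 < d\<close> by simp
        then show ?thesis unfolding word_below_def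
          using eq zJ lJ 2 False by (intro exI[of _ ?J]) (metis leI less_le_trans)
      qed
    qed
  qed
  moreover have "set y \<subseteq> {..<k}" using y vk by (auto simp: in_set_conv_nth)
  ultimately have "free_word k s (y @ ?z)"
    using z by (simp add: free_word_def del: replicate_Suc)
  then show ?thesis using 2 len by (intro exI[of _ "y @ ?z"]) auto
qed

text \<open>\<open>v\<close> is cut into blocks of length \<open>L\<close>, each modified separately
  at the cost of one letter. A block sees only the first \<open>L\<close> letters of the bound, so
  it is free for \<open>s'\<close> as well.\<close>

lemma free_word_blocks:
  assumes v: "v \<in> X_set k s" and s0: "0 < s 0" and eq: "\<And>i. i < L \<Longrightarrow> s i = s' i"
  shows "\<exists>u. length u = M * L \<and> free_word k s' u \<and>
    (\<forall>i. \<bar>real (count_list u i) - real (count_list (map v [0..<M * L]) i)\<bar> \<le> real M)"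
proof (induction M)
  case (Suc M)
  then obtain u where u: "length u = M * L" "free_word k s' u"
    "\<And>i. \<bar>real (count_list u i) - real (count_list (map v [0..<M * L]) i)\<bar> \<le> real M" by blast
  let ?v = "(shift ^^ (M * L)) v"
  obtain w where w: "length w = L" "free_word k s w"
    "\<And>i. \<bar>real (count_list w i) - real (count_list (map ?v [0..<L]) i)\<bar> \<le> 1"
    using free_word_modify[OF X_set_shift[OF v] s0] by blast
  have split: "map v [0..<Suc M * L] = map v [0..<M * L] @ map ?v [0..<L]"
    by (intro nth_equalityI) (auto simp: nth_append shift_funpow add.commute)
  have "free_word k s' w" using free_word_cong[of w s s' k] eq w by simp
  moreover have "\<bar>real (count_list (u @ w) i) - real (count_list (map v [0..<Suc M * L]) i)\<bar> \<le> real (Suc M)" for i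
    unfolding split count_list_append using u(3)[of i] w(3)[of i] by linarith
  ultimately show ?case using u w by (intro exI[of _ "u @ w"]) (auto intro: free_word_append)
qed simp

text \<open>One modified letter per block of length \<open>L\<close> costs \<open>1 / real L\<close>
  in frequency, and \<eta> pays for the convergence of the frequencies of \<open>v\<close>. With
  \<open>s' = s\<close> this approximates the points of one set; with a different \<open>s'\<close>
  it compares two sets.\<close>

lemma free_word_approx:
  assumes v: "v \<in> X_set k s" "has_digit_frequency k v \<alpha>" and s0: "0 < s 0"
    and eq: "\<And>i. i < L \<Longrightarrow> s i = s' i" and "0 < L" "0 < \<eta>"
  shows "\<exists>u. free_word k s' u \<and> u \<noteq> [] \<and> (\<forall>i<k. \<bar>word_freq u i - \<alpha> i\<bar> \<le> 1 / real L + \<eta>)"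
proof -
  obtain N where N: "\<And>r i. N \<le> r \<Longrightarrow> i < k \<Longrightarrow> \<bar>word_freq (map v [0..<r]) i - \<alpha> i\<bar> < \<eta>"
    by (rule coordinates_eventually_near[of k "\<lambda>r. word_freq (map v [0..<r])" \<alpha> \<eta>])
      (use v(2) \<open>0 < \<eta>\<close> in \<open>auto simp: has_digit_frequency_iff\<close>)
  define M where "M = Suc N"
  have MLpos: "N \<le> M * L" "0 < M * L" using \<open>0 < L\<close> by (auto simp: M_def intro: trans_le_add2)
  obtain u where u: "length u = M * L" "free_word k s' u"
    "\<And>i. \<bar>real (count_list u i) - real (count_list (map v [0..<M * L]) i)\<bar> \<le> real M"
    using free_word_blocks[OF v(1) s0 eq] by blast
  have "\<bar>word_freq u i - \<alpha> i\<bar> \<le> 1 / real L + \<eta>" if "i < k" for i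
  proof -
    let ?w = "map v [0..<M * L]"
    have "word_freq u i - word_freq ?w i = (real (count_list u i) - real (count_list ?w i)) / real (M * L)"
      using u(1) by (simp add: word_freq_def diff_divide_distrib)
    then have "\<bar>word_freq u i - word_freq ?w i\<bar> \<le> real M / real (M * L)"
      using u(3)[of i] by (simp add: divide_right_mono del: of_nat_mult)
    also have "\<dots> = 1 / real L" using \<open>0 < M * L\<close> by simp
    finally show ?thesis using N[OF MLpos(1) that] by linarith
  qed
  moreover have "u \<noteq> []" using u(1) MLpos by auto
  ultimately show ?thesis using u(2) by blast
qed

section \<open>Infinite concatenations of free words\<close>

lemma count_list_concat_upt:
  "count_list (concat (map W [0..<t])) i = (\<Sum>s<t. count_list (W s) i)"
  by (induction t) auto

lemma length_concat_upt: "length (concat (map W [0..<t])) = (\<Sum>s<t. length (W s))"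
  by (induction t) auto

lemma concat_seq_prefix:
  assumes "\<And>i. W i \<noteq> []"
  shows "\<exists>t\<le>r. \<exists>p. map (concat_seq W) [0..<r] = concat (map W [0..<t]) @ p \<and> length p \<le> length (W t)"
proof (induction r)
  case (Suc r)
  let ?C = "\<lambda>t. concat (map W [0..<t])" and ?v = "concat_seq W"
  obtain t p where t: "t \<le> r" "map ?v [0..<r] = ?C t @ p" "length p \<le> length (W t)"
    using Suc by blast
  have len: "length (?C t) + length p = r" using arg_cong[OF t(2), of length] by simp
  show ?case
  proof (cases "length p = length (W t)")
    case True
    then have r: "r = length (?C (Suc t))" using len by simp
    have "map ?v [0..<r] = ?C (Suc t)" unfolding r by (rule map_concat_seq[OF assms])
    moreover have "Suc 0 \<le> length (W (Suc t))" using assms[of "Suc t"] by (simp add: Suc_le_eq)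
    ultimately show ?thesis
      using t(1) by (intro exI[of _ "Suc t"] conjI exI[of _ "[?v r]"]) simp_all
  next
    case False
    then show ?thesis using t by (intro exI[of _ t] conjI exI[of _ "p @ [?v r]"]) simp_all
  qed
qed simp

text \<open>The sequence read from position \<open>r\<close> is decided inside a finite word: the
  first \<open>Suc r\<close> words reach beyond \<open>r\<close>, and their concatenation is
  free.\<close>

lemma concat_seq_in_X_set:
  assumes "\<And>t. free_word k s (W t)" "\<And>t. W t \<noteq> []"
  shows "concat_seq W \<in> X_set k s"
proof -
  let ?C = "\<lambda>t. concat (map W [0..<t])" and ?v = "concat_seq W"
  have free: "free_word k s (?C t)" for t using assms(1) by (intro free_word_concat) auto
  have len: "r < length (?C (Suc r))" for r
    using length_concat_ge[of W "Suc r", OF assms(2)] by simp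
  have "?v j < k" for j
  proof -
    have "?v j \<in> set (?C (Suc j))" unfolding concat_seq_def using len by (rule nth_mem)
    then show ?thesis using free[of "Suc j"] by (auto simp: free_word_def simp del: upt_Suc)
  qed
  moreover have "less_fun ((shift ^^ r) ?v) s" for r
  proof -
    have below: "word_below (drop r (?C (Suc r))) s"
      using free[of "Suc r"] len[of r] by (simp add: free_word_def del: upt_Suc)
    have "drop r (?C (Suc r)) = drop r (map ?v [0..<length (?C (Suc r))])"
      by (simp only: map_concat_seq[of W, OF assms(2)])
    also have "\<dots> = map ((shift ^^ r) ?v) [0..<length (?C (Suc r)) - r]"
      by (intro nth_equalityI) (auto simp: shift_funpow add.commute simp del: upt_Suc)
    finally have "word_below (map ((shift ^^ r) ?v) [0..<length (?C (Suc r)) - r]) s"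
      using below by (simp only:)
    then show ?thesis unfolding less_fun_iff_word_below by blast
  qed
  ultimately show ?thesis by (auto simp: X_set_def digit_seqs_def lex_le_def)
qed

text \<open>The words are repeated so slowly (\<open>\<tau>\<close> below) that each one is short compared with the
  concatenation of its predecessors.\<close>

lemma free_words_frequency:
  assumes free: "\<And>t. free_word k s (u t)" "\<And>t. u t \<noteq> []"
    and lim: "\<And>i. i < k \<Longrightarrow> (\<lambda>t. word_freq (u t) i) \<longlonglongrightarrow> \<alpha> i"
    and \<alpha>: "\<alpha> \<in> unit_simplex k"
  shows "\<exists>v\<in>X_set k s. has_digit_frequency k v \<alpha>"
proof -
  \<comment> \<open>The indices admissible at time \<open>t\<close>. Every \<open>j\<close> becomes
    admissible, so the largest one tends to infinity, and \<open>j * length (u j) \<le> t\<close>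
    makes the word chosen at time \<open>t\<close> negligible against \<open>t\<close>.\<close>
  define T where "T = (\<lambda>t. {j. j \<le> t \<and> j * length (u j) \<le> t})"
  define \<tau> where "\<tau> = (\<lambda>t. Max (T t))"
  have fin: "finite (T t)" and zero: "0 \<in> T t" for t by (auto simp: T_def)
  have "\<tau> t \<in> T t" for t unfolding \<tau>_def using fin zero by (intro Max_in) auto
  then have tau: "\<tau> t * length (u (\<tau> t)) \<le> t" for t by (simp add: T_def)
  have tau_ge: "j \<le> \<tau> t" if "j \<le> t" "j * length (u j) \<le> t" for j t
    unfolding \<tau>_def using fin that by (intro Max_ge) (auto simp: T_def)
  define W where "W = (\<lambda>t. u (\<tau> t))"
  let ?v = "concat_seq W"
  have W: "free_word k s (W t)" "W t \<noteq> []" for t using free by (simp_all add: W_def)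
  have "(\<lambda>r. word_freq (map ?v [0..<r]) i) \<longlonglongrightarrow> \<alpha> i" if i: "i < k" for i
  proof (rule LIMSEQ_I)
    fix \<epsilon> :: real assume "0 < \<epsilon>"
    define \<eta> where "\<eta> = \<epsilon> / 3"
    have "0 < \<eta>" using \<open>0 < \<epsilon>\<close> by (simp add: \<eta>_def)
    have a01: "0 \<le> \<alpha> i" "\<alpha> i \<le> 1"
    proof -
      show "0 \<le> \<alpha> i" using \<alpha> i by (simp add: unit_simplex_def)
      have "\<alpha> i \<le> (\<Sum>i<k. \<alpha> i)" using \<alpha> i by (intro member_le_sum) (auto simp: unit_simplex_def)
      then show "\<alpha> i \<le> 1" using \<alpha> by (simp add: unit_simplex_def)
    qed
    define len where "len = (\<lambda>t. real (length (W t)))"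
    \<comment> \<open>Surplus of the letter \<open>i\<close> in \<open>W t\<close> over the expected
      number.\<close>
    define e where "e = (\<lambda>t. real (count_list (W t) i) - \<alpha> i * len t)"
    obtain J0 where J0: "\<And>j. J0 \<le> j \<Longrightarrow> \<bar>word_freq (u j) i - \<alpha> i\<bar> < \<eta>"
      using LIMSEQ_D[OF lim[OF i] \<open>0 < \<eta>\<close>] by auto
    define J where "J = Suc (max J0 (nat \<lceil>1 / \<eta>\<rceil>))"
    have "1 / \<eta> \<le> real (nat \<lceil>1 / \<eta>\<rceil>)" by (rule real_nat_ceiling_ge)
    also have "\<dots> \<le> real J" by (simp add: J_def)
    finally have J: "1 \<le> \<eta> * real J" "J0 \<le> J"
      using \<open>0 < \<eta>\<close> by (auto simp: J_def field_simps)
    define N where "N = max J (J * length (u J))"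
    \<comment> \<open>From \<open>N\<close> on the chosen index is at least \<open>J\<close>. Since
      \<open>J \<ge> J0\<close>, this controls the frequency of \<open>W t\<close>; since
      \<open>\<eta> * real J \<ge> 1\<close>, it controls the length of \<open>W t\<close>.\<close>
    have good: "\<bar>e t\<bar> \<le> \<eta> * len t" "len t \<le> \<eta> * real t" if "N \<le> t" for t
    proof -
      have Jt: "J \<le> \<tau> t" using tau_ge[of J t] that by (simp add: N_def)
      have "e t = (word_freq (W t) i - \<alpha> i) * len t"
        using W(2)[of t] by (simp add: e_def len_def word_freq_def algebra_simps)
      then have "\<bar>e t\<bar> = \<bar>word_freq (W t) i - \<alpha> i\<bar> * len t" by (simp add: abs_mult len_def)
      also have "\<dots> \<le> \<eta> * len t"
        using J0[of "\<tau> t"] Jt J(2) by (intro mult_right_mono) (auto simp: W_def len_def)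
      finally show "\<bar>e t\<bar> \<le> \<eta> * len t" .
      have "len t \<le> (\<eta> * real J) * len t"
        using mult_right_mono[OF J(1), of "len t"] by (simp add: len_def)
      also have "\<dots> \<le> (\<eta> * real (\<tau> t)) * len t"
        using Jt \<open>0 < \<eta>\<close> by (intro mult_right_mono mult_left_mono) (auto simp: len_def)
      also have "\<dots> = \<eta> * real (\<tau> t * length (u (\<tau> t)))" by (simp add: len_def W_def)
      also have "\<dots> \<le> \<eta> * real t"
        using tau[of t] \<open>0 < \<eta>\<close> by (intro mult_left_mono) (auto simp del: of_nat_mult)
      finally show "len t \<le> \<eta> * real t" .
    qed
    \<comment> \<open>\<open>A\<close> and \<open>B\<close> absorb the finitely many words before
      \<open>N\<close>.\<close>
    define A where "A = (\<Sum>t<N. \<bar>e t\<bar>)"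
    define B where "B = (\<Sum>t<N. len t)"
    have sum_e: "(\<Sum>s<t. \<bar>e s\<bar>) \<le> A + \<eta> * (\<Sum>s<t. len s)" for t
    proof -
      have "(\<Sum>s<t. \<bar>e s\<bar>) \<le> (\<Sum>s<t. (if s < N then \<bar>e s\<bar> else 0) + \<eta> * len s)"
        using good(1) \<open>0 < \<eta>\<close> by (intro sum_mono) (auto simp: len_def)
      also have "\<dots> = (\<Sum>s\<in>{..<t} \<inter> {..<N}. \<bar>e s\<bar>) + \<eta> * (\<Sum>s<t. len s)"
        by (simp add: sum.distrib sum_distrib_left sum.inter_restrict lessThan_def)
      also have "(\<Sum>s\<in>{..<t} \<inter> {..<N}. \<bar>e s\<bar>) \<le> A"
        unfolding A_def by (intro sum_mono2) auto
      finally show ?thesis by simp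
    qed
    have len_t: "len t \<le> B + \<eta> * real t" for t
    proof (cases "t < N")
      case True
      then have "len t \<le> B" unfolding B_def by (intro member_le_sum) (auto simp: len_def)
      then show ?thesis using \<open>0 < \<eta>\<close> by (smt (verit) mult_nonneg_nonneg of_nat_0_le_iff)
    next
      case False
      have "0 \<le> B" unfolding B_def by (intro sum_nonneg) (auto simp: len_def)
      then show ?thesis using good(2)[of t] False by simp
    qed
    \<comment> \<open>The complete words contribute at most \<open>A + \<eta> * real r\<close>, the
      unfinished word \<open>p\<close> at most \<open>B + \<eta> * real r\<close>. The constant
      \<open>A + B\<close> will use up the remaining third of \<epsilon>.\<close>
    have D: "\<bar>real (count_list (map ?v [0..<r]) i) - \<alpha> i * real r\<bar> \<le> A + B + 2 * \<eta> * real r" for r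
    proof -
      obtain t p where t: "t \<le> r" "map ?v [0..<r] = concat (map W [0..<t]) @ p"
          "length p \<le> length (W t)"
        using concat_seq_prefix[of W r] W(2) by blast
      have r: "real r = (\<Sum>s<t. len s) + real (length p)"
        using arg_cong[OF t(2), of length] by (simp add: length_concat_upt len_def)
      have "real (count_list (map ?v [0..<r]) i) - \<alpha> i * real r
          = (\<Sum>s<t. e s) + (real (count_list p i) - \<alpha> i * real (length p))"
        unfolding t(2) r e_def
        by (simp add: count_list_concat_upt sum_subtractf sum_distrib_left algebra_simps)
      moreover have "\<bar>\<Sum>s<t. e s\<bar> \<le> (\<Sum>s<t. \<bar>e s\<bar>)" by (rule sum_abs)
      moreover have "\<bar>real (count_list p i) - \<alpha> i * real (length p)\<bar> \<le> len t"
      proof -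
        have "real (count_list p i) \<le> real (length p)" using count_le_length[of p i] by simp
        moreover have "0 \<le> \<alpha> i * real (length p)" "\<alpha> i * real (length p) \<le> real (length p)"
          using a01 by (auto simp: mult_left_le_one_le)
        moreover have "real (length p) \<le> len t" using t(3) by (simp add: len_def)
        ultimately show ?thesis by linarith
      qed
      moreover have "\<eta> * (\<Sum>s<t. len s) \<le> \<eta> * real r" "\<eta> * real t \<le> \<eta> * real r"
        using r t(1) \<open>0 < \<eta>\<close> by (auto intro!: mult_left_mono)
      ultimately show ?thesis using sum_e[of t] len_t[of t] by linarith
    qed
    obtain R where R: "(A + B) / \<eta> < real R" using reals_Archimedean2 by blast
    show "\<exists>no. \<forall>r\<ge>no. norm (word_freq (map ?v [0..<r]) i - \<alpha> i) < \<epsilon>"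
    proof (intro exI[of _ "Suc R"] allI impI)
      fix r assume r: "Suc R \<le> r"
      then have "(A + B) / \<eta> < real r" using R by linarith
      then have "A + B < \<eta> * real r" using \<open>0 < \<eta>\<close> by (simp add: field_simps)
      then have "\<bar>real (count_list (map ?v [0..<r]) i) - \<alpha> i * real r\<bar> < \<epsilon> * real r"
        using D[of r] by (simp add: \<eta>_def)
      moreover have "word_freq (map ?v [0..<r]) i - \<alpha> i
          = (real (count_list (map ?v [0..<r]) i) - \<alpha> i * real r) / real r"
        using r by (simp add: word_freq_def field_simps)
      ultimately show "norm (word_freq (map ?v [0..<r]) i - \<alpha> i) < \<epsilon>"
        using r by (simp add: abs_divide divide_less_eq)
    qed
  qed
  then have "has_digit_frequency k ?v \<alpha>" by (simp add: has_digit_frequency_iff)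
  then show ?thesis using concat_seq_in_X_set[of k s W] W by blast
qed

lemma approximating_words:
  assumes "\<And>\<epsilon>. 0 < \<epsilon> \<Longrightarrow> \<exists>u. P u \<and> (\<forall>i<k. \<bar>word_freq u i - \<alpha> i\<bar> < \<epsilon>)"
  obtains u where "\<And>t. P (u t)" "\<And>i. i < k \<Longrightarrow> (\<lambda>t. word_freq (u t) i) \<longlonglongrightarrow> \<alpha> i"
proof -
  have "\<forall>t. \<exists>u. P u \<and> (\<forall>i<k. \<bar>word_freq u i - \<alpha> i\<bar> < 1 / real (Suc t))"
    using assms by simp
  then obtain u where u: "\<And>t. P (u t)" "\<And>t i. i < k \<Longrightarrow> \<bar>word_freq (u t) i - \<alpha> i\<bar> < 1 / real (Suc t)"
    by metis
  show thesis
  proof (rule that[OF u(1)])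
    fix i assume i: "i < k"
    have "(\<lambda>t. word_freq (u t) i - \<alpha> i) \<longlonglongrightarrow> 0"
    proof (rule Lim_null_comparison)
      show "\<forall>\<^sub>F t in sequentially. norm (word_freq (u t) i - \<alpha> i) \<le> 1 / real (Suc t)"
        using u(2)[OF i] by (intro always_eventually allI) (simp only: real_norm_def less_imp_le)
      show "(\<lambda>t. 1 / real (Suc t)) \<longlonglongrightarrow> 0" by (rule lim_inverse_n'[THEN LIMSEQ_Suc])
    qed
    then show "(\<lambda>t. word_freq (u t) i) \<longlonglongrightarrow> \<alpha> i" by (rule LIM_zero_cancel)
  qed
qed

section \<open>The sets \<open>DF k n\<close> as closures of frequencies of free words\<close>

context alphabet
begin

lemma S_seq_0_pos: "0 < S_seq k n 0"
  using S_seq_0 k3 by simp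

lemma word_freq_simplex:
  assumes "set u \<subseteq> {..<k}" "u \<noteq> []"
  shows "word_freq u \<in> unit_simplex k"
proof -
  have "(\<Sum>i<k. real (count_list u i)) = real (length u)"
    using sum_count_set[of u "{..<k}"] assms(1) by (simp flip: of_nat_sum)
  then have "(\<Sum>i<k. word_freq u i) = 1"
    using assms(2) by (simp add: word_freq_def flip: sum_divide_distrib)
  moreover have "count_list u i = 0" if "k \<le> i" for i
    using assms(1) that by (intro count_notin) auto
  ultimately show ?thesis by (simp add: unit_simplex_def word_freq_def)
qed

lemma DF_seqI:
  assumes "\<alpha> \<in> unit_simplex k" "\<And>t. free_word k (S_seq k n) (u t)" "\<And>t. u t \<noteq> []"
    "\<And>i. i < k \<Longrightarrow> (\<lambda>t. word_freq (u t) i) \<longlonglongrightarrow> \<alpha> i"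
  shows "\<alpha> \<in> DF k n"
  using free_words_frequency[of k "S_seq k n" u \<alpha>] assms by (auto simp: DF_def)

lemma DF_simplex: "\<alpha> \<in> DF k n \<Longrightarrow> \<alpha> \<in> unit_simplex k"
  by (simp add: DF_def)

lemma DF_iff:
  "\<alpha> \<in> DF k n \<longleftrightarrow> \<alpha> \<in> unit_simplex k \<and>
     (\<forall>\<epsilon>>0. \<exists>u. free_word k (S_seq k n) u \<and> u \<noteq> [] \<and> (\<forall>i<k. \<bar>word_freq u i - \<alpha> i\<bar> < \<epsilon>))"
proof (intro iffI conjI allI impI)
  assume \<alpha>: "\<alpha> \<in> DF k n"
  then show "\<alpha> \<in> unit_simplex k" by (rule DF_simplex)
  obtain v where v: "v \<in> X_set k (S_seq k n)" "has_digit_frequency k v \<alpha>"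
    using \<alpha> by (auto simp: DF_def)
  fix \<epsilon> :: real assume "0 < \<epsilon>"
  then obtain L where L: "1 / real (Suc L) < \<epsilon> / 2" using nat_approx_posE[of "\<epsilon> / 2"] by auto
  obtain u where "free_word k (S_seq k n) u" "u \<noteq> []"
    "\<forall>i<k. \<bar>word_freq u i - \<alpha> i\<bar> \<le> 1 / real (Suc L) + \<epsilon> / 2"
    using free_word_approx[OF v S_seq_0_pos, of "Suc L" "S_seq k n" "\<epsilon> / 2"] \<open>0 < \<epsilon>\<close> by auto
  then show "\<exists>u. free_word k (S_seq k n) u \<and> u \<noteq> [] \<and> (\<forall>i<k. \<bar>word_freq u i - \<alpha> i\<bar> < \<epsilon>)"
    using L by (intro exI[of _ u]) fastforce
next
  assume r: "\<alpha> \<in> unit_simplex k \<and>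
     (\<forall>\<epsilon>>0. \<exists>u. free_word k (S_seq k n) u \<and> u \<noteq> [] \<and> (\<forall>i<k. \<bar>word_freq u i - \<alpha> i\<bar> < \<epsilon>))"
  obtain u where "\<And>t. free_word k (S_seq k n) (u t) \<and> u t \<noteq> []"
    "\<And>i. i < k \<Longrightarrow> (\<lambda>t. word_freq (u t) i) \<longlonglongrightarrow> \<alpha> i"
    by (rule approximating_words[of "\<lambda>u. free_word k (S_seq k n) u \<and> u \<noteq> []" k \<alpha>]) (use r in auto)
  then show "\<alpha> \<in> DF k n" using r by (intro DF_seqI[of \<alpha> n u]) auto
qed

lemma DF_seqE:
  assumes "\<alpha> \<in> DF k n"
  obtains u where "\<And>t. free_word k (S_seq k n) (u t)" "\<And>t. u t \<noteq> []"
    "\<And>i. i < k \<Longrightarrow> (\<lambda>t. word_freq (u t) i) \<longlonglongrightarrow> \<alpha> i"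
proof -
  obtain u where "\<And>t. free_word k (S_seq k n) (u t) \<and> u t \<noteq> []"
    "\<And>i. i < k \<Longrightarrow> (\<lambda>t. word_freq (u t) i) \<longlonglongrightarrow> \<alpha> i"
    by (rule approximating_words[of "\<lambda>u. free_word k (S_seq k n) u \<and> u \<noteq> []" k \<alpha>])
      (use assms in \<open>auto simp: DF_iff\<close>)
  then show thesis using that by blast
qed

lemma word_freq_in_DF: "free_word k (S_seq k n) u \<Longrightarrow> u \<noteq> [] \<Longrightarrow> word_freq u \<in> DF k n"
  using word_freq_simplex by (auto simp: DF_iff free_word_def)

lemma DF_nonempty: "DF k n \<noteq> {}"
  using word_freq_in_DF[of n "replicate 1 0"] free_word_zeros[of k "S_seq k n" 1] S_seq_0_pos k3
  by auto

lemma DF_closed: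
  assumes "\<alpha> \<in> unit_simplex k" "\<And>\<epsilon>. 0 < \<epsilon> \<Longrightarrow> \<exists>\<beta>\<in>DF k n. \<forall>i<k. \<bar>\<beta> i - \<alpha> i\<bar> < \<epsilon>"
  shows "\<alpha> \<in> DF k n"
  unfolding DF_iff
proof (intro conjI allI impI)
  fix \<epsilon> :: real assume "0 < \<epsilon>"
  then obtain \<beta> where \<beta>: "\<beta> \<in> DF k n" "\<forall>i<k. \<bar>\<beta> i - \<alpha> i\<bar> < \<epsilon> / 2" using assms(2)[of "\<epsilon> / 2"] by auto
  then obtain u where u: "free_word k (S_seq k n) u" "u \<noteq> []" "\<forall>i<k. \<bar>word_freq u i - \<beta> i\<bar> < \<epsilon> / 2"
    using \<open>0 < \<epsilon>\<close> half_gt_zero unfolding DF_iff by blast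
  have "\<bar>word_freq u i - \<alpha> i\<bar> < \<epsilon>" if "i < k" for i
    using \<beta>(2) u(3) that by (smt (verit) field_sum_of_halves)
  then show "\<exists>u. free_word k (S_seq k n) u \<and> u \<noteq> [] \<and> (\<forall>i<k. \<bar>word_freq u i - \<alpha> i\<bar> < \<epsilon>)"
    using u by blast
qed (rule assms(1))

text \<open>One \<open>1 / real q\<close> comes from altering a letter in each block of length
  \<open>q\<close>, the other is the tolerance for the frequencies. Fixing \<open>q\<close> letters
  of \<open>S_seq\<close> takes \<open>q * (k - 1)\<close> entries of \<open>n\<close>.\<close>

lemma DF_near:
  assumes "\<And>i. i < q * (k - 1) \<Longrightarrow> n i = n' i" "0 < q" "\<alpha> \<in> DF k n"
  shows "\<exists>\<beta>\<in>DF k n'. \<forall>i<k. \<bar>\<beta> i - \<alpha> i\<bar> \<le> 2 / real q"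
proof -
  obtain v where v: "v \<in> X_set k (S_seq k n)" "has_digit_frequency k v \<alpha>"
    using assms(3) by (auto simp: DF_def)
  obtain u where u: "free_word k (S_seq k n') u" "u \<noteq> []"
    "\<forall>i<k. \<bar>word_freq u i - \<alpha> i\<bar> \<le> 1 / real q + 1 / real q"
    using free_word_approx[OF v S_seq_0_pos, of q "S_seq k n'" "1 / real q"]
      S_seq_agree[of q n n'] assms by auto
  then show ?thesis using word_freq_in_DF by (intro bexI[of _ "word_freq u"]) auto
qed

text \<open>\<open>S_seq\<close> reverses the order, and a word that is free for a sequence is free
  for every larger one.\<close>

lemma DF_antimono: "less_fun n n' \<Longrightarrow> DF k n' \<subseteq> DF k n"
  unfolding subset_iff DF_iff using free_word_less_fun[OF _ S_seq_antimono] by blast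

end

section \<open>Abelianisation and desubstitution\<close>

text \<open>The incidence matrix of the substitution with exponent \<open>m\<close>, acting on
  vectors of letter counts.\<close>

definition subst_map :: "nat \<Rightarrow> nat \<Rightarrow> (nat \<Rightarrow> real) \<Rightarrow> (nat \<Rightarrow> real)" where
  "subst_map k m \<gamma> = (\<lambda>i.
     if i = 0 then (real m + 1) * \<gamma> (k - 2) + real m * \<gamma> (k - 1)
     else if i < k - 1 then \<gamma> (i - 1)
     else if i = k - 1 then \<gamma> (k - 2) + \<gamma> (k - 1)
     else 0)"

text \<open>The inverse matrix. For \<open>m = J_map k \<alpha>\<close> it is \<open>K_map\<close>
  before the division by \<open>1 - \<alpha> 0\<close>.\<close>

definition subst_inv :: "nat \<Rightarrow> nat \<Rightarrow> (nat \<Rightarrow> real) \<Rightarrow> (nat \<Rightarrow> real)" where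
  "subst_inv k m \<alpha> = (\<lambda>i.
     if i < k - 2 then \<alpha> (i + 1)
     else if i = k - 2 then \<alpha> 0 - real m * \<alpha> (k - 1)
     else if i = k - 1 then (real m + 1) * \<alpha> (k - 1) - \<alpha> 0
     else 0)"

definition normalise :: "nat \<Rightarrow> (nat \<Rightarrow> real) \<Rightarrow> (nat \<Rightarrow> real)" where
  "normalise k \<gamma> = (\<lambda>i. \<gamma> i / (\<Sum>j<k. \<gamma> j))"

text \<open>\<open>park\<close> desubstitutes a word after moving each surplus zero to the left, to the nearest
  preceding letter \<open>k - 1\<close> that is followed by only \<open>m\<close> zeros. Moving zeros to the left makes words
  smaller, so freeness is preserved. The first component counts the zeros left over.\<close>

primrec park :: "nat \<Rightarrow> nat \<Rightarrow> nat list \<Rightarrow> nat \<times> nat list" where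
  "park k m [] = (0, [])"
| "park k m (x # xs) = (let (c, w) = park k m xs in
     if x = 0 then (c + 1, w)
     else if x < k - 1 then (c, (x - 1) # w)
     else if m < c then (c - (m + 1), (k - 2) # w)
     else (0, (k - 1) # w))"

lemma word_below_Cons_iff: "word_below (x # u) s \<longleftrightarrow> x < s 0 \<or> x = s 0 \<and> word_below u (shift s)"
proof
  assume "word_below (x # u) s"
  then obtain j where j: "j < length (x # u)" "\<forall>i<j. (x # u) ! i = s i" "(x # u) ! j < s j"
    by (auto simp: word_below_def)
  show "x < s 0 \<or> x = s 0 \<and> word_below u (shift s)"
  proof (cases j)
    case (Suc l)
    have "u ! i = shift s i" if "i < l" for i using j(2)[rule_format, of "Suc i"] Suc that by (simp add: shift_def)
    then have "word_below u (shift s)"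
      unfolding word_below_def using j Suc by (intro exI[of _ l]) (simp add: shift_def)
    then show ?thesis using j(2)[rule_format, of 0] Suc by simp
  qed (use j in simp)
next
  assume "x < s 0 \<or> x = s 0 \<and> word_below u (shift s)"
  then show "word_below (x # u) s"
  proof (elim disjE conjE)
    assume x: "x = s 0" and "word_below u (shift s)"
    then obtain j where "j < length u" "\<forall>i<j. u ! i = s (Suc i)" "u ! j < s (Suc j)"
      by (auto simp: word_below_def shift_def)
    then show ?thesis
      unfolding word_below_def using x by (intro exI[of _ "Suc j"]) (auto simp: nth_Cons split: nat.split)
  qed (rule word_below_Cons)
qed

lemma park_zeros: "park k m (replicate r 0 @ xs) = (r + fst (park k m xs), snd (park k m xs))"
  by (induction r) (auto simp: split_beta)

text \<open>Read from the right, the carry behaves like a queue: a \<open>0\<close> adds one, and a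
  \<open>k - 1\<close> removes \<open>m + 1\<close>, stopping at zero. If it is never cut off within
  \<open>u\<close>, it is the plain balance; otherwise only letters of \<open>u\<close> have
  contributed since the last cut, at most one each.\<close>

lemma park_carry_append:
  "int (fst (park k m (u @ xs))) \<le> max (int (length u))
     (int (fst (park k m xs)) + int (count_list u 0) - (int m + 1) * int (count_list u (k - 1)))"
  if "1 < k" "set u \<subseteq> {..<k}"
  using that
proof (induction u)
  case (Cons x u)
  let ?c = "int (fst (park k m (u @ xs)))" and
    ?e = "int (fst (park k m xs)) + int (count_list u 0) - (int m + 1) * int (count_list u (k - 1))"
  have IH: "?c \<le> max (int (length u)) ?e" using Cons by auto
  consider "x = 0" | "0 < x" "x < k - 1" | "x = k - 1" using Cons.prems by fastforce
  then show ?case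
  proof cases
    case 1
    then have "int (fst (park k m ((x # u) @ xs))) = ?c + 1" by (simp add: split_beta)
    then show ?thesis using IH 1 Cons.prems(1) by (auto simp: max_def split: if_splits)
  next
    case 2
    then have "int (fst (park k m ((x # u) @ xs))) = ?c" by (simp add: split_beta)
    then show ?thesis using IH 2 by (auto simp: max_def split: if_splits)
  next
    case 3
    then have "int (fst (park k m ((x # u) @ xs))) \<le> max 0 (?c - (int m + 1))"
      using Cons.prems(1) by (auto simp: split_beta)
    moreover have "(int m + 1) * int (count_list (x # u) (k - 1)) = (int m + 1) * int (count_list u (k - 1)) + (int m + 1)"
      using 3 by (simp add: algebra_simps)
    moreover have "count_list (x # u) 0 = count_list u 0" using 3 Cons.prems(1) by simp
    ultimately show ?thesis using IH unfolding max_def list.size by (auto split: if_splits)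
  qed
qed simp

text \<open>One copy of \<open>u\<close> can absorb as many zeros as it supplies, so a further copy
  preserves the bound \<open>length u\<close>. What matters is that the bound does not grow with
  \<open>N\<close>.\<close>

lemma park_carry_power:
  assumes "1 < k" "set u \<subseteq> {..<k}" "real (count_list u 0) \<le> (real m + 1) * real (count_list u (k - 1))"
  shows "fst (park k m (concat (replicate N u))) \<le> length u"
proof (induction N)
  case (Suc N)
  have "real_of_int (int (count_list u 0)) \<le> real_of_int ((int m + 1) * int (count_list u (k - 1)))"
    using assms(3) by simp
  then have "int (count_list u 0) \<le> (int m + 1) * int (count_list u (k - 1))"
    by (simp only: of_int_le_iff)
  then show ?case
    using park_carry_append[OF assms(1,2), of m "concat (replicate N u)"] Suc by simp
qed simp

section \<open>The substitution matrices and their inverses\<close>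

context alphabet
begin

lemma sum_split_last2: "(\<Sum>i<k. f i) = (\<Sum>i<k-2. f i) + f (k - 2) + f (k - 1)" for f :: "nat \<Rightarrow> real"
proof -
  obtain j where "k = Suc (Suc j)" using k3 by (metis add_2_eq_Suc le_Suc_ex numeral_3_eq_3 add_Suc)
  then show ?thesis by simp
qed

lemma sum_split_ends: "(\<Sum>i<k. f i) = f 0 + (\<Sum>i<k-2. f (i + 1)) + f (k - 1)" for f :: "nat \<Rightarrow> real"
proof -
  obtain j where "k = Suc (Suc j)" using k3 by (metis add_2_eq_Suc le_Suc_ex numeral_3_eq_3 add_Suc)
  then show ?thesis using sum.lessThan_Suc_shift[of f "Suc j"] by simp
qed

lemma subst_map_eqs:
  "subst_map k m \<gamma> 0 = (real m + 1) * \<gamma> (k - 2) + real m * \<gamma> (k - 1)"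
  "i < k - 2 \<Longrightarrow> subst_map k m \<gamma> (i + 1) = \<gamma> i"
  "subst_map k m \<gamma> (k - 1) = \<gamma> (k - 2) + \<gamma> (k - 1)"
  "k \<le> i \<Longrightarrow> subst_map k m \<gamma> i = 0"
  using k3 by (auto simp: subst_map_def)

lemma subst_inv_eqs:
  "i < k - 2 \<Longrightarrow> subst_inv k m \<alpha> i = \<alpha> (i + 1)"
  "subst_inv k m \<alpha> (k - 2) = \<alpha> 0 - real m * \<alpha> (k - 1)"
  "subst_inv k m \<alpha> (k - 1) = (real m + 1) * \<alpha> (k - 1) - \<alpha> 0"
  "k \<le> i \<Longrightarrow> subst_inv k m \<alpha> i = 0"
proof -
  have "k - 1 \<noteq> k - 2" "\<not> k - 1 < k - 2" using k3 by arith+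
  then show "subst_inv k m \<alpha> (k - 1) = (real m + 1) * \<alpha> (k - 1) - \<alpha> 0" by (simp add: subst_inv_def)
qed (use k3 in \<open>auto simp: subst_inv_def\<close>)

lemma index_cases:
  obtains "i = 0" | j where "j < k - 2" "i = j + 1" | "i = k - 1" | "k \<le> i"
  by (cases i) fastforce+

lemma index_cases2:
  obtains "i < k - 2" | "i = k - 2" | "i = k - 1" | "k \<le> i"
  by fastforce

lemma subst_map_inv:
  assumes "\<And>i. k \<le> i \<Longrightarrow> \<alpha> i = 0"
  shows "subst_map k m (subst_inv k m \<alpha>) = \<alpha>"
proof
  fix i show "subst_map k m (subst_inv k m \<alpha>) i = \<alpha> i"
    by (cases i rule: index_cases) (auto simp only: subst_map_eqs subst_inv_eqs assms, auto simp: algebra_simps)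
qed

lemma subst_inv_map:
  assumes "\<And>i. k \<le> i \<Longrightarrow> \<gamma> i = 0"
  shows "subst_inv k m (subst_map k m \<gamma>) = \<gamma>"
proof
  fix i show "subst_inv k m (subst_map k m \<gamma>) i = \<gamma> i"
    by (cases i rule: index_cases2) (auto simp only: subst_map_eqs subst_inv_eqs assms, auto simp: algebra_simps)
qed

text \<open>The image of each letter contains exactly one non-zero letter, so the total grows by the
  number of zeros in the image. The dual identity \<open>sum_subst_inv\<close> accounts for the
  denominator \<open>1 - \<alpha> 0\<close> of \<open>K_map\<close>.\<close>

lemma sum_subst_map: "(\<Sum>i<k. subst_map k m \<gamma> i) = (\<Sum>i<k. \<gamma> i) + subst_map k m \<gamma> 0"
proof -
  have "(\<Sum>i<k-2. subst_map k m \<gamma> (i + 1)) = (\<Sum>i<k-2. \<gamma> i)"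
    by (intro sum.cong refl subst_map_eqs(2)) simp
  then show ?thesis
    unfolding sum_split_ends[of "subst_map k m \<gamma>"] sum_split_last2[of \<gamma>] subst_map_eqs(3) by simp
qed

lemma sum_subst_inv: "(\<Sum>i<k. subst_inv k m \<alpha> i) = (\<Sum>i<k. \<alpha> i) - \<alpha> 0"
proof -
  have "(\<Sum>i<k-2. subst_inv k m \<alpha> i) = (\<Sum>i<k-2. \<alpha> (i + 1))"
    by (intro sum.cong refl subst_inv_eqs(1)) simp
  then show ?thesis
    unfolding sum_split_last2[of "subst_inv k m \<alpha>"] sum_split_ends[of \<alpha>] subst_inv_eqs(2,3)
    by (simp add: algebra_simps)
qed

lemma subst_map_linear:
  "subst_map k m (\<lambda>i. a * \<gamma> i + b * \<delta> i) = (\<lambda>i. a * subst_map k m \<gamma> i + b * subst_map k m \<delta> i)"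
  by (auto simp: subst_map_def fun_eq_iff algebra_simps)

lemma subst_map_scale: "subst_map k m (\<lambda>i. a * \<gamma> i) = (\<lambda>i. a * subst_map k m \<gamma> i)"
  using subst_map_linear[of m a \<gamma> 0] by simp

lemma subst_inv_linear:
  "subst_inv k m (\<lambda>i. a * \<gamma> i + b * \<delta> i) = (\<lambda>i. a * subst_inv k m \<gamma> i + b * subst_inv k m \<delta> i)"
  by (auto simp: subst_inv_def fun_eq_iff algebra_simps)

lemma subst_inv_scale: "subst_inv k m (\<lambda>i. a * \<gamma> i) = (\<lambda>i. a * subst_inv k m \<gamma> i)"
  using subst_inv_linear[of m a \<gamma> 0] by simp

lemma subst_map_nonneg:
  assumes "\<And>i. i < k \<Longrightarrow> 0 \<le> \<gamma> i"
  shows "0 \<le> subst_map k m \<gamma> i"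
  using assms k3 by (auto simp: subst_map_def)

lemma normalise_simplex:
  assumes "\<And>i. i < k \<Longrightarrow> 0 \<le> \<gamma> i" "\<And>i. k \<le> i \<Longrightarrow> \<gamma> i = 0" "0 < (\<Sum>i<k. \<gamma> i)"
  shows "normalise k \<gamma> \<in> unit_simplex k"
  using assms by (auto simp: unit_simplex_def normalise_def sum_nonneg simp flip: sum_divide_distrib)

lemma normalise_scale: "a \<noteq> 0 \<Longrightarrow> normalise k (\<lambda>i. a * \<gamma> i) = normalise k \<gamma>"
  by (simp add: normalise_def flip: sum_distrib_left)

lemma count_subst_letter:
  assumes "a < k"
  shows "real (count_list (subst_letter k m a) i) = subst_map k m (\<lambda>j. if j = a then 1 else 0) i"
proof -
  have ne: "k - 2 \<noteq> k - 1" "k - 1 \<noteq> 0" "k - 2 \<noteq> 0" using k3 by arith+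
  consider "a < k - 2" | "a = k - 2" | "a = k - 1" using assms by linarith
  then show ?thesis
  proof cases
    case 1
    then show ?thesis
      using k3 by (auto simp: subst_letter_small subst_map_def)
  next
    case 2
    show ?thesis unfolding 2 subst_letter_penult
      by (cases i rule: index_cases) (use ne k3 in \<open>auto simp: subst_map_def count_list_replicate\<close>)
  next
    case 3
    show ?thesis unfolding 3 subst_letter_last
      by (cases i rule: index_cases) (use ne k3 in \<open>auto simp: subst_map_def count_list_replicate\<close>)
  qed
qed

lemma count_subst_word:
  assumes "set u \<subseteq> {..<k}"
  shows "real (count_list (subst_word k m u) i) = subst_map k m (\<lambda>j. real (count_list u j)) i"
  using assms
proof (induction u)
  case Nil
  then show ?case by (simp add: subst_map_def)
next
  case (Cons a u)
  have "(\<lambda>j. real (count_list (a # u) j)) = (\<lambda>j. 1 * (if j = a then 1 else 0) + 1 * real (count_list u j))"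
    by auto
  then have "subst_map k m (\<lambda>j. real (count_list (a # u) j)) i
      = subst_map k m (\<lambda>j. if j = a then 1 else 0) i + subst_map k m (\<lambda>j. real (count_list u j)) i"
    by (simp only: subst_map_linear)
  then show ?case using Cons count_subst_letter[of a m i] by simp
qed

lemma word_freq_eq_normalise:
  assumes "set u \<subseteq> {..<k}"
  shows "word_freq u = normalise k (\<lambda>i. real (count_list u i))"
  using sum_count_set[OF assms] by (simp add: normalise_def word_freq_def fun_eq_iff flip: of_nat_sum)

lemma count_eq_word_freq: "real (count_list u i) = real (length u) * word_freq u i"
  by (cases "u = []") (simp_all add: word_freq_def)

lemma tendsto_subst_map:
  assumes "\<And>i. i < k \<Longrightarrow> (\<lambda>t. f t i) \<longlonglongrightarrow> \<gamma> i"
  shows "(\<lambda>t. subst_map k m (f t) i) \<longlonglongrightarrow> subst_map k m \<gamma> i"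
  unfolding subst_map_def using k3 by (auto intro!: tendsto_intros assms)

lemma tendsto_subst_inv:
  assumes "\<And>i. i < k \<Longrightarrow> (\<lambda>t. f t i) \<longlonglongrightarrow> \<gamma> i"
  shows "(\<lambda>t. subst_inv k m (f t) i) \<longlonglongrightarrow> subst_inv k m \<gamma> i"
  unfolding subst_inv_def using k3 by (auto intro!: tendsto_intros assms)

lemma tendsto_normalise:
  assumes "\<And>i. i < k \<Longrightarrow> (\<lambda>t. f t i) \<longlonglongrightarrow> \<gamma> i" "(\<Sum>i<k. \<gamma> i) \<noteq> 0" "i < k"
  shows "(\<lambda>t. normalise k (f t) i) \<longlonglongrightarrow> normalise k \<gamma> i"
  unfolding normalise_def using assms by (intro tendsto_intros) auto

lemma sum_subst_map_ge:
  assumes "\<And>i. i < k \<Longrightarrow> 0 \<le> \<gamma> i"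
  shows "(\<Sum>i<k. \<gamma> i) \<le> (\<Sum>i<k. subst_map k m \<gamma> i)"
  using sum_subst_map[of m \<gamma>] subst_map_nonneg[of \<gamma> m 0] assms by simp

text \<open>Substitution keeps words free and acts on their counts by the matrix. Normalisation
  passes to the limit because the total stays at least 1.\<close>

lemma DF_subst_map:
  assumes "\<gamma> \<in> DF k (shift n)"
  shows "normalise k (subst_map k (n 0) \<gamma>) \<in> DF k n"
proof -
  obtain u where u: "\<And>t. free_word k (S_seq k (shift n)) (u t)" "\<And>t. u t \<noteq> []"
    "\<And>i. i < k \<Longrightarrow> (\<lambda>t. word_freq (u t) i) \<longlonglongrightarrow> \<gamma> i"
    using assms by (rule DF_seqE) blast
  let ?A = "subst_map k (n 0)"
  have \<gamma>: "\<gamma> \<in> unit_simplex k" using DF_simplex assms .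
  then have "0 \<le> \<gamma> i" if "i < k" for i using that by (simp add: unit_simplex_def)
  note nn = this
  have pos: "1 \<le> (\<Sum>i<k. ?A \<gamma> i)"
    using sum_subst_map_ge[of \<gamma> "n 0"] nn \<gamma> by (simp add: unit_simplex_def)
  show ?thesis
  proof (rule DF_seqI)
    show "normalise k (?A \<gamma>) \<in> unit_simplex k"
      using pos subst_map_nonneg[of \<gamma>] nn subst_map_eqs(4) by (intro normalise_simplex) auto
    show "free_word k (S_seq k n) (subst_word k (n 0) (u t))" for t
      unfolding S_seq_unfold[of n] by (rule free_word_subst[OF u(1) S_seq_digit S_seq_0])
    show "subst_word k (n 0) (u t) \<noteq> []" for t
      using length_subst_word[of "u t" k "n 0"] u(2)[of t] by auto
    fix i assume i: "i < k"
    have eq: "word_freq (subst_word k (n 0) (u t)) = normalise k (?A (word_freq (u t)))" for t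
    proof -
      have ut: "set (u t) \<subseteq> {..<k}" using u(1) by (simp add: free_word_def)
      have "word_freq (subst_word k (n 0) (u t)) = normalise k (?A (\<lambda>j. real (count_list (u t) j)))"
        by (simp only: word_freq_eq_normalise[OF set_subst_word[OF ut]] count_subst_word[OF ut])
      also have "\<dots> = normalise k (?A (word_freq (u t)))"
        using u(2)[of t] by (simp add: count_eq_word_freq subst_map_scale normalise_scale)
      finally show ?thesis .
    qed
    show "(\<lambda>t. word_freq (subst_word k (n 0) (u t)) i) \<longlonglongrightarrow> normalise k (?A \<gamma>) i"
      unfolding eq using u(3) pos i by (intro tendsto_normalise tendsto_subst_map) auto
  qed
qed

section \<open>Desubstitution of free words and the map \<open>K_map\<close>\<close>

lemma word_below_leading_zeros:
  assumes "word_below ((k - 1) # xs) (subst_seq k m s)" "s \<in> digit_seqs k" "s 0 = k - 1"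
  shows "\<exists>ys. xs = replicate m 0 @ ys"
proof -
  let ?S = "subst_seq k m s"
  obtain p x q where p: "(k - 1) # xs = p @ x # q" "p = map ?S [0..<length p]" "x < ?S (length p)"
    using assms(1) by (rule word_belowE)
  note start = subst_seq_start[OF assms(2,3), where m = m]
  have "p \<noteq> []" using p start(1) by auto
  \<comment> \<open>The common prefix \<open>p\<close> cannot end within the block of zeros of
    \<open>?S\<close>, because no letter is smaller than \<open>0\<close>; so it contains the whole
    block.\<close>
  then have "?S (length p) = 0" if "length p \<le> m" using start(2)[OF _ that] by simp
  then have "\<not> length p \<le> m" using p(3) by auto
  then have len: "m < length p" by simp
  have "xs ! i = 0" if "i < m" for i
  proof -
    have "p ! Suc i = map ?S [0..<length p] ! Suc i" using p(2) by simp
    also have "\<dots> = 0" using that len start(2)[of "Suc i"] by simp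
    finally have "p ! Suc i = 0" .
    moreover have "((k - 1) # xs) ! Suc i = p ! Suc i" using p(1) that len by (simp add: nth_append)
    ultimately show ?thesis by simp
  qed
  moreover have "m \<le> length xs" using arg_cong[OF p(1), of length] len by simp
  ultimately have "take m xs = replicate m 0" by (intro nth_equalityI) auto
  then show ?thesis by (metis append_take_drop_id)
qed

text \<open>The last conclusion expresses that moving zeros to the left only lowers a word. It
  ranges over all \<open>S\<close> because removing an equal first letter turns \<open>S\<close>
  into \<open>shift S\<close>. For a new letter \<open>k - 1\<close> it is applied to the bound
  itself and pulled back by \<open>word_below_substD\<close>.\<close>

lemma park_free_word:
  assumes "free_word k (subst_seq k m s) u" "s \<in> digit_seqs k" "s 0 = k - 1" "park k m u = (c, w)"
  shows "free_word k s w \<and> (\<forall>i. count_list u i = count_list (subst_word k m w) i + (if i = 0 then c else 0))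
    \<and> (\<forall>S. word_below u S \<longrightarrow> word_below (replicate c 0 @ subst_word k m w) S)"
  using assms(1,4)
proof (induction u arbitrary: c w)
  case (Cons x xs)
  obtain d v where dv: "park k m xs = (d, v)" by fastforce
  have x: "x < k" "word_below (x # xs) (subst_seq k m s)" "free_word k (subst_seq k m s) xs"
    using Cons.prems(1) by (simp_all add: free_word_Cons)
  have IH: "free_word k s v"
    "\<And>i. count_list xs i = count_list (subst_word k m v) i + (if i = 0 then d else 0)"
    "\<And>S. word_below xs S \<Longrightarrow> word_below (replicate d 0 @ subst_word k m v) S"
    using Cons.IH[OF x(3) dv] by blast+
  \<comment> \<open>Every new letter other than \<open>k - 1\<close> is smaller than the first
    letter of \<open>s\<close>, so only a new \<open>k - 1\<close> needs an argument.\<close>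
  have small: "free_word k s (y # v)" if "y < k - 1" for y
    using that IH(1) assms(3) by (auto simp: free_word_Cons intro: word_below_Cons)
  have same: "word_below (x # replicate d 0 @ subst_word k m v) S" if "word_below (x # xs) S" for S
    using that IH(3) by (auto simp: word_below_Cons_iff)
  have zero: "word_below (replicate (Suc r) 0 @ z) S" if "word_below (x # xs) S" "0 < x" for r z S
  proof -
    have "0 < S 0" using that by (auto simp: word_below_Cons_iff)
    then show ?thesis by (simp add: word_below_Cons)
  qed
  consider "x = 0" | "0 < x" "x < k - 1" | "x = k - 1" "m < d" | "x = k - 1" "d \<le> m"
    using x(1) by linarith
  then show ?case
  proof cases
    case 1
    then have cw: "c = Suc d" "w = v" using Cons.prems(2) dv by auto
    show ?thesis using IH same 1 unfolding cw by auto
  next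
    case 2
    then have cw: "c = d" "w = (x - 1) # v" using Cons.prems(2) dv by auto
    have l: "subst_letter k m (x - 1) = [x]" using 2 by (simp add: subst_letter_small)
    have "word_below (replicate d 0 @ x # subst_word k m v) S" if "word_below (x # xs) S" for S
      using same[OF that] zero[OF that 2(1)] by (cases d) auto
    then show ?thesis unfolding cw subst_word_simps l
      using IH(2) small[of "x - 1"] 2 by auto
  next
    case 3
    then have cw: "c = d - Suc m" "w = (k - 2) # v" using Cons.prems(2) dv k3 by auto
    have l: "subst_letter k m (k - 2) = x # replicate (Suc m) 0" using 3 subst_letter_penult by simp
    have "word_below (replicate c 0 @ x # replicate (Suc m) 0 @ subst_word k m v) S"
      if "word_below (x # xs) S" for S
    proof (cases c)
      case 0
      then have "d = Suc m" using cw 3 by simp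
      then show ?thesis using same[OF that] 0 by simp
    next
      case (Suc r)
      then show ?thesis using zero[OF that] 3 k3 by simp
    qed
    moreover have "count_list (x # xs) i = count_list (subst_word k m w) i + (if i = 0 then c else 0)" for i
      unfolding cw subst_word_simps l using IH(2)[of i] 3 k3 by (simp add: count_list_replicate)
    ultimately show ?thesis
      using small[of "k - 2"] k3 unfolding cw subst_word_simps l by simp
  next
    case 4
    then have cw: "c = 0" "w = (k - 1) # v" using Cons.prems(2) dv k3 by auto
    \<comment> \<open>The zeros directly behind this \<open>k - 1\<close> all enter the carry, so
      \<open>d\<close> is at least \<open>m\<close>. Together with \<open>d \<le> m\<close> this
      means that the image of \<open>k - 1\<close> uses up the carry exactly.\<close>
    obtain ys where "xs = replicate m 0 @ ys"
      using word_below_leading_zeros[OF _ assms(2,3)] x(2) 4 by blast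
    then have d: "d = m" using park_zeros[of k m m ys] dv 4 by simp
    have l: "subst_letter k m (k - 1) = x # replicate m 0" using 4 subst_letter_last by simp
    have below: "word_below (subst_word k m w) S" if "word_below (x # xs) S" for S
      using same[OF that] unfolding cw subst_word_simps l d by simp
    have "set w \<subseteq> {..<k}" using IH(1) k3 unfolding cw by (simp add: free_word_def)
    then have "word_below w s"
      using word_below_substD[OF below[OF x(2)] _ assms(2)] by blast
    then have "free_word k s w" using IH(1) k3 unfolding cw by (simp add: free_word_Cons)
    moreover have "count_list (x # xs) i = count_list (subst_word k m w) i + (if i = 0 then c else 0)" for i
      unfolding cw subst_word_simps l using IH(2)[of i] d 4 k3 by (simp add: count_list_replicate)
    ultimately show ?thesis using below cw by simp
  qed
qed simp

lemma simplex'D: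
  assumes "\<alpha> \<in> unit_simplex' k"
  shows "0 < \<alpha> (k - 1)" "0 \<le> \<alpha> 0" "\<alpha> 0 < 1" "real (J_map k \<alpha>) * \<alpha> (k - 1) \<le> \<alpha> 0"
    "\<alpha> 0 < (real (J_map k \<alpha>) + 1) * \<alpha> (k - 1)" "\<alpha> \<in> unit_simplex k"
    "\<And>i. 0 \<le> \<alpha> i" "(\<Sum>i<k. \<alpha> i) = 1" "\<And>i. k \<le> i \<Longrightarrow> \<alpha> i = 0"
proof -
  show simplex: "\<alpha> \<in> unit_simplex k" and sum: "(\<Sum>i<k. \<alpha> i) = 1" 
    using assms by (auto simp: unit_simplex'_def unit_simplex_def)
  show "\<alpha> i = 0" if "k \<le> i" for i using that simplex by (simp add: unit_simplex_def)
  have nn: "0 \<le> \<alpha> i" for i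
    using simplex by (cases "i < k") (auto simp: unit_simplex_def)
  show last: "0 < \<alpha> (k - 1)" using assms nn[of "k - 1"] by (auto simp: unit_simplex'_def)
  have "0 \<le> (\<Sum>i<k-2. \<alpha> (i + 1))" using nn by (intro sum_nonneg)
  then show "\<alpha> 0 < 1" using sum last sum_split_ends[of \<alpha>] by linarith
  show "0 \<le> \<alpha> 0" and "0 \<le> \<alpha> i" for i by (rule nn)+
  have J: "real (J_map k \<alpha>) = of_int \<lfloor>\<alpha> 0 / \<alpha> (k - 1)\<rfloor>" using nn last by (simp add: J_map_def)
  then have "real (J_map k \<alpha>) \<le> \<alpha> 0 / \<alpha> (k - 1)" "\<alpha> 0 / \<alpha> (k - 1) < real (J_map k \<alpha>) + 1"
    by linarith+
  then show "real (J_map k \<alpha>) * \<alpha> (k - 1) \<le> \<alpha> 0" "\<alpha> 0 < (real (J_map k \<alpha>) + 1) * \<alpha> (k - 1)"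
    using last by (simp_all add: field_simps)
qed

lemma K_map_eq: "K_map k \<alpha> i = subst_inv k (J_map k \<alpha>) \<alpha> i / (1 - \<alpha> 0)"
  by (simp add: K_map_def subst_inv_def)

lemma K_map_eq_normalise:
  "\<alpha> \<in> unit_simplex' k \<Longrightarrow> K_map k \<alpha> = normalise k (subst_inv k (J_map k \<alpha>) \<alpha>)"
  by (simp add: fun_eq_iff K_map_eq normalise_def sum_subst_inv simplex'D)

lemma K_map_simplex':
  assumes "\<alpha> \<in> unit_simplex' k"
  shows "K_map k \<alpha> \<in> unit_simplex' k"
proof -
  note D = simplex'D[OF assms]
  let ?B = "subst_inv k (J_map k \<alpha>) \<alpha>"
  have "0 \<le> ?B i" for i
  proof (cases i rule: index_cases2)
    case 1
    then show ?thesis using D(7) by (simp add: subst_inv_eqs(1))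
  next
    case 2
    then show ?thesis using D(4) by (simp add: subst_inv_eqs(2))
  next
    case 3
    then show ?thesis using D(5) subst_inv_eqs(3) by simp
  next
    case 4
    then show ?thesis by (simp add: subst_inv_eqs(4))
  qed
  then have "K_map k \<alpha> \<in> unit_simplex k"
    unfolding K_map_eq_normalise[OF assms] using D subst_inv_eqs(4)
    by (intro normalise_simplex) (auto simp: sum_subst_inv)
  moreover have "K_map k \<alpha> (k - 1) \<noteq> 0"
    unfolding K_map_eq subst_inv_eqs using D by auto
  ultimately show ?thesis by (simp add: unit_simplex'_def)
qed

text \<open>By \<open>park\<close>, a free word has the letter counts of an image under the
  substitution plus some further zeros. In an image every \<open>k - 1\<close> brings at least
  \<open>n 0\<close> zeros, and this inequality between counts survives the limit.\<close>

lemma DF_J_map_ge: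
  assumes "\<alpha> \<in> DF k n" "\<alpha> \<in> unit_simplex' k"
  shows "n 0 \<le> J_map k \<alpha>"
proof -
  obtain u where u: "\<And>t. free_word k (S_seq k n) (u t)" "\<And>t. u t \<noteq> []"
    "\<And>i. i < k \<Longrightarrow> (\<lambda>t. word_freq (u t) i) \<longlonglongrightarrow> \<alpha> i"
    using assms(1) by (rule DF_seqE) blast
  have le: "real (n 0) * word_freq (u t) (k - 1) \<le> word_freq (u t) 0" for t
  proof -
    obtain c w where cw: "park k (n 0) (u t) = (c, w)" by fastforce
    have w: "free_word k (S_seq k (shift n)) w"
      "\<And>i. count_list (u t) i = count_list (subst_word k (n 0) w) i + (if i = 0 then c else 0)"
      using park_free_word[OF u(1)[of t, unfolded S_seq_unfold[of n]] S_seq_digit S_seq_0 cw] by blast+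
    have cnt: "real (count_list (subst_word k (n 0) w) i) = subst_map k (n 0) (\<lambda>j. real (count_list w j)) i" for i
      using w(1) by (intro count_subst_word) (simp add: free_word_def)
    have "real (n 0) * real (count_list (u t) (k - 1)) \<le> real (count_list (u t) 0)"
      using w(2)[of 0] w(2)[of "k - 1"] cnt[of 0] cnt[of "k - 1"] k3
      by (simp add: subst_map_eqs(1) subst_map_eqs(3)[simplified] algebra_simps)
    then show ?thesis
      by (simp add: word_freq_def divide_right_mono)
  qed
  have lim: "(\<lambda>t. real (n 0) * word_freq (u t) (k - 1)) \<longlonglongrightarrow> real (n 0) * \<alpha> (k - 1)"
    "(\<lambda>t. word_freq (u t) 0) \<longlonglongrightarrow> \<alpha> 0"
    using u(3)[of "k - 1"] u(3)[of 0] k3 by (auto intro!: tendsto_intros)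
  have "real (n 0) * \<alpha> (k - 1) \<le> \<alpha> 0"
    using lim le by (intro LIMSEQ_le[OF lim]) auto
  then have "real (n 0) \<le> \<alpha> 0 / \<alpha> (k - 1)" using simplex'D[OF assms(2)] by (simp add: field_simps)
  then show ?thesis unfolding J_map_def by (rule le_nat_floor)
qed

text \<open>\<open>J_map k \<alpha> = n 0\<close> puts the frequency of \<open>0\<close> strictly
  below \<open>n 0 + 1\<close> times that of \<open>k - 1\<close>, so almost all approximating words
  satisfy the hypothesis of \<open>park_carry_power\<close>. Repeating such a word
  \<open>Suc t\<close> times reduces the share of leftover zeros to at most
  \<open>1 / real (Suc t)\<close>.\<close>

lemma DF_K_map:
  assumes "\<alpha> \<in> DF k n" "\<alpha> \<in> unit_simplex' k" "J_map k \<alpha> = n 0"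
  shows "K_map k \<alpha> \<in> DF k (shift n)"
proof -
  obtain u where u: "\<And>t. free_word k (S_seq k n) (u t)" "\<And>t. u t \<noteq> []"
    "\<And>i. i < k \<Longrightarrow> (\<lambda>t. word_freq (u t) i) \<longlonglongrightarrow> \<alpha> i"
    using assms(1) by (rule DF_seqE) blast
  note D = simplex'D[OF assms(2)]
  let ?m = "n 0" and ?B = "subst_inv k (n 0)"
  define W where "W = (\<lambda>t. concat (replicate (Suc t) (u t)))"
  define c where "c = (\<lambda>t. fst (park k ?m (W t)))"
  define w where "w = (\<lambda>t. snd (park k ?m (W t)))"
  \<comment> \<open>Frequencies of \<open>W t\<close> after removal of the leftover zeros, still
    relative to the full length. The inverse matrix sends \<open>f t\<close> to a multiple of the
    counts of \<open>w t\<close>.\<close>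
  define f where "f = (\<lambda>t i. 1 * word_freq (u t) i + (- (real (c t) / real (length (W t)))) * (if i = 0 then 1 else 0))"
  have uk: "set (u t) \<subseteq> {..<k}" for t using u(1) by (simp add: free_word_def)
  have lenW: "length (W t) = Suc t * length (u t)" for t by (simp add: W_def length_concat sum_list_replicate)
  have cntW: "count_list (concat (replicate r (u t))) i = r * count_list (u t) i" for t r i
    by (induction r) auto
  have freqW: "word_freq (W t) i = word_freq (u t) i" for t i
  proof -
    have "count_list (W t) i = Suc t * count_list (u t) i" unfolding W_def by (rule cntW)
    then show ?thesis unfolding word_freq_def lenW using u(2)[of t] by (simp only: of_nat_mult) simp
  qed
  have W: "free_word k (S_seq k n) (W t)" for t
    unfolding W_def using u(1) by (intro free_word_concat) auto
  have w: "free_word k (S_seq k (shift n)) (w t)"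
    "\<And>i. count_list (W t) i = count_list (subst_word k ?m (w t)) i + (if i = 0 then c t else 0)" for t
    using park_free_word[OF W[of t, unfolded S_seq_unfold[of n]] S_seq_digit S_seq_0, of "c t" "w t"]
    by (auto simp: c_def w_def)
  have wk: "set (w t) \<subseteq> {..<k}" for t using w(1) by (simp add: free_word_def)
  have Wpos: "0 < real (length (W t))" for t using u(2)[of t] by (simp add: lenW del: mult_Suc)
  have eq: "(\<lambda>i. real (count_list (w t) i)) = (\<lambda>i. real (length (W t)) * ?B (f t) i)" for t
  proof -
    have "(\<lambda>i. real (count_list (w t) i)) = ?B (subst_map k ?m (\<lambda>i. real (count_list (w t) i)))"
      using wk[of t] by (intro subst_inv_map[symmetric]) (auto intro!: count_notin)
    also have "subst_map k ?m (\<lambda>i. real (count_list (w t) i)) = (\<lambda>i. real (length (W t)) * f t i)"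
    proof
      fix i
      have "subst_map k ?m (\<lambda>i. real (count_list (w t) i)) i
          = real (count_list (W t) i) - (if i = 0 then real (c t) else 0)"
        using count_subst_word[OF wk, of ?m t i] w(2)[of t i] by simp
      then show "subst_map k ?m (\<lambda>i. real (count_list (w t) i)) i = real (length (W t)) * f t i"
        using Wpos[of t] count_eq_word_freq[of "W t" i]
        by (cases "i = 0") (simp_all add: freqW f_def algebra_simps)
    qed
    finally show ?thesis by (simp only: subst_inv_scale)
  qed
  have freq: "word_freq (w t) = normalise k (?B (f t))" for t
    unfolding word_freq_eq_normalise[OF wk] eq using Wpos[of t] by (intro normalise_scale) simp
  have "\<forall>\<^sub>F t in sequentially. word_freq (u t) 0 < (real ?m + 1) * word_freq (u t) (k - 1)"
  proof -
    have "(\<lambda>t. (real ?m + 1) * word_freq (u t) (k - 1) - word_freq (u t) 0)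
        \<longlonglongrightarrow> (real ?m + 1) * \<alpha> (k - 1) - \<alpha> 0"
      using k3 by (intro tendsto_intros u(3)) auto
    then have "\<forall>\<^sub>F t in sequentially. 0 < (real ?m + 1) * word_freq (u t) (k - 1) - word_freq (u t) 0"
      using D(5) assms(3) by (intro order_tendstoD(1)) auto
    then show ?thesis by simp
  qed
  then have c_small: "\<forall>\<^sub>F t in sequentially. real (c t) / real (length (W t)) \<le> 1 / real (Suc t)"
  proof (rule eventually_mono)
    fix t assume t: "word_freq (u t) 0 < (real ?m + 1) * word_freq (u t) (k - 1)"
    have "real (count_list (u t) 0) \<le> (real ?m + 1) * real (count_list (u t) (k - 1))"
    proof -
      have "real (length (u t)) * word_freq (u t) 0
          \<le> real (length (u t)) * ((real ?m + 1) * word_freq (u t) (k - 1))"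
        using t by (intro mult_left_mono) auto
      then show ?thesis unfolding count_eq_word_freq by (simp add: algebra_simps)
    qed
    then have "c t \<le> length (u t)"
      unfolding c_def W_def using k3 by (intro park_carry_power[OF _ uk]) auto
    then have "real (c t) / real (length (W t)) \<le> real (length (u t)) / real (length (W t))"
      by (intro divide_right_mono) auto
    also have "\<dots> = 1 / real (Suc t)" using u(2)[of t] unfolding lenW of_nat_mult by (simp del: of_nat_Suc)
    finally show "real (c t) / real (length (W t)) \<le> 1 / real (Suc t)" .
  qed
  have c0: "(\<lambda>t. real (c t) / real (length (W t))) \<longlonglongrightarrow> 0"
    by (rule tendsto_sandwich[OF _ c_small tendsto_const lim_inverse_n'[THEN LIMSEQ_Suc]]) simp
  have limf: "(\<lambda>t. f t i) \<longlonglongrightarrow> \<alpha> i" if "i < k" for i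
  proof -
    have "(\<lambda>t. f t i) \<longlonglongrightarrow> 1 * \<alpha> i + (- 0) * (if i = 0 then 1 else 0)"
      unfolding f_def by (intro tendsto_intros u(3) c0 that)
    then show ?thesis by simp
  qed
  have limB: "(\<lambda>t. ?B (f t) i) \<longlonglongrightarrow> ?B \<alpha> i" for i by (intro tendsto_subst_inv limf)
  have sumB: "(\<Sum>i<k. ?B \<alpha> i) = 1 - \<alpha> 0" using D by (simp add: sum_subst_inv)
  have "(\<lambda>t. \<Sum>i<k. ?B (f t) i) \<longlonglongrightarrow> 1 - \<alpha> 0"
    unfolding sumB[symmetric] by (intro tendsto_sum limB)
  then have "\<forall>\<^sub>F t in sequentially. 0 < (\<Sum>i<k. ?B (f t) i)"
    by (rule order_tendstoD(1)) (use D(3) in simp)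
  \<comment> \<open>\<open>w t\<close> may be empty for small \<open>t\<close>. From
    \<open>N\<close> on its total is positive, hence the shift of the index by \<open>N\<close>
    below.\<close>
  then obtain N where N: "\<And>t. N \<le> t \<Longrightarrow> 0 < (\<Sum>i<k. ?B (f t) i)" by (auto simp: eventually_sequentially)
  have ne: "w t \<noteq> []" if "N \<le> t" for t
  proof
    assume "w t = []"
    then have "?B (f t) i = 0" for i using fun_cong[OF eq[of t], of i] Wpos[of t] by simp
    then show False using N[OF that] by simp
  qed
  show ?thesis
  proof (rule DF_seqI[of _ _ "\<lambda>t. w (t + N)"])
    show "K_map k \<alpha> \<in> unit_simplex k" using simplex'D(6)[OF K_map_simplex'[OF assms(2)]] .
    fix i assume "i < k"
    then show "(\<lambda>t. word_freq (w (t + N)) i) \<longlonglongrightarrow> K_map k \<alpha> i"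
      unfolding freq K_map_eq_normalise[OF assms(2)] assms(3)
      using sumB D by (intro LIMSEQ_ignore_initial_segment[of "\<lambda>t. normalise k (?B (f t)) i"]
          tendsto_normalise limB) auto
  qed (use w(1) ne in auto)
qed

lemma itinerary_0: "itinerary k \<alpha> 0 = J_map k \<alpha>"
  by (simp add: itinerary_def)

lemma shift_itinerary: "shift (itinerary k \<alpha>) = itinerary k (K_map k \<alpha>)"
  by (simp add: itinerary_def shift_def funpow_swap1)

lemma DF_itinerary_not_less:
  assumes "\<alpha> \<in> DF k b" "\<alpha> \<in> unit_simplex' k"
  shows "\<not> less_fun (itinerary k \<alpha>) b"
proof
  assume "less_fun (itinerary k \<alpha>) b"
  then obtain r where "itinerary k \<alpha> r < b r" "\<And>i. i < r \<Longrightarrow> itinerary k \<alpha> i = b i"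
    by (auto elim: less_funE)
  then show False using assms
  proof (induction r arbitrary: \<alpha> b)
    case 0
    then show ?case using DF_J_map_ge[of \<alpha> b] by (simp add: itinerary_0)
  next
    case (Suc r)
    have "J_map k \<alpha> = b 0" using Suc.prems(2)[of 0] by (simp add: itinerary_0)
    then have "K_map k \<alpha> \<in> DF k (shift b)" using DF_K_map Suc.prems by blast
    then show False
    proof (rule Suc.IH[rotated 2])
      show "itinerary k (K_map k \<alpha>) r < shift b r"
        using Suc.prems(1) unfolding shift_itinerary[symmetric] by (simp add: shift_def)
      show "itinerary k (K_map k \<alpha>) i = shift b i" if "i < r" for i
        using Suc.prems(2)[of "Suc i"] that unfolding shift_itinerary[symmetric] by (simp add: shift_def)
      show "K_map k \<alpha> \<in> unit_simplex' k" using K_map_simplex' Suc.prems by blast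
    qed
  qed
qed

end

section \<open>Cylinders of itineraries\<close>

primrec map_iter :: "nat \<Rightarrow> (nat \<Rightarrow> nat) \<Rightarrow> nat \<Rightarrow> (nat \<Rightarrow> real) \<Rightarrow> (nat \<Rightarrow> real)" where
  "map_iter k n 0 \<gamma> = \<gamma>"
| "map_iter k n (Suc r) \<gamma> = subst_map k (n 0) (map_iter k (shift n) r \<gamma>)"

primrec inv_iter :: "nat \<Rightarrow> (nat \<Rightarrow> nat) \<Rightarrow> nat \<Rightarrow> (nat \<Rightarrow> real) \<Rightarrow> (nat \<Rightarrow> real)" where
  "inv_iter k n 0 \<alpha> = \<alpha>"
| "inv_iter k n (Suc r) \<alpha> = inv_iter k (shift n) r (subst_inv k (n 0) \<alpha>)"

text \<open>The closed simplex spanned by the normalised columns of the product of the first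
  \<open>r\<close> matrices. It contains every point of \<open>unit_simplex' k\<close> whose
  itinerary starts with these \<open>r\<close> entries, but its boundary points may have other
  itineraries.\<close>

definition cylinder :: "nat \<Rightarrow> (nat \<Rightarrow> nat) \<Rightarrow> nat \<Rightarrow> (nat \<Rightarrow> real) set" where
  "cylinder k n r = {\<alpha> \<in> unit_simplex k. \<forall>i. 0 \<le> inv_iter k n r \<alpha> i}"

definition top_vertex :: "nat \<Rightarrow> nat \<Rightarrow> real" where
  "top_vertex k = (\<lambda>i. if i = k - 1 then 1 else 0)"

lemma compact_box: "compact (Pi\<^sub>E (UNIV :: nat set) (\<lambda>_. {0..1::real}))"
  using compactin_PiE[of "\<lambda>_. euclidean :: real topology" "UNIV :: nat set" "\<lambda>_. {0..1}"]
  by (simp add: euclidean_product_topology compactin_euclidean_iff)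

lemma simplex_le_1:
  assumes "\<alpha> \<in> unit_simplex k"
  shows "0 \<le> \<alpha> i" "\<alpha> i \<le> 1"
proof -
  show "0 \<le> \<alpha> i" using assms by (cases "i < k") (auto simp: unit_simplex_def)
  show "\<alpha> i \<le> 1"
  proof (cases "i < k")
    case True
    then have "\<alpha> i \<le> (\<Sum>i<k. \<alpha> i)" using assms by (intro member_le_sum) (auto simp: unit_simplex_def)
    then show ?thesis using assms by (simp add: unit_simplex_def)
  qed (use assms in \<open>simp add: unit_simplex_def\<close>)
qed

text \<open>Points are functions on all of \<open>nat\<close> with values in \<open>{0..1}\<close>,
  so compactness comes from the infinite cube in the product topology, where convergence is
  coordinatewise.\<close>

lemma simplex_convergent_subseq:
  assumes "\<And>t. f t \<in> unit_simplex k"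
  obtains l and \<phi> :: "nat \<Rightarrow> nat" where "l \<in> unit_simplex k" "strict_mono \<phi>"
    "\<And>i. (\<lambda>t. f (\<phi> t) i) \<longlonglongrightarrow> l i"
proof -
  have "f t \<in> Pi\<^sub>E UNIV (\<lambda>_. {0..1})" for t using simplex_le_1[OF assms[of t]] by auto
  then obtain l and \<phi> :: "nat \<Rightarrow> nat" where \<phi>: "strict_mono \<phi>" "(f \<circ> \<phi>) \<longlonglongrightarrow> l"
    using compact_imp_seq_compact[OF compact_box] unfolding seq_compact_def by metis
  have lim: "(\<lambda>t. f (\<phi> t) i) \<longlonglongrightarrow> l i" for i
    using continuous_on_tendsto_compose[OF continuous_on_product_coordinates \<phi>(2), of i]
    by (simp add: comp_def)
  have "0 \<le> l i" for i
    using lim simplex_le_1[OF assms] by (intro LIMSEQ_le_const[OF lim]) auto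
  moreover have "l i = 0" if "k \<le> i" for i
  proof -
    have "f (\<phi> t) i = 0" for t using assms that by (simp add: unit_simplex_def)
    then show ?thesis using lim[of i] by (simp add: LIMSEQ_const_iff)
  qed
  moreover have "(\<Sum>i<k. l i) = 1"
  proof -
    have "(\<lambda>t. \<Sum>i<k. f (\<phi> t) i) \<longlonglongrightarrow> (\<Sum>i<k. l i)" by (intro tendsto_sum lim)
    moreover have "(\<Sum>i<k. f (\<phi> t) i) = 1" for t using assms by (simp add: unit_simplex_def)
    ultimately show ?thesis by (simp add: LIMSEQ_const_iff)
  qed
  ultimately have "l \<in> unit_simplex k" by (simp add: unit_simplex_def)
  then show thesis using that \<phi>(1) lim by blast
qed

context alphabet
begin

lemma map_iter_snoc: "map_iter k n (Suc r) \<gamma> = map_iter k n r (subst_map k (n r) \<gamma>)"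
proof (induction r arbitrary: n)
  case (Suc r)
  have "shift n r = n (Suc r)" by (simp add: shift_def)
  then show ?case by (simp only: map_iter.simps(2)[of k n] Suc)
qed simp

lemma inv_iter_snoc: "inv_iter k n (Suc r) \<alpha> = subst_inv k (n r) (inv_iter k n r \<alpha>)"
proof (induction r arbitrary: n \<alpha>)
  case (Suc r)
  have "shift n r = n (Suc r)" by (simp add: shift_def)
  moreover have "inv_iter k (shift n) (Suc r) (subst_inv k (n 0) \<alpha>)
      = subst_inv k (shift n r) (inv_iter k (shift n) r (subst_inv k (n 0) \<alpha>))" by (rule Suc)
  ultimately show ?case by (simp only: inv_iter.simps(2)[of k n])
qed simp

lemma map_iter_cong:
  "(\<And>i. i < r \<Longrightarrow> n i = n' i) \<Longrightarrow> map_iter k n r \<gamma> = map_iter k n' r \<gamma>"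
proof (induction r arbitrary: \<gamma>)
  case (Suc r)
  then show ?case unfolding map_iter_snoc by simp
qed simp

lemma inv_iter_cong:
  "(\<And>i. i < r \<Longrightarrow> n i = n' i) \<Longrightarrow> inv_iter k n r \<alpha> = inv_iter k n' r \<alpha>"
proof (induction r arbitrary: \<alpha>)
  case (Suc r)
  then show ?case unfolding inv_iter_snoc by simp
qed simp

lemma map_iter_outside: "(\<And>i. k \<le> i \<Longrightarrow> \<gamma> i = 0) \<Longrightarrow> k \<le> i \<Longrightarrow> map_iter k n r \<gamma> i = 0"
  by (induction r arbitrary: n) (auto simp: subst_map_eqs)

lemma inv_iter_outside: "(\<And>i. k \<le> i \<Longrightarrow> \<gamma> i = 0) \<Longrightarrow> k \<le> i \<Longrightarrow> inv_iter k n r \<gamma> i = 0"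
  by (cases r) (auto simp: inv_iter_snoc subst_inv_eqs simp del: inv_iter.simps(2))

lemma inv_iter_map_iter:
  "(\<And>i. k \<le> i \<Longrightarrow> \<gamma> i = 0) \<Longrightarrow> inv_iter k n r (map_iter k n r \<gamma>) = \<gamma>"
  by (induction r arbitrary: n) (simp_all add: subst_inv_map map_iter_outside)

lemma map_iter_inv_iter:
  "(\<And>i. k \<le> i \<Longrightarrow> \<alpha> i = 0) \<Longrightarrow> map_iter k n r (inv_iter k n r \<alpha>) = \<alpha>"
  by (induction r arbitrary: n \<alpha>) (simp_all add: subst_map_inv subst_inv_eqs)

lemma map_iter_linear:
  "map_iter k n r (\<lambda>i. a * \<gamma> i + b * \<delta> i) = (\<lambda>i. a * map_iter k n r \<gamma> i + b * map_iter k n r \<delta> i)"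
  by (induction r arbitrary: n) (simp_all add: subst_map_linear)

lemma inv_iter_scale: "inv_iter k n r (\<lambda>i. a * \<alpha> i) = (\<lambda>i. a * inv_iter k n r \<alpha> i)"
  by (induction r arbitrary: n \<alpha>) (simp_all add: subst_inv_scale)

lemma map_iter_nonneg: "(\<And>i. 0 \<le> \<gamma> i) \<Longrightarrow> 0 \<le> map_iter k n r \<gamma> i"
  by (induction r arbitrary: n i) (simp_all add: subst_map_nonneg)

lemma sum_map_iter_ge: "(\<And>i. 0 \<le> \<gamma> i) \<Longrightarrow> (\<Sum>i<k. \<gamma> i) \<le> (\<Sum>i<k. map_iter k n r \<gamma> i)"
proof (induction r arbitrary: n)
  case (Suc r)
  show ?case
    using Suc.IH[of "shift n"] Suc.prems
      sum_subst_map_ge[of "map_iter k (shift n) r \<gamma>" "n 0"] map_iter_nonneg[of \<gamma> "shift n" r]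
    by simp
qed simp

lemma cylinder_Suc: "cylinder k n (Suc r) \<subseteq> cylinder k n r"
proof
  fix \<alpha> assume \<alpha>: "\<alpha> \<in> cylinder k n (Suc r)"
  then have "k \<le> i \<Longrightarrow> \<alpha> i = 0" for i by (simp add: cylinder_def unit_simplex_def)
  then have "k \<le> i \<Longrightarrow> inv_iter k n r \<alpha> i = 0" for i by (rule inv_iter_outside)
  then have "inv_iter k n r \<alpha> = subst_map k (n r) (inv_iter k n (Suc r) \<alpha>)"
    unfolding inv_iter_snoc by (rule subst_map_inv[symmetric])
  then show "\<alpha> \<in> cylinder k n r" 
    using \<alpha> by (simp add: cylinder_def subst_map_nonneg del: inv_iter.simps)
qed

lemma cylinder_antimono: "r \<le> r' \<Longrightarrow> cylinder k n r' \<subseteq> cylinder k n r"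
  by (induction rule: dec_induct) (use cylinder_Suc in blast)+

lemma cylinder_cong: "(\<And>i. i < r \<Longrightarrow> n i = n' i) \<Longrightarrow> cylinder k n r = cylinder k n' r"
  unfolding cylinder_def using inv_iter_cong[of r n n'] by simp

lemma normalise_map_iter_cylinder:
  assumes "\<gamma> \<in> unit_simplex k"
  shows "normalise k (map_iter k n r \<gamma>) \<in> cylinder k n r"
proof -
  have \<gamma>: "\<And>i. 0 \<le> \<gamma> i" "\<And>i. k \<le> i \<Longrightarrow> \<gamma> i = 0" "(\<Sum>i<k. \<gamma> i) = 1"
    using assms simplex_le_1[OF assms] by (auto simp: unit_simplex_def)
  let ?M = "map_iter k n r \<gamma>" let ?s = "\<Sum>i<k. ?M i"
  have s: "1 \<le> ?s" using sum_map_iter_ge[of \<gamma> n r] \<gamma>(1,3) by simp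
  have "normalise k ?M = (\<lambda>i. (1 / ?s) * ?M i)" by (simp add: normalise_def)
  then have "inv_iter k n r (normalise k ?M) = (\<lambda>i. (1 / ?s) * \<gamma> i)"
    using \<gamma>(2) by (simp add: inv_iter_scale inv_iter_map_iter del: times_divide_eq_left)
  moreover have "normalise k ?M \<in> unit_simplex k"
    using s map_iter_nonneg[OF \<gamma>(1)] map_iter_outside[OF \<gamma>(2)] by (intro normalise_simplex) auto
  ultimately show ?thesis using s \<gamma>(1) by (simp add: cylinder_def)
qed

text \<open>Up to normalisation the iterates of \<open>K_map\<close> are the inverse matrix
  products, so \<open>inv_iter\<close> yields a positive multiple of a point of the simplex.\<close>

lemma itinerary_cylinder:
  assumes "\<alpha> \<in> unit_simplex' k"
  shows "\<alpha> \<in> cylinder k (itinerary k \<alpha>) r"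
proof -
  have iter: "(K_map k ^^ r) \<alpha> \<in> unit_simplex' k" for r
    by (induction r) (use assms K_map_simplex' in auto)
  have "\<exists>c>0. inv_iter k (itinerary k \<alpha>) r \<alpha> = (\<lambda>i. c * (K_map k ^^ r) \<alpha> i)"
  proof (induction r)
    case 0
    show ?case by (intro exI[of _ 1]) simp
  next
    case (Suc r)
    let ?\<beta> = "(K_map k ^^ r) \<alpha>"
    obtain c where c: "0 < c" "inv_iter k (itinerary k \<alpha>) r \<alpha> = (\<lambda>i. c * ?\<beta> i)" using Suc by blast
    have \<beta>: "?\<beta> 0 < 1" using simplex'D(3)[OF iter] .
    have "inv_iter k (itinerary k \<alpha>) (Suc r) \<alpha> = (\<lambda>i. c * subst_inv k (J_map k ?\<beta>) ?\<beta> i)"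
      unfolding inv_iter_snoc c(2) subst_inv_scale by (simp add: itinerary_def)
    also have "\<dots> = (\<lambda>i. (c * (1 - ?\<beta> 0)) * (K_map k ^^ Suc r) \<alpha> i)"
      using \<beta> by (simp add: K_map_eq)
    finally show ?case using c(1) \<beta> by (intro exI[of _ "c * (1 - ?\<beta> 0)"]) simp
  qed
  then show ?thesis
    using simplex'D(6)[OF assms] simplex'D(7)[OF iter] by (auto simp: cylinder_def)
qed

text \<open>If the last coordinate of an image of a non-negative vector is zero, then the last two
  coordinates of that vector are zero, while the zeros before it are only shifted. So each step back
  adds one zero at the end.\<close>

lemma map_iter_zero_tail:
  assumes "\<And>i. 0 \<le> \<delta> i" "\<And>i. i < k \<Longrightarrow> k \<le> i + 1 + t \<Longrightarrow> map_iter k n r \<delta> i = 0" "t + r < k"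
    "i < k" "k \<le> i + 1 + t + r"
  shows "\<delta> i = 0"
  using assms(2-)
proof (induction r arbitrary: n t)
  case (Suc r)
  let ?\<gamma> = "map_iter k (shift n) r \<delta>"
  have nn: "0 \<le> ?\<gamma> j" for j using assms(1) by (rule map_iter_nonneg)
  have "subst_map k (n 0) ?\<gamma> (k - 1) = 0" using Suc.prems(1)[of "k - 1"] k3 by simp
  then have last: "?\<gamma> (k - 2) = 0" "?\<gamma> (k - 1) = 0"
    using nn[of "k - 2"] nn[of "k - 1"] unfolding subst_map_eqs(3) by linarith+
  show ?case
  proof (rule Suc.IH[of "Suc t" "shift n"])
    fix j assume j: "j < k" "k \<le> j + 1 + Suc t"
    consider "j < k - 2" | "j = k - 2" | "j = k - 1" using j by linarith
    then show "?\<gamma> j = 0"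
    proof cases
      case 1
      then have "subst_map k (n 0) ?\<gamma> (j + 1) = 0" using Suc.prems(1)[of "j + 1"] j by simp
      then show ?thesis unfolding subst_map_eqs(2)[OF 1] .
    qed (use last in auto)
  qed (use Suc.prems in auto)
qed simp

text \<open>A zero last coordinate would spread, within \<open>k - 1\<close> steps back, over all
  coordinates of the preimage, and \<alpha> would be the zero vector.\<close>

lemma cylinder_last_pos:
  assumes "\<alpha> \<in> cylinder k n (k - 1)"
  shows "0 < \<alpha> (k - 1)"
proof (rule ccontr)
  have \<alpha>: "\<alpha> \<in> unit_simplex k" "\<And>i. k \<le> i \<Longrightarrow> \<alpha> i = 0" "(\<Sum>i<k. \<alpha> i) = 1"
    using assms by (auto simp: cylinder_def unit_simplex_def)
  let ?\<delta> = "inv_iter k n (k - 1) \<alpha>"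
  have eq: "map_iter k n (k - 1) ?\<delta> = \<alpha>" by (rule map_iter_inv_iter[OF \<alpha>(2)])
  assume "\<not> 0 < \<alpha> (k - 1)"
  then have "\<alpha> (k - 1) = 0" using simplex_le_1(1)[OF \<alpha>(1), of "k - 1"] by linarith
  then have "map_iter k n (k - 1) ?\<delta> i = 0" if "i < k" "k \<le> i + 1 + 0" for i
  proof -
    have "i = k - 1" using that by simp
    then show ?thesis unfolding eq using \<open>\<alpha> (k - 1) = 0\<close> by simp
  qed
  then have "?\<delta> i = 0" if "i < k" for i
    using map_iter_zero_tail[of ?\<delta> 0 n "k - 1" i] assms that k3 by (simp add: cylinder_def)
  moreover have "?\<delta> i = 0" if "k \<le> i" for i using inv_iter_outside[OF \<alpha>(2) that] .
  ultimately have "?\<delta> = (\<lambda>i. 0 * ?\<delta> i + 0 * ?\<delta> i)" by (metis add_0 mult_zero_left not_le)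
  then have "map_iter k n (k - 1) ?\<delta> = (\<lambda>i. 0)"
    using map_iter_linear[of n "k - 1" 0 ?\<delta> 0 ?\<delta>] by (metis add_0 mult_zero_left)
  then have "\<alpha> = (\<lambda>i. 0)" using eq by simp
  then show False using \<alpha>(3) by simp
qed

text \<open>\<open>cylinder_last_pos\<close> is used twice: for \<alpha>, to reach
  \<open>unit_simplex' k\<close>, and for the desubstituted point, whose positive last coordinate is
  the strict inequality that excludes the boundary and makes the floor equal to
  \<open>n 0\<close>.\<close>

lemma cylinders_step:
  assumes "\<And>r. \<alpha> \<in> cylinder k n r"
  shows "\<alpha> \<in> unit_simplex' k" "J_map k \<alpha> = n 0" "\<And>r. K_map k \<alpha> \<in> cylinder k (shift n) r"
proof -
  let ?\<gamma> = "subst_inv k (n 0) \<alpha>"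
  have last: "0 < \<alpha> (k - 1)" using cylinder_last_pos assms by blast
  show s': "\<alpha> \<in> unit_simplex' k"
    using assms[of 0] last by (simp add: cylinder_def unit_simplex'_def)
  note D = simplex'D[OF s']
  have \<gamma>: "0 \<le> ?\<gamma> i" for i using assms[of "Suc 0"] by (simp add: cylinder_def)
  have sum: "(\<Sum>i<k. ?\<gamma> i) = 1 - \<alpha> 0" using D by (simp add: sum_subst_inv)
  have norm: "normalise k ?\<gamma> = (\<lambda>i. (1 / (1 - \<alpha> 0)) * ?\<gamma> i)" unfolding normalise_def sum by simp
  have simplex: "normalise k ?\<gamma> \<in> unit_simplex k"
    using \<gamma> D sum subst_inv_eqs(4) by (intro normalise_simplex) auto
  have cyl: "normalise k ?\<gamma> \<in> cylinder k (shift n) r" for r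
  proof -
    have "0 \<le> inv_iter k (shift n) r ?\<gamma> i" for i
      using assms[of "Suc r"] by (simp add: cylinder_def)
    then have "0 \<le> inv_iter k (shift n) r (normalise k ?\<gamma>) i" for i
      unfolding norm inv_iter_scale using D by simp
    then show ?thesis using simplex by (simp add: cylinder_def)
  qed
  have "0 < normalise k ?\<gamma> (k - 1)" using cylinder_last_pos cyl by blast
  then have "0 < ?\<gamma> (k - 1)" using D unfolding norm by (simp add: zero_less_mult_iff zero_less_divide_iff)
  then have "\<alpha> 0 / \<alpha> (k - 1) < real (n 0) + 1" "real (n 0) \<le> \<alpha> 0 / \<alpha> (k - 1)"
    using \<gamma>[of "k - 2"] last unfolding subst_inv_eqs by (simp_all add: field_simps)
  then have "\<lfloor>\<alpha> 0 / \<alpha> (k - 1)\<rfloor> = int (n 0)" by linarith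
  then show J: "J_map k \<alpha> = n 0" by (simp add: J_map_def)
  show "K_map k \<alpha> \<in> cylinder k (shift n) r" for r
    using cyl unfolding K_map_eq_normalise[OF s'] J .
qed

lemma cylinders_itinerary:
  assumes "\<And>r. \<alpha> \<in> cylinder k n r"
  shows "itinerary k \<alpha> = n"
proof
  fix r
  show "itinerary k \<alpha> r = n r"
    using assms
  proof (induction r arbitrary: \<alpha> n)
    case 0
    then show ?case using cylinders_step(2) by (simp add: itinerary_0)
  next
    case (Suc r)
    have "itinerary k (K_map k \<alpha>) r = shift n r"
      using cylinders_step(3)[OF Suc.prems] by (rule Suc.IH)
    then show ?case unfolding shift_itinerary[symmetric] by (simp add: shift_def)
  qed
qed

lemma top_vertex_simplex: "top_vertex k \<in> unit_simplex k"
  using k3 by (auto simp: unit_simplex_def top_vertex_def)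

text \<open>The constant sequence \<open>k - 1\<close> equals its own bound, so its prefixes are not
  free. A final \<open>0\<close> repairs this, and its frequency vanishes in the limit.\<close>

lemma top_vertex_DF: "top_vertex k \<in> DF k (\<lambda>_. 0)"
proof (rule DF_seqI[OF top_vertex_simplex])
  let ?u = "\<lambda>t. replicate t (k - 1) @ [0::nat]"
  have "free_word k (\<lambda>_. k - 1) (?u t)" for t
  proof (induction t)
    case 0
    then show ?case using k3 by (simp add: free_word_Cons word_below_Cons)
  next
    case (Suc t)
    have "word_below (?u (Suc t)) (\<lambda>_. k - 1)"
      using k3 by (intro word_belowI[of "replicate (Suc t) (k - 1)"]) (simp_all del: replicate_Suc)
    then show ?case using Suc k3 by (simp add: free_word_Cons)
  qed
  then show "free_word k (S_seq k (\<lambda>_. 0)) (?u t)" for t unfolding S_seq_zero .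
  fix i assume "i < k"
  have "(\<lambda>t. 1 / real (Suc t)) \<longlonglongrightarrow> 0" by (rule lim_inverse_n'[THEN LIMSEQ_Suc])
  moreover have "(\<lambda>t. 1 - 1 / real (Suc t)) \<longlonglongrightarrow> 1 - 0" by (intro tendsto_intros calculation)
  moreover have "real t / real (Suc t) = 1 - 1 / real (Suc t)" for t
    using of_nat_neq_0[of t, where ?'a = real] by (simp add: divide_simps)
  then have "word_freq (?u t) i = (if i = k - 1 then 1 - 1 / real (Suc t) else if i = 0 then 1 / real (Suc t) else 0)" for t
    using k3 by (auto simp: word_freq_def count_list_replicate simp del: of_nat_Suc)
  ultimately show "(\<lambda>t. word_freq (?u t) i) \<longlonglongrightarrow> top_vertex k i"
    by (cases "i = k - 1"; cases "i = 0") (simp_all add: top_vertex_def)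
qed simp

lemma normalise_map_iter_DF:
  "normalise k (map_iter k n r (top_vertex k)) \<in> DF k (\<lambda>i. if i < r then n i else 0)"
proof (induction r arbitrary: n)
  case 0
  have "normalise k (top_vertex k) = top_vertex k"
    using top_vertex_simplex by (simp add: normalise_def unit_simplex_def)
  then show ?case using top_vertex_DF by simp
next
  case (Suc r)
  let ?n = "\<lambda>i. if i < Suc r then n i else 0" and ?M = "map_iter k (shift n) r (top_vertex k)"
  have nn: "0 \<le> top_vertex k i" for i by (simp add: top_vertex_def)
  have s: "1 \<le> (\<Sum>i<k. ?M i)"
    using sum_map_iter_ge[of "top_vertex k" "shift n" r] nn top_vertex_simplex by (simp add: unit_simplex_def)
  have "normalise k ?M \<in> DF k (\<lambda>i. if i < r then shift n i else 0)" by (rule Suc.IH)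
  also have "(\<lambda>i. if i < r then shift n i else 0) = shift ?n" by (auto simp: shift_def)
  finally have "normalise k (subst_map k (?n 0) (normalise k ?M)) \<in> DF k ?n" by (rule DF_subst_map)
  \<comment> \<open>The inner normalisation only rescales the vector, and the outer one cancels the
    factor.\<close>
  also have "normalise k ?M = (\<lambda>i. (1 / (\<Sum>i<k. ?M i)) * ?M i)" by (simp add: normalise_def)
  also have "normalise k (subst_map k (?n 0) \<dots>) = normalise k (map_iter k n (Suc r) (top_vertex k))"
    using s unfolding subst_map_scale by (subst normalise_scale) auto
  finally show ?case .
qed

text \<open>Vertices of the cylinders accumulate at a point of all cylinders, as these are nested
  and closed. The vertex of step \<open>r\<close> lies in \<open>DF\<close> of the sequence
  \<open>n\<close> cut off by zeros after \<open>r\<close> entries, so by continuity of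
  \<open>DF\<close> the limit lies in \<open>DF k n\<close>.\<close>

lemma itinerary_surj:
  obtains \<alpha> where "\<alpha> \<in> unit_simplex' k" "itinerary k \<alpha> = n" "\<alpha> \<in> DF k n"
proof -
  define f where "f = (\<lambda>r. normalise k (map_iter k n r (top_vertex k)))"
  have cyl: "f r \<in> cylinder k n r" for r
    unfolding f_def by (rule normalise_map_iter_cylinder[OF top_vertex_simplex])
  then have "f r \<in> unit_simplex k" for r by (simp add: cylinder_def)
  then obtain \<alpha> \<phi> where \<alpha>: "\<alpha> \<in> unit_simplex k" "strict_mono \<phi>" "\<And>i. (\<lambda>t. f (\<phi> t) i) \<longlonglongrightarrow> \<alpha> i"
    using simplex_convergent_subseq[of f k] by blast
  have le: "t \<le> \<phi> t" for t using \<alpha>(2) by (rule strict_mono_imp_increasing)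
  have cyl': "\<alpha> \<in> cylinder k n r" for r
  proof -
    have "(\<lambda>t. inv_iter k n r (f (\<phi> t)) i) \<longlonglongrightarrow> inv_iter k n r \<alpha> i" for i
    proof (induction r arbitrary: i)
      case (Suc r)
      then show ?case unfolding inv_iter_snoc by (intro tendsto_subst_inv)
    qed (use \<alpha>(3) in simp)
    moreover have "0 \<le> inv_iter k n r (f (\<phi> t)) i" if "r \<le> t" for t i
      using cyl[of "\<phi> t"] cylinder_antimono[of r "\<phi> t" n] le[of t] that by (auto simp: cylinder_def)
    ultimately have "0 \<le> inv_iter k n r \<alpha> i" for i
      by (intro LIMSEQ_le_const[of "\<lambda>t. inv_iter k n r (f (\<phi> t)) i"]) auto
    then show ?thesis using \<alpha>(1) by (simp add: cylinder_def)
  qed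
  have "\<alpha> \<in> DF k n"
  proof (rule DF_closed[OF \<alpha>(1)])
    fix \<epsilon> :: real assume "0 < \<epsilon>"
    then obtain q where q: "1 / real (Suc q) < \<epsilon> / 4" using nat_approx_posE[of "\<epsilon> / 4"] by auto
    have "0 < \<epsilon> / 2" using \<open>0 < \<epsilon>\<close> by simp
    then obtain N where N: "\<And>t i. N \<le> t \<Longrightarrow> i < k \<Longrightarrow> \<bar>f (\<phi> t) i - \<alpha> i\<bar> < \<epsilon> / 2"
      using coordinates_eventually_near[of k "\<lambda>t. f (\<phi> t)" \<alpha>] \<alpha>(3) by blast
    define t where "t = max N (Suc q * (k - 1))"
    have "\<exists>\<beta>\<in>DF k n. \<forall>i<k. \<bar>\<beta> i - f (\<phi> t) i\<bar> \<le> 2 / real (Suc q)"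
    proof (rule DF_near)
      show "f (\<phi> t) \<in> DF k (\<lambda>i. if i < \<phi> t then n i else 0)"
        unfolding f_def by (rule normalise_map_iter_DF)
      show "(if i < \<phi> t then n i else 0) = n i" if "i < Suc q * (k - 1)" for i
      proof -
        have "Suc q * (k - 1) \<le> t" unfolding t_def by (rule max.cobounded2)
        then have "i < \<phi> t" using that le[of t] by (meson less_le_trans)
        then show ?thesis by simp
      qed
    qed simp
    then obtain \<beta> where \<beta>: "\<beta> \<in> DF k n" "\<And>i. i < k \<Longrightarrow> \<bar>\<beta> i - f (\<phi> t) i\<bar> \<le> 2 / real (Suc q)" by blast
    have "\<bar>\<beta> i - \<alpha> i\<bar> < \<epsilon>" if "i < k" for i
    proof -
      have "2 / real (Suc q) < \<epsilon> / 2" using q by (simp add: field_simps)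
      moreover have "\<bar>f (\<phi> t) i - \<alpha> i\<bar> < \<epsilon> / 2" using N[of t i] that by (simp add: t_def)
      ultimately show ?thesis using \<beta>(2)[OF that] by linarith
    qed
    then show "\<exists>\<beta>\<in>DF k n. \<forall>i<k. \<bar>\<beta> i - \<alpha> i\<bar> < \<epsilon>" using \<beta>(1) by blast
  qed
  then show thesis using that cylinders_step(1)[OF cyl'] cylinders_itinerary[OF cyl'] by blast
qed

text \<open>The point of \<open>DF k n\<close> with itinerary \<open>n\<close> cannot lie in
  \<open>DF k b\<close>. Together with \<open>DF_antimono\<close>, inclusion of the sets thus
  determines the order of the sequences.\<close>

lemma DF_not_subset:
  assumes "less_fun n b"
  shows "\<not> DF k n \<subseteq> DF k b"
proof -
  obtain \<alpha> where "\<alpha> \<in> unit_simplex' k" "itinerary k \<alpha> = n" "\<alpha> \<in> DF k n"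
    by (rule itinerary_surj)
  then show ?thesis using DF_itinerary_not_less[of \<alpha> b] assms by blast
qed

end

section \<open>Generic itineraries\<close>

definition unit_vec :: "nat \<Rightarrow> nat \<Rightarrow> real" where
  "unit_vec t = (\<lambda>i. if i = t then 1 else 0)"

text \<open>The condition with index \<open>j\<close> also handles the integer vector with code \<open>j\<close>; entries of
  the list beyond its length are unspecified integers, which does no harm.\<close>

definition resolved :: "nat \<Rightarrow> (nat \<Rightarrow> nat) \<Rightarrow> nat \<Rightarrow> nat \<Rightarrow> bool" where
  "resolved k n r j \<longleftrightarrow>
     (\<forall>\<alpha>\<in>cylinder k n r. \<forall>\<beta>\<in>cylinder k n r. \<forall>i<k. \<bar>\<alpha> i - \<beta> i\<bar> < 1 / real (Suc j)) \<and>
     ((\<exists>i<k. (from_nat j :: int list) ! i \<noteq> 0) \<longrightarrow>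
        (\<forall>\<alpha>\<in>cylinder k n r. (\<Sum>i<k. of_int ((from_nat j :: int list) ! i) * \<alpha> i) \<noteq> 0))"

definition generic :: "nat \<Rightarrow> (nat \<Rightarrow> nat) \<Rightarrow> bool" where
  "generic k n \<longleftrightarrow> (\<forall>j. \<exists>r. resolved k n r j)"

lemma resolvedD:
  assumes "resolved k n r j"
  shows "\<And>\<alpha> \<beta> i. \<alpha> \<in> cylinder k n r \<Longrightarrow> \<beta> \<in> cylinder k n r \<Longrightarrow> i < k \<Longrightarrow>
      \<bar>\<alpha> i - \<beta> i\<bar> < 1 / real (Suc j)"
    "\<And>\<alpha> i. i < k \<Longrightarrow> (from_nat j :: int list) ! i \<noteq> 0 \<Longrightarrow> \<alpha> \<in> cylinder k n r \<Longrightarrow>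
      (\<Sum>i<k. of_int ((from_nat j :: int list) ! i) * \<alpha> i) \<noteq> 0"
  using assms unfolding resolved_def by metis+

context alphabet
begin

lemma resolved_mono:
  assumes "resolved k n r j" "r \<le> r'"
  shows "resolved k n r' j"
  using resolvedD[OF assms(1)] cylinder_antimono[OF assms(2), of n]
  unfolding resolved_def by (meson subsetD)

lemma resolved_cong: "(\<And>i. i < r \<Longrightarrow> n i = n' i) \<Longrightarrow> resolved k n r j \<longleftrightarrow> resolved k n' r j"
  using cylinder_cong[of r n n'] unfolding resolved_def by simp

text \<open>A point with the same itinerary lies in the same cylinders, whose diameters shrink to
  zero. An integer relation is excluded by the condition whose index codes its coefficients.\<close>

lemma generic_imp:
  assumes "generic k (itinerary k \<alpha>)" "\<alpha> \<in> unit_simplex' k"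
  shows "regular k \<alpha>" "completely_irrational k \<alpha>"
proof -
  let ?n = "itinerary k \<alpha>"
  note \<alpha> = itinerary_cylinder[OF assms(2)]
  have "\<beta> = \<alpha>" if \<beta>: "\<beta> \<in> unit_simplex' k" "itinerary k \<beta> = ?n" for \<beta>
  proof
    fix i
    show "\<beta> i = \<alpha> i"
    proof (cases "i < k")
      case True
      have "\<bar>\<beta> i - \<alpha> i\<bar> < \<epsilon>" if \<epsilon>: "0 < \<epsilon>" for \<epsilon>
      proof -
        obtain j where j: "1 / real (Suc j) < \<epsilon>" using \<epsilon> by (rule nat_approx_posE)
        obtain r where "resolved k ?n r j" using assms(1) by (auto simp: generic_def)
        then have "\<bar>\<beta> i - \<alpha> i\<bar> < 1 / real (Suc j)"
          using itinerary_cylinder[OF \<beta>(1), of r] True unfolding \<beta>(2) by (intro resolvedD(1)[OF _ _ \<alpha>])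
        then show ?thesis using j by linarith
      qed
      then have "\<bar>\<beta> i - \<alpha> i\<bar> \<le> 0" by (meson not_le order_less_irrefl)
      then show ?thesis by simp
    qed (use simplex'D(9)[OF \<beta>(1)] simplex'D(9)[OF assms(2)] in simp)
  qed
  then show "regular k \<alpha>" using assms(2) unfolding regular_def by blast
  show "completely_irrational k \<alpha>"
    unfolding completely_irrational_def
  proof
    assume "\<exists>m::nat \<Rightarrow> int. (\<exists>i<k. m i \<noteq> 0) \<and> (\<Sum>i<k. of_int (m i) * \<alpha> i) = 0"
    then obtain m :: "nat \<Rightarrow> int" where m: "\<exists>i<k. m i \<noteq> 0" "(\<Sum>i<k. of_int (m i) * \<alpha> i) = 0" by blast
    define j where "j = to_nat (map m [0..<k])"
    have nth: "(from_nat j :: int list) ! i = m i" if "i < k" for i using that by (simp add: j_def)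
    obtain r where "resolved k ?n r j" using assms(1) by (auto simp: generic_def)
    moreover obtain i where "i < k" "m i \<noteq> 0" using m(1) by blast
    ultimately have "(\<Sum>i<k. of_int ((from_nat j :: int list) ! i) * \<alpha> i) \<noteq> 0"
      using nth[of i] \<alpha>[of r] by (intro resolvedD(2)[of k ?n r j i]) simp_all
    then show False using m(2) nth by simp
  qed
qed

section \<open>Blocks of zeros and the contraction of cylinders\<close>

lemma map_iter_add: "map_iter k n (r + s) \<gamma> = map_iter k n r (map_iter k ((shift ^^ r) n) s \<gamma>)"
proof (induction r arbitrary: n)
  case (Suc r)
  have "(shift ^^ Suc r) n = (shift ^^ r) (shift n)" by (simp only: funpow_Suc_right comp_def)
  then show ?case using Suc by simp
qed simp

lemma inv_iter_add: "inv_iter k n (r + s) \<alpha> = inv_iter k ((shift ^^ r) n) s (inv_iter k n r \<alpha>)"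
proof (induction r arbitrary: n \<alpha>)
  case (Suc r)
  have "(shift ^^ Suc r) n = (shift ^^ r) (shift n)" by (simp only: funpow_Suc_right comp_def)
  then show ?case using Suc by simp
qed simp

lemma shift_zero [simp]: "shift (\<lambda>_. 0) = (\<lambda>_. 0)" "(shift ^^ r) (\<lambda>_. 0) = (\<lambda>_. 0)"
  by (simp_all add: shift_def shift_funpow)

abbreviation zero_iter :: "nat \<Rightarrow> (nat \<Rightarrow> real) \<Rightarrow> (nat \<Rightarrow> real)" where
  "zero_iter \<equiv> map_iter k (\<lambda>_. 0)"

lemma zero_iter_sum: "(\<Sum>i<k-1. zero_iter t \<gamma> i) = (\<Sum>i<k-1. \<gamma> i)"
proof (induction t)
  case (Suc t)
  obtain j where j: "k - 1 = Suc j" "k - 2 = j" using k3 by (cases "k - 1") auto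
  have "(\<Sum>i<k-1. subst_map k 0 \<delta> i) = (\<Sum>i<k-1. \<delta> i)" for \<delta>
  proof -
    have "(\<Sum>i<j. subst_map k 0 \<delta> (i + 1)) = (\<Sum>i<j. \<delta> i)"
      using j by (intro sum.cong refl subst_map_eqs(2)) simp
    then show ?thesis
      unfolding j(1) sum.lessThan_Suc_shift[of "subst_map k 0 \<delta>" j] sum.lessThan_Suc[of \<delta> j] using j(2) by (simp add: subst_map_eqs(1))
  qed
  then show ?case using Suc by simp
qed simp

lemma zero_iter_shifted: "t \<le> i \<Longrightarrow> i < k - 1 \<Longrightarrow> zero_iter t \<gamma> i = \<gamma> (i - t)"
proof (induction t arbitrary: i)
  case (Suc t)
  then obtain i' where i: "i = i' + 1" by (cases i) auto
  then have "i' < k - 2" using Suc.prems by simp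
  then show ?case using Suc i subst_map_eqs(2)[of i' 0 "zero_iter t \<gamma>"] by simp
qed simp

lemma zero_iter_last: "t \<le> k - 1 \<Longrightarrow> zero_iter t \<gamma> (k - 1) = \<gamma> (k - 1) + (\<Sum>j<t. \<gamma> (k - 2 - j))"
proof (induction t)
  case (Suc t)
  have "zero_iter t \<gamma> (k - 2) = \<gamma> (k - 2 - t)"
    using Suc.prems k3 by (intro zero_iter_shifted) auto
  moreover have "zero_iter (Suc t) \<gamma> (k - 1) = zero_iter t \<gamma> (k - 2) + zero_iter t \<gamma> (k - 1)"
    by (simp only: map_iter.simps shift_zero subst_map_eqs(3))
  ultimately show ?case using Suc by simp
qed simp

text \<open>The first \<open>k - 1\<close> coordinates are permuted cyclically, and each passes once through the
  position \<open>k - 2\<close>, whose content is added to the last coordinate.\<close>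

lemma zero_iter_last_mult:
  "zero_iter (q * (k - 1)) \<gamma> (k - 1) = \<gamma> (k - 1) + real q * (\<Sum>i<k-1. \<gamma> i)"
proof (induction q)
  case (Suc q)
  let ?\<delta> = "zero_iter (q * (k - 1)) \<gamma>"
  have "zero_iter (Suc q * (k - 1)) \<gamma> (k - 1) = zero_iter (k - 1) ?\<delta> (k - 1)"
    by (simp add: map_iter_add)
  also have "\<dots> = ?\<delta> (k - 1) + (\<Sum>j<k-1. ?\<delta> (k - 2 - j))" by (rule zero_iter_last) simp
  also have "(\<Sum>j<k-1. ?\<delta> (k - 2 - j)) = (\<Sum>i<k-1. ?\<delta> i)"
    using sum.nat_diff_reindex[of ?\<delta> "k - 1"] by (simp add: numeral_2_eq_2)
  also have "\<dots> = (\<Sum>i<k-1. \<gamma> i)" by (rule zero_iter_sum)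
  finally show ?case using Suc by (simp add: algebra_simps)
qed simp

lemma sum_map_iter_le:
  "\<exists>C\<ge>0. \<forall>\<tau>. (\<forall>i. 0 \<le> \<tau> i) \<longrightarrow> (\<Sum>i<k. map_iter k n r \<tau> i) \<le> C * (\<Sum>i<k. \<tau> i)"
proof (induction r arbitrary: n)
  case 0
  show ?case by (intro exI[of _ 1]) simp
next
  case (Suc r)
  obtain C where C: "0 \<le> C" "\<And>\<tau>. (\<forall>i. 0 \<le> \<tau> i) \<Longrightarrow>
      (\<Sum>i<k. map_iter k (shift n) r \<tau> i) \<le> C * (\<Sum>i<k. \<tau> i)"
    using Suc by blast
  \<comment> \<open>\<open>m + 2\<close> is the length of the longest image of a letter, that of
    \<open>k - 2\<close>.\<close>
  have step: "(\<Sum>i<k. subst_map k m \<delta> i) \<le> (real m + 2) * (\<Sum>i<k. \<delta> i)" if nn: "\<And>i. 0 \<le> \<delta> i" for m \<delta>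
  proof -
    have "0 \<le> (\<Sum>i<k-2. \<delta> i)" using nn by (intro sum_nonneg)
    then have "(real m + 1) * (\<delta> (k - 2) + \<delta> (k - 1)) \<le> (real m + 1) * (\<Sum>i<k. \<delta> i)"
      unfolding sum_split_last2[of \<delta>] by (intro mult_left_mono) auto
    then show ?thesis
      using nn[of "k - 1"] unfolding sum_subst_map subst_map_eqs(1) by (simp add: algebra_simps)
  qed
  show ?case
  proof (intro exI[of _ "(real (n 0) + 2) * C"] conjI allI impI)
    fix \<tau> :: "nat \<Rightarrow> real" assume \<tau>: "\<forall>i. 0 \<le> \<tau> i"
    have "(\<Sum>i<k. map_iter k n (Suc r) \<tau> i) \<le> (real (n 0) + 2) * (\<Sum>i<k. map_iter k (shift n) r \<tau> i)"
      unfolding map_iter.simps using \<tau> by (intro step map_iter_nonneg) blast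
    also have "\<dots> \<le> (real (n 0) + 2) * (C * (\<Sum>i<k. \<tau> i))"
      using C(2)[OF \<tau>] by (intro mult_left_mono) auto
    finally show "(\<Sum>i<k. map_iter k n (Suc r) \<tau> i) \<le> (real (n 0) + 2) * C * (\<Sum>i<k. \<tau> i)"
      by (simp add: mult.assoc)
  qed (use C(1) in simp)
qed

text \<open>Let \<delta> be the vector behind the first \<open>R\<close> matrices, and
  \<open>T\<close> the sum of its first \<open>k - 1\<close> coordinates. Each round of
  \<open>k - 1\<close> zeros adds \<open>T\<close> to the last coordinate and leaves
  \<open>T\<close> unchanged, so after \<open>q\<close> rounds the bounded total forces
  \<open>T \<le> 1 / real q\<close>. Hence \<delta> is nearly a multiple of the top vertex, and the
  fixed product of \<open>R\<close> matrices costs only a constant.\<close>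

lemma cylinder_contraction:
  assumes zero: "\<And>i. R \<le> i \<Longrightarrow> n i = 0"
  defines "\<alpha>' \<equiv> normalise k (map_iter k n R (top_vertex k))"
  obtains C where "0 \<le> C" "\<And>q \<alpha> l. 0 < q \<Longrightarrow> \<alpha> \<in> cylinder k n (R + q * (k - 1)) \<Longrightarrow>
    \<bar>\<alpha> l - \<alpha>' l\<bar> \<le> C / real q"
proof -
  let ?P = "map_iter k n R" and ?e = "top_vertex k"
  obtain C where C: "0 \<le> C" "\<And>\<tau>. (\<forall>i. 0 \<le> \<tau> i) \<Longrightarrow> (\<Sum>i<k. ?P \<tau> i) \<le> C * (\<Sum>i<k. \<tau> i)"
    using sum_map_iter_le[of n R] by blast
  have e: "0 \<le> ?e i" for i by (simp add: top_vertex_def)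
  define s where "s = (\<Sum>i<k. ?P ?e i)"
  have s: "1 \<le> s"
    using sum_map_iter_ge[of ?e n R] e top_vertex_simplex unfolding s_def by (simp add: unit_simplex_def)
  have \<alpha>'_eq: "\<alpha>' l = ?P ?e l / s" for l by (simp add: \<alpha>'_def normalise_def s_def)
  have "\<alpha>' \<in> unit_simplex k"
    using normalise_map_iter_cylinder[OF top_vertex_simplex, of n R] by (simp add: \<alpha>'_def cylinder_def)
  then have \<alpha>'_01: "0 \<le> \<alpha>' l" "\<alpha>' l \<le> 1" for l using simplex_le_1 by blast+
  have "\<bar>\<alpha> l - \<alpha>' l\<bar> \<le> C / real q"
    if q: "0 < q" and \<alpha>: "\<alpha> \<in> cylinder k n (R + q * (k - 1))" for q \<alpha> l
  proof -
    have out: "\<And>i. k \<le> i \<Longrightarrow> \<alpha> i = 0" and sum1: "(\<Sum>i<k. \<alpha> i) = 1" and nn: "\<And>i. 0 \<le> \<alpha> i"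
      using \<alpha> simplex_le_1(1)[of \<alpha> k] by (auto simp: cylinder_def unit_simplex_def)
    define \<delta> where "\<delta> = inv_iter k n R \<alpha>"
    define \<gamma> where "\<gamma> = inv_iter k n (R + q * (k - 1)) \<alpha>"
    define T where "T = (\<Sum>i<k-1. \<delta> i)"
    have \<delta>_out: "k \<le> i \<Longrightarrow> \<delta> i = 0" for i unfolding \<delta>_def using out by (rule inv_iter_outside)
    have \<delta>_nn: "0 \<le> \<delta> i" for i
      using \<alpha> cylinder_antimono[of R "R + q * (k - 1)" n] by (auto simp: \<delta>_def cylinder_def)
    have \<gamma>_nn: "0 \<le> \<gamma> i" for i using \<alpha> by (simp add: \<gamma>_def cylinder_def)
    have P\<delta>: "?P \<delta> = \<alpha>" unfolding \<delta>_def using out by (rule map_iter_inv_iter)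
    have "(shift ^^ R) n = (\<lambda>_. 0)" using zero by (simp add: shift_funpow)
    then have "\<gamma> = inv_iter k (\<lambda>_. 0) (q * (k - 1)) \<delta>" by (simp add: \<gamma>_def \<delta>_def inv_iter_add)
    then have \<delta>\<gamma>: "\<delta> = zero_iter (q * (k - 1)) \<gamma>" using map_iter_inv_iter[OF \<delta>_out] by simp
    have T\<gamma>: "T = (\<Sum>i<k-1. \<gamma> i)" unfolding T_def \<delta>\<gamma> by (rule zero_iter_sum)
    have "real q * T \<le> \<delta> (k - 1)"
      using zero_iter_last_mult[of q \<gamma>] \<gamma>_nn[of "k - 1"] unfolding \<delta>\<gamma>[symmetric] T\<gamma> by simp
    also have "\<dots> \<le> (\<Sum>i<k. \<delta> i)" using \<delta>_nn k3 by (intro member_le_sum) auto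
    also have "\<dots> \<le> 1" using sum_map_iter_ge[of \<delta> n R] \<delta>_nn unfolding P\<delta> sum1 by simp
    finally have T: "T \<le> 1 / real q" using q by (simp add: field_simps)
    define \<tau> where "\<tau> = (\<lambda>i. if i < k - 1 then \<delta> i else 0)"
    have \<tau>_nn: "0 \<le> \<tau> i" for i using \<delta>_nn by (simp add: \<tau>_def)
    have "\<delta> = (\<lambda>i. \<delta> (k - 1) * ?e i + 1 * \<tau> i)"
    proof
      fix i show "\<delta> i = \<delta> (k - 1) * ?e i + 1 * \<tau> i"
        using \<delta>_out[of i] k3 by (cases "i < k - 1"; cases "i = k - 1") (auto simp: \<tau>_def top_vertex_def)
    qed
    then have "?P \<delta> = (\<lambda>i. \<delta> (k - 1) * ?P ?e i + 1 * ?P \<tau> i)"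
      using map_iter_linear[of n R "\<delta> (k - 1)" ?e 1 \<tau>] by simp
    then have \<alpha>_eq: "\<alpha> i = \<delta> (k - 1) * ?P ?e i + ?P \<tau> i" for i unfolding P\<delta> by simp
    \<comment> \<open>Total of the error vector. As \<alpha> has total 1, its main part is
      \<open>1 - E\<close> times \<alpha>', which leaves the error
      \<open>?P \<tau> l - E * \<alpha>' l\<close>, a difference of two numbers between 0 and
      \<open>E\<close>.\<close>
    define E where "E = (\<Sum>i<k. ?P \<tau> i)"
    have "(\<Sum>i<k. \<alpha> i) = \<delta> (k - 1) * s + E"
      unfolding \<alpha>_eq s_def E_def by (simp add: sum.distrib sum_distrib_left)
    then have \<delta>s: "\<delta> (k - 1) * s = 1 - E" using sum1 by simp
    have \<delta>P: "\<delta> (k - 1) * ?P ?e l = (\<delta> (k - 1) * s) * \<alpha>' l" using s \<alpha>'_eq by simp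
    have diff: "\<alpha> l - \<alpha>' l = ?P \<tau> l - E * \<alpha>' l"
      unfolding \<alpha>_eq[of l] \<delta>P \<delta>s by (simp add: algebra_simps)
    have P\<tau>: "0 \<le> ?P \<tau> i" for i using \<tau>_nn by (rule map_iter_nonneg)
    have E0: "0 \<le> E" unfolding E_def using P\<tau> by (intro sum_nonneg)
    have "?P \<tau> l \<le> E"
    proof (cases "l < k")
      case True
      then show ?thesis unfolding E_def using P\<tau> by (intro member_le_sum) auto
    next
      case False
      then have "?P \<tau> l = 0" by (intro map_iter_outside) (auto simp: \<tau>_def)
      then show ?thesis using E0 by simp
    qed
    moreover have "0 \<le> E * \<alpha>' l" "E * \<alpha>' l \<le> E"
      using E0 \<alpha>'_01[of l] by (simp_all add: mult_left_le)
    ultimately have "\<bar>\<alpha> l - \<alpha>' l\<bar> \<le> E" unfolding diff using P\<tau>[of l] by linarith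
    also have "E \<le> C * (\<Sum>i<k. \<tau> i)" unfolding E_def using \<tau>_nn by (intro C(2)) blast
    also have "(\<Sum>i<k. \<tau> i) = T"
      unfolding T_def \<tau>_def using k3 by (intro sum.mono_neutral_cong_right) auto
    also have "C * T \<le> C * (1 / real q)" using T C(1) by (rule mult_left_mono)
    finally show ?thesis by simp
  qed
  then show thesis using that C(1) by blast
qed

section \<open>Avoiding rational hyperplanes\<close>

lemma functional_eq_zero:
  assumes "\<And>t. t < k \<Longrightarrow> (\<Sum>i<k. c i * map_iter k n r (unit_vec t) i) = 0" "i < k"
  shows "c i = 0"
  using assms
proof (induction r arbitrary: n c i)
  case 0
  have "(\<Sum>j<k. c j * unit_vec i j) = (\<Sum>j<k. if j = i then c j else 0)"
    by (intro sum.cong) (auto simp: unit_vec_def)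
  then show ?case using 0 by simp
next
  case (Suc r)
  \<comment> \<open>The transposed matrix applied to \<open>c\<close>; it carries the hypothesis to
    a product with one factor less.\<close>
  define d where "d = (\<lambda>i. if i < k - 2 then c (i + 1) else if i = k - 2 then (real (n 0) + 1) * c 0 + c (k - 1)
     else real (n 0) * c 0 + c (k - 1))"
  have ne: "k - 1 \<noteq> k - 2" "\<not> k - 1 < k - 2" using k3 by arith+
  have dual: "(\<Sum>i<k. c i * subst_map k (n 0) \<delta> i) = (\<Sum>i<k. d i * \<delta> i)" for \<delta>
  proof -
    have "(\<Sum>i<k-2. c (i + 1) * subst_map k (n 0) \<delta> (i + 1)) = (\<Sum>i<k-2. d i * \<delta> i)"
      by (intro sum.cong refl) (simp add: subst_map_eqs(2)[simplified] d_def)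
    then show ?thesis
      unfolding sum_split_ends[of "\<lambda>i. c i * subst_map k (n 0) \<delta> i"] sum_split_last2[of "\<lambda>i. d i * \<delta> i"]
        subst_map_eqs using ne by (simp add: d_def algebra_simps)
  qed
  have d0: "d i = 0" if "i < k" for i
    using Suc.prems(1) that unfolding map_iter.simps dual by (rule Suc.IH)
  have e: "(real (n 0) + 1) * c 0 + c (k - 1) = 0" "real (n 0) * c 0 + c (k - 1) = 0"
    using d0[of "k - 2"] d0[of "k - 1"] ne k3 by (auto simp: d_def)
  then have c0: "c 0 = 0" by (simp add: algebra_simps)
  show ?case
  proof (cases i rule: index_cases)
    case (2 j)
    then show ?thesis using d0[of j] by (simp add: d_def)
  qed (use c0 e Suc.prems(2) in auto)
qed

text \<open>The origin of the entry \<open>1\<close> in the next lemma: exponent \<open>1\<close>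
  turns the top vertex into its sum with the unit vector \<open>0\<close>. Each following zero moves
  that unit vector one place on and fixes the top vertex.\<close>

lemma zero_iter_unit:
  "t < k - 1 \<Longrightarrow> zero_iter t (subst_map k 1 (top_vertex k)) = (\<lambda>i. 1 * unit_vec t i + 1 * top_vertex k i)"
proof (induction t)
  case 0
  show ?case
  proof
    fix i
    show "zero_iter 0 (subst_map k 1 (top_vertex k)) i = 1 * unit_vec 0 i + 1 * top_vertex k i"
      using k3 by (auto simp: subst_map_def unit_vec_def top_vertex_def)
  qed
next
  case (Suc t)
  have IH: "zero_iter t (subst_map k 1 (top_vertex k)) = (\<lambda>i. 1 * unit_vec t i + 1 * top_vertex k i)"
    using Suc by simp
  have "subst_map k 0 (\<lambda>i. 1 * unit_vec t i + 1 * top_vertex k i) i = 1 * unit_vec (Suc t) i + 1 * top_vertex k i" for i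
    using Suc.prems k3 by (auto simp: subst_map_def unit_vec_def top_vertex_def)
  then show ?case unfolding map_iter.simps shift_zero IH by (rule ext)
qed

text \<open>Pulled back through the first \<open>r\<close> matrices, the functional is non-zero on
  some unit vector, as the product is invertible. If it is non-zero on the top vertex, a tail of
  zeros suffices; otherwise \<open>t\<close> zeros and a \<open>1\<close> add the unit vector
  \<open>t\<close> to the top vertex.\<close>

lemma extension_off_hyperplane:
  assumes "i < k" "c i \<noteq> 0"
  obtains n' R where "\<And>i. i < r \<Longrightarrow> n' i = n i" "r \<le> R" "\<And>i. R \<le> i \<Longrightarrow> n' i = 0"
    "(\<Sum>i<k. c i * map_iter k n' R (top_vertex k) i) \<noteq> 0"
proof -
  define L where "L = (\<lambda>\<gamma>. \<Sum>i<k. c i * map_iter k n r \<gamma> i)"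
  have lin: "L (\<lambda>i. 1 * \<gamma> i + 1 * \<delta> i) = L \<gamma> + L \<delta>" for \<gamma> \<delta>
    unfolding L_def map_iter_linear by (simp add: sum.distrib algebra_simps)
  obtain t where t: "t < k" "L (unit_vec t) \<noteq> 0"
    using functional_eq_zero[of c n r i] assms unfolding L_def by blast
  have top: "unit_vec (k - 1) = top_vertex k" by (simp add: unit_vec_def top_vertex_def)
  show thesis
  proof (cases "L (top_vertex k) = 0")
    case False
    let ?n = "\<lambda>i. if i < r then n i else 0"
    have "map_iter k ?n r (top_vertex k) = map_iter k n r (top_vertex k)" by (rule map_iter_cong) simp
    then show ?thesis using that[of ?n r] False by (simp add: L_def)
  next
    case True
    then have t': "t < k - 1" using t top by (metis Suc_pred' less_Suc_eq less_nat_zero_code not_gr_zero)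
    let ?n = "\<lambda>i. if i < r then n i else if i = r + t then 1 else 0"
    have "map_iter k ?n (r + Suc t) (top_vertex k)
        = map_iter k ?n r (map_iter k ((shift ^^ r) ?n) (Suc t) (top_vertex k))" by (rule map_iter_add)
    also have "map_iter k ((shift ^^ r) ?n) (Suc t) (top_vertex k)
        = map_iter k ((shift ^^ r) ?n) t (subst_map k ((shift ^^ r) ?n t) (top_vertex k))"
      by (rule map_iter_snoc)
    also have "(shift ^^ r) ?n t = 1" by (simp add: shift_funpow)
    also have "map_iter k ((shift ^^ r) ?n) t (subst_map k 1 (top_vertex k))
        = zero_iter t (subst_map k 1 (top_vertex k))"
      by (rule map_iter_cong) (simp add: shift_funpow)
    also have "\<dots> = (\<lambda>i. 1 * unit_vec t i + 1 * top_vertex k i)" by (rule zero_iter_unit[OF t'])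
    also have "map_iter k ?n r (\<lambda>i. 1 * unit_vec t i + 1 * top_vertex k i)
        = map_iter k n r (\<lambda>i. 1 * unit_vec t i + 1 * top_vertex k i)" by (rule map_iter_cong) simp
    finally have "(\<Sum>i<k. c i * map_iter k ?n (r + Suc t) (top_vertex k) i)
        = L (\<lambda>i. 1 * unit_vec t i + 1 * top_vertex k i)" by (simp add: L_def)
    then have "(\<Sum>i<k. c i * map_iter k ?n (r + Suc t) (top_vertex k) i) \<noteq> 0"
      unfolding lin using True t(2) by simp
    then show ?thesis by (intro that[of ?n "r + Suc t"]) auto
  qed
qed

lemma resolved_extension:
  "\<exists>n' r'. (\<forall>i<r. n' i = n i) \<and> r \<le> r' \<and> resolved k n' r' j"
proof -
  let ?m = "\<lambda>i. real_of_int ((from_nat j :: int list) ! i)"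
  obtain n' R where n': "\<And>i. i < r \<Longrightarrow> n' i = n i" "r \<le> R" "\<And>i. R \<le> i \<Longrightarrow> n' i = 0"
    "(\<exists>i<k. (from_nat j :: int list) ! i \<noteq> 0) \<longrightarrow> (\<Sum>i<k. ?m i * map_iter k n' R (top_vertex k) i) \<noteq> 0"
  proof (cases "\<exists>i<k. (from_nat j :: int list) ! i \<noteq> 0")
    case True
    then obtain i where "i < k" "?m i \<noteq> 0" by auto
    then show ?thesis by (rule extension_off_hyperplane[of i ?m r n]) (use that in blast)
  next
    case False
    then show ?thesis by (intro that[of "\<lambda>i. if i < r then n i else 0" r]) auto
  qed
  define \<alpha>' where "\<alpha>' = normalise k (map_iter k n' R (top_vertex k))"
  obtain C where C: "0 \<le> C" "\<And>q \<alpha> l. 0 < q \<Longrightarrow> \<alpha> \<in> cylinder k n' (R + q * (k - 1)) \<Longrightarrow>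
      \<bar>\<alpha> l - \<alpha>' l\<bar> \<le> C / real q"
    unfolding \<alpha>'_def by (rule cylinder_contraction[OF n'(3)]) blast+
  define v where "v = (\<Sum>i<k. ?m i * \<alpha>' i)"
  define A where "A = (\<Sum>i<k. \<bar>?m i\<bar>)"
  have A: "0 \<le> A" unfolding A_def by (intro sum_nonneg) simp
  have v: "v \<noteq> 0" if "\<exists>i<k. (from_nat j :: int list) ! i \<noteq> 0"
  proof -
    let ?s = "\<Sum>i<k. map_iter k n' R (top_vertex k) i"
    have "1 \<le> ?s"
      using sum_map_iter_ge[of "top_vertex k" n' R] top_vertex_simplex
      by (simp add: unit_simplex_def) (simp add: top_vertex_def)
    moreover have "v = (\<Sum>i<k. ?m i * map_iter k n' R (top_vertex k) i) / ?s"
      by (simp add: v_def \<alpha>'_def normalise_def sum_divide_distrib)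
    ultimately show ?thesis using n'(4) that by simp
  qed
  \<comment> \<open>\<open>v = 0\<close> can happen only if the first \<open>k\<close> coefficients
    vanish, and then there is no hyperplane to avoid; the value \<open>1\<close> keeps the divisor
    positive.\<close>
  define b where "b = (if v = 0 then 1 else \<bar>v\<bar>)"
  have b: "0 < b" by (simp add: b_def)
  \<comment> \<open>The first summand serves the diameter, the second the distance to the
    hyperplane.\<close>
  obtain q where q: "2 * C * real (Suc j) + A * C / b < real q" using reals_Archimedean2 by blast
  have C1: "0 \<le> 2 * C * real (Suc j)" "0 \<le> A * C / b" using C(1) A b by simp_all
  then have q0: "0 < real q" using q by linarith
  have q1: "2 * C / real q < 1 / real (Suc j)"
  proof -
    have "2 * C * real (Suc j) < real q" using q C1 by linarith
    then show ?thesis using q0 by (simp add: field_simps)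
  qed
  have q2: "A * (C / real q) < b"
  proof -
    have "A * C / b < real q" using q C1 by linarith
    then show ?thesis using q0 b by (simp add: field_simps)
  qed
  have "resolved k n' (R + q * (k - 1)) j"
    unfolding resolved_def
  proof (intro conjI ballI allI impI)
    fix \<alpha> \<beta> i assume "\<alpha> \<in> cylinder k n' (R + q * (k - 1))" "\<beta> \<in> cylinder k n' (R + q * (k - 1))"
    then have "\<bar>\<alpha> i - \<alpha>' i\<bar> \<le> C / real q" "\<bar>\<beta> i - \<alpha>' i\<bar> \<le> C / real q" using C(2) q0 by auto
    moreover have "2 * C / real q = C / real q + C / real q" by simp
    ultimately have "\<bar>\<alpha> i - \<beta> i\<bar> \<le> 2 * C / real q" by linarith
    then show "\<bar>\<alpha> i - \<beta> i\<bar> < 1 / real (Suc j)" using q1 by linarith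
  next
    fix \<alpha> assume m: "\<exists>i<k. (from_nat j :: int list) ! i \<noteq> 0" and \<alpha>: "\<alpha> \<in> cylinder k n' (R + q * (k - 1))"
    have "(\<Sum>i<k. ?m i * \<alpha> i) - v = (\<Sum>i<k. ?m i * (\<alpha> i - \<alpha>' i))"
      by (simp add: v_def sum_subtractf algebra_simps)
    also have "\<bar>\<dots>\<bar> \<le> (\<Sum>i<k. \<bar>?m i\<bar> * (C / real q))"
      using C(2)[OF _ \<alpha>] q0
      by (intro order_trans[OF sum_abs] sum_mono) (simp only: abs_mult, intro mult_left_mono, auto)
    also have "\<dots> = A * (C / real q)" by (simp only: A_def sum_distrib_right)
    also have "\<dots> < \<bar>v\<bar>" using q2 v[OF m] by (simp add: b_def)
    finally show "(\<Sum>i<k. ?m i * \<alpha> i) \<noteq> 0" by auto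
  qed
  then show ?thesis using n'(1,2) by (intro exI[of _ n'] exI[of _ "R + q * (k - 1)"]) auto
qed

text \<open>An entry \<open>1\<close> placed behind the resolved prefix does not affect the
  condition, and repeated extension then produces infinitely many non-zero entries.\<close>

lemma resolved_extension_nonzero:
  "\<exists>n' r'. (\<forall>i<r. n' i = n i) \<and> r < r' \<and> resolved k n' r' j \<and> n' (r' - 1) \<noteq> 0"
proof -
  obtain n' r' where n': "\<forall>i<r. n' i = n i" "r \<le> r'" "resolved k n' r' j"
    using resolved_extension[of r n j] by blast
  have "resolved k (n'(r' := 1)) r' j" using n'(3) resolved_cong[of r' n' "n'(r' := 1)" j] by simp
  then have "resolved k (n'(r' := 1)) (Suc r') j" by (rule resolved_mono) simp
  then show ?thesis using n' by (intro exI[of _ "n'(r' := 1)"] exI[of _ "Suc r'"]) auto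
qed

lemma generic_extension:
  obtains n' where "\<And>i. i < r \<Longrightarrow> n' i = n i" "generic k n'" "\<And>N. \<exists>i\<ge>N. n' i \<noteq> 0"
proof -
  \<comment> \<open>A state is a sequence together with the length of the prefix already settled;
    the step from \<open>f j\<close> to \<open>f (Suc j)\<close> resolves condition
    \<open>j\<close>.\<close>
  let ?Q = "\<lambda>j x y. (\<forall>i<snd x. fst y i = fst x i) \<and> snd x < snd y \<and> resolved k (fst y) (snd y) j
      \<and> fst y (snd y - 1) \<noteq> 0"
  have "\<exists>f. \<forall>j. (j = 0 \<longrightarrow> f j = (n, r)) \<and> ?Q j (f j) (f (Suc j))"
  proof (rule dependent_nat_choice)
    show "\<exists>x. (0::nat) = 0 \<longrightarrow> x = (n, r)" by simp
    fix x :: "(nat \<Rightarrow> nat) \<times> nat" and j :: nat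
    show "\<exists>y. (Suc j = 0 \<longrightarrow> y = (n, r)) \<and> ?Q j x y"
      using resolved_extension_nonzero[of "snd x" "fst x" j] by simp
  qed
  then obtain f where f0: "f 0 = (n, r)" and f: "\<And>j. ?Q j (f j) (f (Suc j))" by blast
  have agree: "fst (f j') i = fst (f j) i" if "j \<le> j'" "i < snd (f j)" for i j j'
  proof -
    have "i < snd (f j') \<and> fst (f j') i = fst (f j) i"
      using that(1)
    proof (induction rule: dec_induct)
      case (step l)
      then show ?case using f[of l] by (metis order.strict_trans)
    qed (use that(2) in simp)
    then show ?thesis ..
  qed
  have ge: "j \<le> snd (f j)" for j
  proof (induction j)
    case (Suc j)
    then show ?case using f[of j] by linarith
  qed simp
  \<comment> \<open>The settled length at stage \<open>Suc i\<close> exceeds \<open>i\<close>, so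
    entry \<open>i\<close> is final there.\<close>
  define n' where "n' = (\<lambda>i. fst (f (Suc i)) i)"
  have n': "n' i = fst (f j) i" if "i < snd (f j)" for i j
  proof (cases "j \<le> Suc i")
    case True
    then show ?thesis using agree[of j "Suc i" i] that by (simp add: n'_def)
  next
    case False
    then show ?thesis using agree[of "Suc i" j i] ge[of "Suc i"] by (simp add: n'_def)
  qed
  show thesis
  proof (rule that)
    show "n' i = n i" if "i < r" for i using n'[of i 0] that f0 by simp
    have "resolved k n' (snd (f (Suc j))) j" for j
      using f[of j] resolved_cong[of "snd (f (Suc j))" n' "fst (f (Suc j))" j] n' by blast
    then show "generic k n'" by (auto simp: generic_def)
    show "\<exists>i\<ge>N. n' i \<noteq> 0" for N
    proof (intro exI[of _ "snd (f (Suc N)) - 1"] conjI)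
      show "N \<le> snd (f (Suc N)) - 1" using ge[of "Suc N"] by simp
      show "n' (snd (f (Suc N)) - 1) \<noteq> 0"
        using n'[of "snd (f (Suc N)) - 1" "Suc N"] f[of N] by simp
    qed
  qed
qed

end

section \<open>Open sets in the Hausdorff metric\<close>

lemma edist_le:
  assumes "\<And>i. i < k \<Longrightarrow> \<bar>\<alpha> i - \<beta> i\<bar> \<le> \<epsilon>"
  shows "edist k \<alpha> \<beta> \<le> real k * \<epsilon>"
proof -
  have "edist k \<alpha> \<beta> \<le> (\<Sum>i<k. \<bar>\<alpha> i - \<beta> i\<bar>)" unfolding edist_def by (rule L2_set_le_sum_abs)
  also have "\<dots> \<le> (\<Sum>i<k. \<epsilon>)" using assms by (intro sum_mono) simp
  finally show ?thesis by simp
qed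

context Metric_space
begin

lemma hausdorff_dist_near:
  assumes A: "A \<in> compact_sets M d" and B: "B \<in> compact_sets M d"
    and less: "hausdorff_dist M d A B < \<epsilon>" and a: "a \<in> A"
  shows "\<exists>b\<in>B. d a b < \<epsilon>"
proof -
  have "(INF b\<in>B. d a b) < \<epsilon>"
    using inf_dist_le_excess[OF A B a] less A B by (simp add: hausdorff_dist_def)
  moreover have "B \<noteq> {}" using B by (simp add: compact_sets_def)
  moreover have "bdd_below (d a ` B)" by (intro bdd_belowI2[where m = 0]) auto
  ultimately show ?thesis using cINF_less_iff[of B "d a" \<epsilon>] by auto
qed

lemma hausdorff_dist_le:
  assumes A: "A \<in> compact_sets M d" and B: "B \<in> compact_sets M d"
    and ab: "\<And>a. a \<in> A \<Longrightarrow> \<exists>b\<in>B. d a b \<le> \<epsilon>" and ba: "\<And>b. b \<in> B \<Longrightarrow> \<exists>a\<in>A. d b a \<le> \<epsilon>"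
  shows "hausdorff_dist M d A B \<le> \<epsilon>"
proof -
  have "(SUP x\<in>X. INF y\<in>Y. d x y) \<le> \<epsilon>"
    if "X \<noteq> {}" and near: "\<And>x. x \<in> X \<Longrightarrow> \<exists>y\<in>Y. d x y \<le> \<epsilon>" for X Y
    using that(1)
  proof (rule cSUP_least)
    fix x assume "x \<in> X"
    then obtain y where y: "y \<in> Y" "d x y \<le> \<epsilon>" using near by blast
    show "(INF y\<in>Y. d x y) \<le> \<epsilon>" using inf_dist_le[OF y(1), of x] y(2) by linarith
  qed
  then show ?thesis
    using A B ab ba by (simp add: hausdorff_dist_alt) (simp add: compact_sets_def)
qed

lemma compact_sets_separation:
  assumes X: "X \<in> compact_sets M d" and a: "a \<in> M" "a \<notin> X"
  obtains r where "0 < r" "\<And>x. x \<in> X \<Longrightarrow> r \<le> d a x"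
proof -
  have "closedin mtopology X"
    using X by (auto simp: compact_sets_def compactin_imp_closedin Hausdorff_space_mtopology)
  then have "openin mtopology (M - X)" by (simp add: closedin_def)
  then obtain r where r: "0 < r" "mball a r \<subseteq> M - X" using a unfolding openin_mtopology by blast
  have "r \<le> d a x" if "x \<in> X" for x
  proof (rule ccontr)
    assume "\<not> r \<le> d a x"
    then have "x \<in> mball a r" using a that compact_sets_subset[OF X] by auto
    then show False using r(2) that by blast
  qed
  then show thesis using that r(1) by blast
qed

text \<open>A point of \<open>A\<close> outside the compact set \<open>X\<close> has positive
  distance from \<open>X\<close>, and no set containing this point can be closer to
  \<open>X\<close>.\<close>

lemma openin_not_superset:
  assumes "A \<subseteq> M"
  shows "openin (Metric_space.mtopology (compact_sets M d) (hausdorff_dist M d))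
           {X \<in> compact_sets M d. \<not> A \<subseteq> X}"
proof -
  interpret H: Metric_space "compact_sets M d" "hausdorff_dist M d"
    by (rule Metric_space_hausdorff_dist)
  show ?thesis
    unfolding H.openin_mtopology
  proof (intro conjI allI impI)
    fix X assume "X \<in> {X \<in> compact_sets M d. \<not> A \<subseteq> X}"
    then obtain a where X: "X \<in> compact_sets M d" and a: "a \<in> A" "a \<notin> X" by blast
    obtain r where r: "0 < r" "\<And>x. x \<in> X \<Longrightarrow> r \<le> d a x"
      using compact_sets_separation[OF X] a assms by blast
    have "a \<notin> Y" if Y: "Y \<in> compact_sets M d" "hausdorff_dist M d X Y < r" for Y
    proof
      assume "a \<in> Y"
      then obtain x where "x \<in> X" "d a x < r"
        using hausdorff_dist_near[OF Y(1) X, of r a] Y(2) H.commute by metis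
      then show False using r(2)[of x] by linarith
    qed
    then have "H.mball X r \<subseteq> {X \<in> compact_sets M d. \<not> A \<subseteq> X}" using a(1) by auto
    then show "\<exists>r>0. H.mball X r \<subseteq> {X \<in> compact_sets M d. \<not> A \<subseteq> X}" using r(1) by blast
  qed auto
qed

text \<open>A set close to \<open>X\<close> has a point near a given point of \<open>X\<close>
  outside the compact set \<open>B\<close>, hence a point outside \<open>B\<close>.\<close>

lemma openin_not_subset:
  assumes B: "B \<in> compact_sets M d"
  shows "openin (Metric_space.mtopology (compact_sets M d) (hausdorff_dist M d))
           {X \<in> compact_sets M d. \<not> X \<subseteq> B}"
proof -
  interpret H: Metric_space "compact_sets M d" "hausdorff_dist M d"
    by (rule Metric_space_hausdorff_dist)
  show ?thesis
    unfolding H.openin_mtopology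
  proof (intro conjI allI impI)
    fix X assume "X \<in> {X \<in> compact_sets M d. \<not> X \<subseteq> B}"
    then obtain x where X: "X \<in> compact_sets M d" and x: "x \<in> X" "x \<notin> B" by blast
    obtain r where r: "0 < r" "\<And>b. b \<in> B \<Longrightarrow> r \<le> d x b"
      using compact_sets_separation[OF B] x compact_sets_subset[OF X] by blast
    have "\<not> Y \<subseteq> B" if Y: "Y \<in> compact_sets M d" "hausdorff_dist M d X Y < r" for Y
      using hausdorff_dist_near[OF X Y(1,2) x(1)] r(2) by (meson linorder_not_le subsetD)
    then have "H.mball X r \<subseteq> {X \<in> compact_sets M d. \<not> X \<subseteq> B}" by auto
    then show "\<exists>r>0. H.mball X r \<subseteq> {X \<in> compact_sets M d. \<not> X \<subseteq> B}" using r(1) by blast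
  qed auto
qed

end

lemma less_fun_cases: "less_fun f g \<or> f = g \<or> less_fun g f" for f g :: "nat \<Rightarrow> nat"
proof (cases "f = g")
  case False
  then have ex: "\<exists>i. f i \<noteq> g i" by (simp add: fun_eq_iff)
  define i where "i = (LEAST i. f i \<noteq> g i)"
  have "f i \<noteq> g i" using LeastI_ex[OF ex] by (simp add: i_def)
  moreover have "f j = g j" if "j < i" for j using not_less_Least[OF that[unfolded i_def]] by blast
  ultimately show ?thesis unfolding less_fun_def by (metis linorder_neqE_nat)
qed simp

lemma less_fun_between:
  assumes "less_fun a n" "less_fun n b" "\<And>i. i < r \<Longrightarrow> a i = b i" "i < r"
  shows "n i = a i"
proof -
  obtain p where p: "a p < n p" "\<And>i. i < p \<Longrightarrow> a i = n i" using assms(1) by (auto elim: less_funE)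
  obtain q where q: "n q < b q" "\<And>i. i < q \<Longrightarrow> n i = b i" using assms(2) by (auto elim: less_funE)
  have "\<not> p < r"
  proof
    assume pr: "p < r"
    consider "p < q" | "q \<le> p" by (rule le_less_linear[THEN disjE, of q p])
    then show False
    proof cases
      case 1
      then show False using p(1) q(2)[of p] assms(3)[OF pr] by simp
    next
      case 2
      then have "a q \<le> n q" using p by (cases "q = p") auto
      then show False using q(1) assms(3)[of q] 2 pr by simp
    qed
  qed
  then show ?thesis using p(2) assms(4) by simp
qed

section \<open>The sets \<open>DF k n\<close> in the Hausdorff metric\<close>

context alphabet
begin

lemma DF_compact: "DF k n \<in> compact_sets (unit_simplex k) (edist k)"
proof -
  interpret S: Metric_space "unit_simplex k" "edist k" by (rule Metric_space_simplex)
  have "\<exists>l \<phi>. l \<in> DF k n \<and> strict_mono \<phi> \<and> limitin S.mtopology (f \<circ> \<phi>) l sequentially"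
    if f: "range f \<subseteq> DF k n" for f :: "nat \<Rightarrow> nat \<Rightarrow> real"
  proof -
    have f': "f t \<in> DF k n" for t using f by blast
    then have fs: "f t \<in> unit_simplex k" for t by (rule DF_simplex)
    then obtain l and \<phi> :: "nat \<Rightarrow> nat" where l: "l \<in> unit_simplex k" "strict_mono \<phi>"
      "\<And>i. (\<lambda>t. f (\<phi> t) i) \<longlonglongrightarrow> l i"
      using simplex_convergent_subseq[of f k] by blast
    have near: "\<exists>N. \<forall>t\<ge>N. \<forall>i<k. \<bar>f (\<phi> t) i - l i\<bar> < \<epsilon>" if \<epsilon>: "0 < \<epsilon>" for \<epsilon>
    proof -
      obtain N where "\<And>t i. N \<le> t \<Longrightarrow> i < k \<Longrightarrow> \<bar>f (\<phi> t) i - l i\<bar> < \<epsilon>"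
        by (rule coordinates_eventually_near[of k "\<lambda>t. f (\<phi> t)" l \<epsilon>]) (use l(3) \<epsilon> in auto)
      then show ?thesis by blast
    qed
    have "l \<in> DF k n"
    proof (rule DF_closed[OF l(1)])
      fix \<epsilon> :: real assume "0 < \<epsilon>"
      then obtain N where "\<forall>t\<ge>N. \<forall>i<k. \<bar>f (\<phi> t) i - l i\<bar> < \<epsilon>" using near by blast
      then show "\<exists>\<beta>\<in>DF k n. \<forall>i<k. \<bar>\<beta> i - l i\<bar> < \<epsilon>" using f'[of "\<phi> N"] by blast
    qed
    moreover have "limitin S.mtopology (f \<circ> \<phi>) l sequentially"
      unfolding S.limitin_metric
    proof (intro conjI allI impI l(1))
      fix \<epsilon> :: real assume "0 < \<epsilon>"
      \<comment> \<open>The Euclidean distance is at most \<open>k\<close> times a bound for the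
        coordinate differences.\<close>
      define \<eta> where "\<eta> = \<epsilon> / (2 * real k)"
      have \<eta>: "0 < \<eta>" "real k * \<eta> < \<epsilon>" using \<open>0 < \<epsilon>\<close> k3 by (auto simp: \<eta>_def field_simps)
      obtain N where N: "\<forall>t\<ge>N. \<forall>i<k. \<bar>f (\<phi> t) i - l i\<bar> < \<eta>" using near \<eta>(1) by blast
      have "edist k (f (\<phi> t)) l < \<epsilon>" if "N \<le> t" for t
        using edist_le[of k "f (\<phi> t)" l \<eta>] N that \<eta>(2) by (force intro: less_imp_le)
      then show "\<forall>\<^sub>F t in sequentially. (f \<circ> \<phi>) t \<in> unit_simplex k \<and> edist k ((f \<circ> \<phi>) t) l < \<epsilon>"
        using fs by (auto simp: eventually_sequentially)
    qed
    ultimately show ?thesis using l(2) by blast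
  qed
  moreover have "DF k n \<subseteq> unit_simplex k" using DF_simplex by blast
  ultimately show ?thesis
    using DF_nonempty unfolding compact_sets_def S.compactin_sequentially by blast
qed

lemma topspace_DF_top: "topspace (DF_top k) = DF_sets k"
proof -
  interpret H: Metric_space "compact_sets (unit_simplex k) (edist k)" "hausdorff_dist (unit_simplex k) (edist k)"
    by (rule Metric_space.Metric_space_hausdorff_dist[OF Metric_space_simplex])
  show ?thesis using DF_compact by (auto simp: DF_top_def compact_simplex_top_def DF_sets_def)
qed

text \<open>A lexicographic interval expressed by inclusions alone, so that openness follows from
  the Hausdorff metric without choosing a sequence for \<open>X\<close>;
  \<open>DF_interval_iff\<close> translates back.\<close>

definition DF_interval :: "(nat \<Rightarrow> nat) \<Rightarrow> (nat \<Rightarrow> nat) \<Rightarrow> (nat \<Rightarrow> real) set set" where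
  "DF_interval a b = {X \<in> DF_sets k. \<not> DF k a \<subseteq> X \<and> \<not> X \<subseteq> DF k b}"

lemma openin_DF_interval: "openin (DF_top k) (DF_interval a b)"
proof -
  interpret S: Metric_space "unit_simplex k" "edist k" by (rule Metric_space_simplex)
  let ?C = "compact_sets (unit_simplex k) (edist k)"
  have "DF_interval a b = ({X \<in> ?C. \<not> DF k a \<subseteq> X} \<inter> {X \<in> ?C. \<not> X \<subseteq> DF k b}) \<inter> DF_sets k"
    using DF_compact by (auto simp: DF_interval_def DF_sets_def)
  moreover have "openin (compact_simplex_top k) ({X \<in> ?C. \<not> DF k a \<subseteq> X} \<inter> {X \<in> ?C. \<not> X \<subseteq> DF k b})"
    unfolding compact_simplex_top_def using DF_simplex DF_compact
    by (intro openin_Int S.openin_not_superset S.openin_not_subset) auto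
  ultimately show ?thesis unfolding DF_top_def openin_subtopology by blast
qed

lemma DF_interval_iff:
  assumes "n \<noteq> (\<lambda>_. 0)"
  shows "DF k n \<in> DF_interval a b \<longleftrightarrow> less_fun a n \<and> less_fun n b"
proof
  assume "DF k n \<in> DF_interval a b"
  then have "\<not> DF k a \<subseteq> DF k n" "\<not> DF k n \<subseteq> DF k b" by (auto simp: DF_interval_def)
  then show "less_fun a n \<and> less_fun n b"
    using less_fun_cases[of a n] less_fun_cases[of n b] DF_antimono by blast
next
  assume "less_fun a n \<and> less_fun n b"
  then show "DF k n \<in> DF_interval a b"
    using DF_not_subset assms by (auto simp: DF_interval_def DF_sets_def)
qed

lemma DF_hausdorff_near:
  assumes "\<And>i. i < q * (k - 1) \<Longrightarrow> n i = n' i" "0 < q"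
  shows "hausdorff_dist (unit_simplex k) (edist k) (DF k n) (DF k n') \<le> real k * (2 / real q)"
proof -
  interpret S: Metric_space "unit_simplex k" "edist k" by (rule Metric_space_simplex)
  have near: "\<exists>\<beta>\<in>DF k b. edist k \<alpha> \<beta> \<le> real k * (2 / real q)"
    if ab: "\<And>i. i < q * (k - 1) \<Longrightarrow> a i = b i" "\<alpha> \<in> DF k a" for a b \<alpha>
  proof -
    obtain \<beta> where "\<beta> \<in> DF k b" "\<forall>i<k. \<bar>\<beta> i - \<alpha> i\<bar> \<le> 2 / real q"
      using DF_near[OF ab(1) assms(2) ab(2)] by blast
    then show ?thesis by (intro bexI[of _ \<beta>] edist_le) (simp_all add: abs_minus_commute)
  qed
  show ?thesis
    using near[of n n'] near[of n' n] assms(1) by (intro S.hausdorff_dist_le DF_compact) auto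
qed

text \<open>The condition is imposed on every sequence of the interval. This makes the set open by
  construction and lets the condition be recovered for whichever sequence represents a
  member.\<close>

definition generic_DF :: "nat \<Rightarrow> (nat \<Rightarrow> real) set set" where
  "generic_DF j = \<Union>{DF_interval a b | a b. \<forall>n. less_fun a n \<longrightarrow> less_fun n b \<longrightarrow> (\<exists>r. resolved k n r j)}"

lemma generic_in_generic_DF:
  assumes "generic k n" "\<And>N. \<exists>i\<ge>N. n i \<noteq> 0"
  shows "DF k n \<in> generic_DF j"
proof -
  obtain r where r: "resolved k n r j" using assms(1) by (auto simp: generic_def)
  obtain i where i: "r \<le> i" "n i \<noteq> 0" using assms(2) by blast
  \<comment> \<open>Both bounds change a single entry beyond the resolved prefix, so every sequence
    between them keeps that prefix. The lower bound needs a non-zero entry to decrease, which is why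
    \<open>n\<close> must have such entries arbitrarily far out.\<close>
  let ?a = "n(i := n i - 1)" and ?b = "n(i := n i + 1)"
  have "less_fun ?a n" "less_fun n ?b" using i(2) by (auto intro!: less_funI exI[of _ i])
  moreover have "n \<noteq> (\<lambda>_. 0)" using i(2) by auto
  ultimately have "DF k n \<in> DF_interval ?a ?b" by (simp add: DF_interval_iff)
  moreover have "resolved k n' r j" if "less_fun ?a n'" "less_fun n' ?b" for n'
  proof -
    have "n' l = n l" if "l < r" for l
      using less_fun_between[OF \<open>less_fun ?a n'\<close> \<open>less_fun n' ?b\<close>, of r l] that i(1) by simp
    then show ?thesis using r resolved_cong[of r n' n j] by simp
  qed
  ultimately show ?thesis unfolding generic_DF_def by blast
qed

lemma generic_DF_imp:
  assumes "\<And>j. X \<in> generic_DF j"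
  shows "X \<in> Reg_D k \<inter> CI_D k"
proof -
  have "X \<in> DF_sets k" using assms[of 0] by (auto simp: generic_DF_def DF_interval_def)
  then obtain n where n: "n \<noteq> (\<lambda>_. 0)" "X = DF k n" by (auto simp: DF_sets_def)
  \<comment> \<open>\<open>n\<close> is chosen once for all \<open>j\<close>; only the intervals
    vary with \<open>j\<close>.\<close>
  have "\<exists>r. resolved k n r j" for j
    using assms[of j] unfolding generic_DF_def n(2) using DF_interval_iff[OF n(1)] by blast
  then have gen: "generic k n" by (simp add: generic_def)
  obtain \<alpha> where \<alpha>: "\<alpha> \<in> unit_simplex' k" "itinerary k \<alpha> = n" by (rule itinerary_surj)
  then have "regular k \<alpha>" "completely_irrational k \<alpha>" using generic_imp[of \<alpha>] gen by simp_all
  then show ?thesis using \<alpha> n(2) unfolding Reg_D_def CI_D_def by blast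
qed

text \<open>Every prefix extends to a generic sequence with infinitely many non-zero entries, whose
  set lies in all \<open>generic_DF j\<close> at once and, for a long prefix, Hausdorff-close to the
  given set.\<close>

lemma generic_DF_dense: "DF_top k closure_of (\<Inter>j. generic_DF j) = DF_sets k"
proof
  show "DF_top k closure_of (\<Inter>j. generic_DF j) \<subseteq> DF_sets k"
    using closure_of_subset_topspace topspace_DF_top by metis
  interpret H: Metric_space "compact_sets (unit_simplex k) (edist k)" "hausdorff_dist (unit_simplex k) (edist k)"
    by (rule Metric_space.Metric_space_hausdorff_dist[OF Metric_space_simplex])
  show "DF_sets k \<subseteq> DF_top k closure_of (\<Inter>j. generic_DF j)"
  proof
    fix X assume X: "X \<in> DF_sets k"
    then obtain n where n: "X = DF k n" by (auto simp: DF_sets_def)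
    show "X \<in> DF_top k closure_of (\<Inter>j. generic_DF j)"
      unfolding in_closure_of topspace_DF_top
    proof (intro conjI X allI impI)
      fix T assume "X \<in> T \<and> openin (DF_top k) T"
      then obtain U where U: "openin H.mtopology U" "T = U \<inter> DF_sets k" "X \<in> U"
        unfolding DF_top_def compact_simplex_top_def openin_subtopology by blast
      then obtain \<epsilon> where \<epsilon>: "0 < \<epsilon>" "H.mball X \<epsilon> \<subseteq> U" unfolding H.openin_mtopology by blast
      obtain q where q: "2 * real k / \<epsilon> < real q" using reals_Archimedean2 by blast
      moreover have "0 \<le> 2 * real k / \<epsilon>" using \<epsilon>(1) by simp
      ultimately have q0: "0 < q" by linarith
      obtain n' where n': "\<And>i. i < q * (k - 1) \<Longrightarrow> n' i = n i" "generic k n'" "\<And>N. \<exists>i\<ge>N. n' i \<noteq> 0"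
        by (rule generic_extension[of "q * (k - 1)" n]) blast
      have "hausdorff_dist (unit_simplex k) (edist k) (DF k n) (DF k n') \<le> real k * (2 / real q)"
        using n'(1) q0 by (intro DF_hausdorff_near) auto
      also have "\<dots> < \<epsilon>" using q q0 \<epsilon>(1) by (simp add: field_simps)
      finally have "DF k n' \<in> U" using \<epsilon>(2) DF_compact n by auto
      moreover have "DF k n' \<in> generic_DF j" for j using n'(2,3) by (rule generic_in_generic_DF)
      moreover have "n' \<noteq> (\<lambda>_. 0)" using n'(3)[of 0] by auto
      then have "DF k n' \<in> DF_sets k" by (auto simp: DF_sets_def)
      ultimately show "\<exists>Y. Y \<in> (\<Inter>j. generic_DF j) \<and> Y \<in> T" using U(2) by blast
    qed
  qed
qed

lemma generic_DF_gdelta: "gdelta_in (DF_top k) (\<Inter>j. generic_DF j)"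
proof (rule gdelta_in_Inter)
  fix S assume "S \<in> range generic_DF"
  then have "openin (DF_top k) S" 
    unfolding generic_DF_def using openin_DF_interval by (auto intro!: openin_Union)
  then show "gdelta_in (DF_top k) S" by (rule open_imp_gdelta_in)
qed auto

end

theorem theorem51:
  fixes k :: nat
  assumes "k \<ge> 3"
  shows "\<exists>G. gdelta_in (DF_top k) G \<and> DF_top k closure_of G = DF_sets k \<and>
             G \<subseteq> Reg_D k \<inter> CI_D k"
proof -
  interpret alphabet k by unfold_locales (rule assms)
  show ?thesis
  proof (intro exI conjI)
    show "gdelta_in (DF_top k) (\<Inter>j. generic_DF j)" by (rule generic_DF_gdelta)
    show "DF_top k closure_of (\<Inter>j. generic_DF j) = DF_sets k" by (rule generic_DF_dense)
    show "(\<Inter>j. generic_DF j) \<subseteq> Reg_D k \<inter> CI_D k" using generic_DF_imp by blast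
  qed
qed

end
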